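(* Let $J\ge2$ and let $X=(X_n)_{n\le N}$ come from the $J$-state hidden Markov model described in the context with $\mu$ Lebesgue measure on $\mathbb R$, with parameters satisfying Assumptions A2', A3 and A4 (for some $s>0$). Let $r_N=(N/\log N)^{-s/(1+2s)}$ and suppose $L_0=L_0(N)\to\infty$ with $L_0^{\max(5,(J+3)/2)}r_N\to0$. Then there exist estimators $\hat f_1,\dots,\hat f_J$ (functions of $X$ which are continuous functions on $\mathbb R$) and a permutation $\tau$ of $\{1,\dots,J\}$ such that, for some $C>0$ and each $j\le J$, $$\Pi_H\big(\|\hat f_j-f_{\tau(j)}\|_\infty\ge CL_0^5r_N\big)\to0,$$ and, for some $C'>0$ and each $j\le J$, $E_H\|\hat f_j-f_{\tau(j)}\|_\infty\le C'L_0^5r_N$.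
   Context: $J$-state hidden Markov model: $\theta=(\theta_n)_{n\le N}$ is a Markov chain on $\{1,\dots,J\}$ with transition matrix $Q$ and initial distribution $\pi$; conditionally on $\theta$, the $X_n$ are independent with densities $f_{\theta_n}$ with respect to $\mu$. $\Pi_H,E_H$ denote the law and expectation for $H=(Q,\pi,f_1,\dots,f_J)$. Assumption A2': $Q$ has full rank, the chain is irreducible and aperiodic, and $\theta_1$ follows the invariant distribution. Assumption A3: $f_1,\dots,f_J$ are linearly independent. Assumption A4: $f_1,\dots,f_J\in C^s(\mathbb R)$, where, with $C^0(\mathbb R)$ the bounded continuous functions, for $s\in(0,1)$ $C^s(\mathbb R)=\{f\in C^0:\sup_{0<|x-y|\le1}|f(x)-f(y)|/|x-y|^s<\infty\}$, and for $s\ge1$ $C^s(\mathbb R)=\{f: f^{(\lfloor s\rfloor)}\in C^{s-\lfloor s\rfloor}(\mathbb R)\}$ (with the usual Hölder norms). *)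

theory Defs
  imports "HOL-Probability.Probability"
begin

text \<open>States are indexed by 0,...,J-1; observations X_1..X_N are indexed by 0,...,N-1.\<close>

fun mpow :: "nat \<Rightarrow> (nat \<Rightarrow> nat \<Rightarrow> real) \<Rightarrow> nat \<Rightarrow> nat \<Rightarrow> nat \<Rightarrow> real" where
  "mpow J Q 0 = (\<lambda>i j. if i = j then 1 else 0)"
| "mpow J Q (Suc n) = (\<lambda>i j. \<Sum>l<J. mpow J Q n i l * Q l j)"

definition stochastic_matrix :: "nat \<Rightarrow> (nat \<Rightarrow> nat \<Rightarrow> real) \<Rightarrow> bool" where
  "stochastic_matrix J Q \<longleftrightarrow>
     (\<forall>i<J. \<forall>j<J. 0 \<le> Q i j) \<and> (\<forall>i<J. (\<Sum>j<J. Q i j) = 1)"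

definition full_rank :: "nat \<Rightarrow> (nat \<Rightarrow> nat \<Rightarrow> real) \<Rightarrow> bool" where
  "full_rank J Q \<longleftrightarrow>
     (\<forall>v::nat \<Rightarrow> real. (\<forall>j<J. (\<Sum>i<J. v i * Q i j) = 0) \<longrightarrow> (\<forall>i<J. v i = 0))"

definition irreducible_chain :: "nat \<Rightarrow> (nat \<Rightarrow> nat \<Rightarrow> real) \<Rightarrow> bool" where
  "irreducible_chain J Q \<longleftrightarrow> (\<forall>i<J. \<forall>j<J. \<exists>n>0. mpow J Q n i j > 0)"

definition aperiodic_chain :: "nat \<Rightarrow> (nat \<Rightarrow> nat \<Rightarrow> real) \<Rightarrow> bool" where
  "aperiodic_chain J Q \<longleftrightarrow> (\<forall>i<J. Gcd {n::nat. n > 0 \<and> mpow J Q n i i > 0} = 1)"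

definition invariant_distribution :: "nat \<Rightarrow> (nat \<Rightarrow> nat \<Rightarrow> real) \<Rightarrow> (nat \<Rightarrow> real) \<Rightarrow> bool" where
  "invariant_distribution J Q p \<longleftrightarrow>
     (\<forall>i<J. 0 \<le> p i) \<and> (\<Sum>i<J. p i) = 1 \<and> (\<forall>j<J. (\<Sum>i<J. p i * Q i j) = p j)"

definition prob_density :: "(real \<Rightarrow> real) \<Rightarrow> bool" where
  "prob_density g \<longleftrightarrow> g \<in> borel_measurable borel \<and> (\<forall>x. 0 \<le> g x) \<and>
     integrable lborel g \<and> integral\<^sup>L lborel g = 1"

definition lin_indep_funs :: "nat \<Rightarrow> (nat \<Rightarrow> real \<Rightarrow> real) \<Rightarrow> bool" where
  "lin_indep_funs J f \<longleftrightarrow>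
     (\<forall>c::nat \<Rightarrow> real. (\<forall>x. (\<Sum>j<J. c j * f j x) = 0) \<longrightarrow> (\<forall>j<J. c j = 0))"

definition holder_frac :: "real \<Rightarrow> (real \<Rightarrow> real) \<Rightarrow> bool" where
  "holder_frac a g \<longleftrightarrow> bounded (range g) \<and> continuous_on UNIV g \<and>
     (a > 0 \<longrightarrow> (\<exists>M. \<forall>x y. 0 < \<bar>x - y\<bar> \<and> \<bar>x - y\<bar> \<le> 1 \<longrightarrow> \<bar>g x - g y\<bar> \<le> M * \<bar>x - y\<bar> powr a))"

definition holder_space :: "real \<Rightarrow> (real \<Rightarrow> real) set" where
  "holder_space s = {g. let k = nat \<lfloor>s\<rfloor> in
      (\<forall>m<k. \<forall>x. (deriv ^^ m) g differentiable (at x)) \<and> holder_frac (s - real k) ((deriv ^^ k) g)}"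

definition hmm_law :: "nat \<Rightarrow> (nat \<Rightarrow> nat \<Rightarrow> real) \<Rightarrow> (nat \<Rightarrow> real) \<Rightarrow> (nat \<Rightarrow> real \<Rightarrow> real)
     \<Rightarrow> nat \<Rightarrow> (nat \<Rightarrow> real) measure" where
  "hmm_law J Q p f N = density (PiM {..<N} (\<lambda>_. lborel))
     (\<lambda>x. ennreal (\<Sum>k\<in>PiE {..<N} (\<lambda>_. {..<J}).
        p (k 0) * (\<Prod>i<N - 1. Q (k i) (k (Suc i))) * (\<Prod>i<N. f (k i) (x i))))"

definition hmm_params :: "nat \<Rightarrow> real \<Rightarrow> (nat \<Rightarrow> nat \<Rightarrow> real) \<Rightarrow> (nat \<Rightarrow> real) \<Rightarrow> (nat \<Rightarrow> real \<Rightarrow> real) \<Rightarrow> bool" where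
  "hmm_params J s Q p f \<longleftrightarrow>
     stochastic_matrix J Q \<and> (\<forall>j<J. prob_density (f j)) \<and>
     full_rank J Q \<and> irreducible_chain J Q \<and> aperiodic_chain J Q \<and> invariant_distribution J Q p \<and>
     lin_indep_funs J f \<and>
     (\<forall>j<J. f j \<in> holder_space s)"

definition rate :: "real \<Rightarrow> nat \<Rightarrow> real" where
  "rate s N = (real N / ln (real N)) powr (- s / (1 + 2 * s))"

definition sup_dist :: "(real \<Rightarrow> real) \<Rightarrow> (real \<Rightarrow> real) \<Rightarrow> ennreal" where
  "sup_dist g h = (SUP x. ennreal \<bar>g x - h x\<bar>)"

definition valid_estimator :: "nat \<Rightarrow> (nat \<Rightarrow> (nat \<Rightarrow> real) \<Rightarrow> nat \<Rightarrow> real \<Rightarrow> real) \<Rightarrow> bool" where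
  "valid_estimator J fh \<longleftrightarrow>
     (\<forall>N X j. j < J \<longrightarrow> continuous_on UNIV (fh N X j)) \<and>
     (\<forall>N j x. j < J \<longrightarrow> (\<lambda>X. fh N X j x) \<in> borel_measurable (PiM {..<N} (\<lambda>_. lborel)))"

end

theory Submission
  imports Defs "Jordan_Normal_Form.Determinant" "HOL-Real_Asymp.Real_Asymp"
begin

text \<open>Let F_0 = 1 and let F_1, F_2, ... be the indicators of the rational half-lines. Given the middle
  state b of three consecutive observations X1, X2, X3, these are independent. By linear independence
  of the densities and full rank of the transition matrix, the means of the F_n under the laws of X3 and
  of X2 separate the states. So if a linear combination g of the F_i satisfies E g(X1) = 1 and
  E[g(X1) (F_m(X2) - lam_m) F_n(X3)] = 0 for all m and n, then E[g(X1) | b] vanishes for all states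
  but one, whose F_m-means are the lam_m; and E[g(X1) k(X2)] is the mean of k in that state.
  The estimator fits g and lam by minimising the sum of the absolute empirical residuals over a finite
  grid, fixes the labels by the lexicographic order of the lam, and takes for k a smoothing kernel of high
  order. Such a fit is stable, so its error is bounded by the errors of the empirical moments.
  These come from disjoint triples of observations, which are independent given the states; the
  frequencies of the state triples concentrate since the three-step chain has a solution of its
  Poisson equation, and the supremum over the line is bounded by integrating the hyperbolic cosine of
  the Lipschitz error process. The expected error is of order L0^2 times the rate, and the bound in
  probability follows by Markov's inequality.\<close>

text \<open>The number of half-lines that separate the states, the gap between their means and the
  norm of the coefficients of g depend on the unknown parameters, while the estimator must not. It
  therefore uses one slowly growing integer l as number of test functions, as bound on the
  coefficients and, through 1/l, as margin in the ordering; eventually l passes every fixed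
  threshold. Capping l by the logarithm of N keeps every power of l times the parametric error
  1/sqrt N below the nonparametric rate, so only the l kernel averages, each weighted by at most l,
  cost anything: hence L0^2. The stability bound holds on every sample: when the fit is too poor to
  identify the states, the trivial bound is already below the claimed error. Expectations are thus
  bounded without a good event. The supremum over the line is paid by Tonelli, since the integrated
  second moment of a kernel window is finite whatever the tails of the densities.\<close>

section \<open>Finite dual families and inverse matrices\<close>

text \<open>Independent rows, even of infinite length, are told apart by finitely many columns.
  Induction on J: the new row minus its expansion along the old ones, with coefficients given by the
  old functionals, is nonzero at some column, and evaluation there supplies the next
  functional.\<close>

lemma dual_family:
  fixes F :: "nat \<Rightarrow> nat \<Rightarrow> real"
  assumes "\<And>v. (\<forall>l. (\<Sum>b<J. v b * F b l) = 0) \<Longrightarrow> \<forall>b<J. v b = 0"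
  shows "\<exists>L d. (\<forall>j<J. \<forall>l\<ge>L. d j l = 0) \<and>
    (\<forall>j<J. \<forall>b<J. (\<Sum>l<L. d j l * F b l) = (if j = b then 1 else (0::real)))"
  using assms
proof (induction J)
  case 0
  then show ?case by auto
next
  case (Suc J)
  have "\<forall>b<J. v b = 0" if v: "\<forall>l. (\<Sum>b<J. v b * F b l) = 0" for v
  proof -
    have "(\<Sum>b<J. (if b < J then v b else 0) * F b l) = (\<Sum>b<J. v b * F b l)" for l
      by (intro sum.cong) auto
    with v have "\<forall>l. (\<Sum>b<Suc J. (if b < J then v b else 0) * F b l) = 0"
      by simp
    from Suc.prems[OF this] show ?thesis
      by (metis less_Suc_eq)
  qed
  from Suc.IH[OF this] obtain L d where
    d0: "\<And>j l. j < J \<Longrightarrow> l \<ge> L \<Longrightarrow> d j l = 0" and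
    d1: "\<And>j b. j < J \<Longrightarrow> b < J \<Longrightarrow> (\<Sum>l<L. d j l * F b l) = (if j = b then 1 else 0)"
    by blast
  define \<alpha> where "\<alpha> j = (\<Sum>l<L. d j l * F J l)" for j
  define G where "G l = F J l - (\<Sum>j<J. \<alpha> j * F j l)" for l
  have "\<exists>l. G l \<noteq> 0"
  proof (rule ccontr)
    assume "\<not> ?thesis"
    then have G0: "G l = 0" for l by auto
    define v where "v b = (if b < J then - \<alpha> b else 1)" for b
    have "(\<Sum>b<J. v b * F b l) = - (\<Sum>b<J. \<alpha> b * F b l)" for l
      unfolding sum_negf[symmetric] by (intro sum.cong) (auto simp: v_def)
    then have "(\<Sum>b<Suc J. v b * F b l) = G l" for l
      by (simp add: v_def[of J] G_def)
    with G0 have "\<forall>l. (\<Sum>b<Suc J. v b * F b l) = 0" by metis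
    from Suc.prems[OF this] have "v J = 0" by blast
    then show False by (simp add: v_def)
  qed
  then obtain l0 where l0: "G l0 \<noteq> 0" by blast
  define M where "M = max L (Suc l0)"
  have sumM: "(\<Sum>l<M. d j l * x l) = (\<Sum>l<L. d j l * x l)" if "j < J" for j and x :: "nat \<Rightarrow> real"
    by (rule sum.mono_neutral_right) (auto simp: M_def d0 that)
  \<comment> \<open>\<open>e\<close> evaluates at column \<open>l0\<close> what remains of a row
    after its expansion through the old functionals, divided by \<open>G l0\<close>; so it vanishes
    on the old rows and is 1 on the row \<open>F J\<close>.\<close>
  define e where "e l = ((if l = l0 then 1 else 0) - (\<Sum>j<J. F j l0 * d j l)) / G l0" for l
  have esum: "(\<Sum>l<M. e l * x l) = (x l0 - (\<Sum>j<J. F j l0 * (\<Sum>l<L. d j l * x l))) / G l0" for x :: "nat \<Rightarrow> real"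
  proof -
    have "(\<Sum>l<M. e l * x l) = (\<Sum>l<M. (if l = l0 then x l else 0) - (\<Sum>j<J. F j l0 * (d j l * x l))) / G l0"
      unfolding sum_divide_distrib
    proof (intro sum.cong refl)
      fix l
      have "e l * x l = ((if l = l0 then 1 else 0) * x l - (\<Sum>j<J. F j l0 * d j l) * x l) / G l0"
        by (simp only: e_def left_diff_distrib times_divide_eq_left)
      also have "(\<Sum>j<J. F j l0 * d j l) * x l = (\<Sum>j<J. F j l0 * (d j l * x l))"
        by (simp only: sum_distrib_right mult.assoc)
      finally show "e l * x l = ((if l = l0 then x l else 0) - (\<Sum>j<J. F j l0 * (d j l * x l))) / G l0"
        by simp
    qed
    also have "\<dots> = ((\<Sum>l<M. if l = l0 then x l else 0) - (\<Sum>j<J. \<Sum>l<M. F j l0 * (d j l * x l))) / G l0"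
      by (subst sum.swap) (simp add: sum_subtractf)
    also have "(\<Sum>l<M. if l = l0 then x l else 0) = x l0"
      by (simp add: M_def)
    also have "(\<Sum>j<J. \<Sum>l<M. F j l0 * (d j l * x l)) = (\<Sum>j<J. F j l0 * (\<Sum>l<L. d j l * x l))"
      by (intro sum.cong) (auto simp: sumM simp flip: sum_distrib_left)
    finally show ?thesis .
  qed
  have eF: "(\<Sum>l<M. e l * F b l) = (if b = J then 1 else 0)" if "b < Suc J" for b
  proof (cases "b = J")
    case True
    have "(\<Sum>j<J. F j l0 * (\<Sum>l<L. d j l * F J l)) = (\<Sum>j<J. \<alpha> j * F j l0)"
      by (intro sum.cong) (auto simp: \<alpha>_def)
    then have "(\<Sum>l<M. e l * F b l) = G l0 / G l0"
      using True by (simp only: esum G_def)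
    with True l0 show ?thesis by simp
  next
    case False
    then have "b < J" using that by simp
    then have "(\<Sum>j<J. F j l0 * (\<Sum>l<L. d j l * F b l)) = (\<Sum>j<J. if j = b then F j l0 else 0)"
      by (intro sum.cong) (auto simp: d1)
    with False \<open>b < J\<close> show ?thesis by (simp add: esum)
  qed
  \<comment> \<open>The old functionals take the values \<alpha> on the new row; subtracting
    multiples of \<open>e\<close> corrects this without disturbing the old rows.\<close>
  define d' where "d' j l = (if j = J then e l else d j l - \<alpha> j * e l)" for j l
  have "(\<Sum>l<M. d' j l * F b l) = (if j = b then 1 else 0)" if "j < Suc J" "b < Suc J" for j b
  proof (cases "j = J")
    case True
    with that show ?thesis by (simp add: d'_def eF)
  next
    case False
    then have "j < J" using that by simp
    have "(\<Sum>l<M. d' j l * F b l) = (\<Sum>l<M. d j l * F b l) - \<alpha> j * (\<Sum>l<M. e l * F b l)"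
      unfolding sum_distrib_left sum_subtractf[symmetric]
      using False by (intro sum.cong) (auto simp: d'_def left_diff_distrib)
    also have "\<dots> = (\<Sum>l<L. d j l * F b l) - \<alpha> j * (if b = J then 1 else 0)"
      using \<open>j < J\<close> that by (simp add: sumM eF)
    finally show ?thesis
      using \<open>j < J\<close> that d1[of j b] by (auto simp: \<alpha>_def)
  qed
  moreover have "d' j l = 0" if "j < Suc J" "l \<ge> M" for j l
  proof -
    have l: "l \<ge> L" "l \<noteq> l0" using that by (auto simp: M_def)
    have "e l = 0" using l d0 by (auto simp: e_def)
    then show ?thesis using that l d0[of j l] by (cases "j = J") (auto simp: d'_def)
  qed
  ultimately have "(\<forall>j<Suc J. \<forall>l\<ge>M. d' j l = 0) \<and>
    (\<forall>j<Suc J. \<forall>b<Suc J. (\<Sum>l<M. d' j l * F b l) = (if j = b then 1 else 0))"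
    by presburger
  then show ?case
    by (intro exI)
qed

text \<open>The functional \<open>d j\<close> applied to the combination reads off
  \<open>v j\<close>, so its l1 norm is the constant with which small data force small
  coefficients.\<close>

lemma dual_family_bound:
  fixes F :: "nat \<Rightarrow> nat \<Rightarrow> real" and d :: "nat \<Rightarrow> nat \<Rightarrow> real"
  assumes "\<And>b. b < J \<Longrightarrow> (\<Sum>l<L. d j l * F b l) = (if j = b then 1 else 0)"
    and "j < J" and "\<And>l. l < L \<Longrightarrow> \<bar>\<Sum>b<J. v b * F b l\<bar> \<le> e"
  shows "\<bar>v j\<bar> \<le> (\<Sum>l<L. \<bar>d j l\<bar>) * e"
proof -
  have "(\<Sum>l<L. d j l * (\<Sum>b<J. v b * F b l)) = (\<Sum>b<J. v b * (\<Sum>l<L. d j l * F b l))"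
    unfolding sum_distrib_left by (subst sum.swap) (simp add: algebra_simps)
  also have "\<dots> = (\<Sum>b<J. if b = j then v b else 0)"
    by (intro sum.cong) (auto simp: assms(1))
  finally have "v j = (\<Sum>l<L. d j l * (\<Sum>b<J. v b * F b l))"
    using assms(2) by simp
  also have "\<bar>\<dots>\<bar> \<le> (\<Sum>l<L. \<bar>d j l\<bar> * e)"
    by (rule order_trans[OF sum_abs]) (auto simp: abs_mult intro!: sum_mono mult_left_mono assms(3))
  finally show ?thesis by (simp add: sum_distrib_right)
qed

lemma square_right_inverse_imp_left_inverse:
  fixes A B :: "nat \<Rightarrow> nat \<Rightarrow> real"
  assumes "\<And>i j. i < J \<Longrightarrow> j < J \<Longrightarrow> (\<Sum>l<J. A i l * B l j) = (if i = j then 1 else 0)"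
    and "i < J" "j < J"
  shows "(\<Sum>l<J. B i l * A l j) = (if i = j then 1 else 0)"
proof -
  let ?A = "mat J J (\<lambda>(i,j). A i j)" and ?B = "mat J J (\<lambda>(i,j). B i j)"
  have AB: "?A * ?B = 1\<^sub>m J"
    by (rule eq_matI) (auto simp: scalar_prod_def assms(1) simp flip: lessThan_atLeast0)
  have "?B * ?A = 1\<^sub>m J"
    by (rule mat_mult_left_right_inverse[OF _ _ AB]) auto
  then have "(?B * ?A) $$ (i, j) = 1\<^sub>m J $$ (i, j)"
    by simp
  then show ?thesis
    using assms(2,3) by (auto simp: scalar_prod_def simp flip: lessThan_atLeast0)
qed

text \<open>A dual family of the rows, padded with zero columns, is a right inverse; for a square
  matrix it is then also a left inverse.\<close>

lemma left_kernel_trivial_imp_inverse: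
  fixes A :: "nat \<Rightarrow> nat \<Rightarrow> real"
  assumes "\<And>v. (\<forall>j<J. (\<Sum>i<J. v i * A i j) = 0) \<Longrightarrow> \<forall>i<J. v i = 0"
  shows "\<exists>B. (\<forall>i<J. \<forall>j<J. (\<Sum>l<J. A i l * B l j) = (if i = j then 1 else 0)) \<and>
             (\<forall>i<J. \<forall>j<J. (\<Sum>l<J. B i l * A l j) = (if i = j then 1 else (0::real)))"
proof -
  define F where "F i j = (if j < J then A i j else 0)" for i j
  have "\<forall>b<J. v b = 0" if "\<forall>l. (\<Sum>b<J. v b * F b l) = 0" for v
  proof (rule assms, intro allI impI)
    fix j assume "j < J"
    with that[rule_format, of j] show "(\<Sum>i<J. v i * A i j) = 0" by (simp add: F_def)
  qed
  from dual_family[where J = J and F = F, OF this] obtain L d where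
    d0: "\<And>j l. j < J \<Longrightarrow> l \<ge> L \<Longrightarrow> d j l = 0" and
    d1: "\<And>j b. j < J \<Longrightarrow> b < J \<Longrightarrow> (\<Sum>l<L. d j l * F b l) = (if j = b then 1 else 0)"
    by blast
  have AB: "(\<Sum>l<J. A i l * d j l) = (if i = j then 1 else 0)" if "i < J" "j < J" for i j
  proof -
    have "(\<Sum>l<J. A i l * d j l) = (\<Sum>l<max L J. d j l * F i l)"
      by (rule sum.mono_neutral_cong_left) (auto simp: F_def)
    also have "\<dots> = (\<Sum>l<L. d j l * F i l)"
      by (rule sum.mono_neutral_right) (auto simp: d0 that)
    finally show ?thesis using d1[of j i] that by auto
  qed
  show ?thesis
    by (intro exI[of _ "\<lambda>l j. d j l"] conjI allI impI AB
        square_right_inverse_imp_left_inverse[where A = A and B = "\<lambda>l j. d j l", OF AB])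
qed

subsection \<open>Functionals of the state chain\<close>

definition chain_weight :: "(nat \<Rightarrow> nat \<Rightarrow> real) \<Rightarrow> (nat \<Rightarrow> real) \<Rightarrow> nat \<Rightarrow> (nat \<Rightarrow> nat) \<Rightarrow> real" where
  "chain_weight Q p N k = p (k 0) * (\<Prod>i<N - 1. Q (k i) (k (Suc i)))"

text \<open>Expectations over state paths are kept as finite weighted sums. This spares a
  probability space of paths, and passing from M to M + 1 states becomes an algebraic
  identity.\<close>

definition chain_expectation ::
    "nat \<Rightarrow> (nat \<Rightarrow> nat \<Rightarrow> real) \<Rightarrow> (nat \<Rightarrow> real) \<Rightarrow> nat \<Rightarrow> ((nat \<Rightarrow> nat) \<Rightarrow> real) \<Rightarrow> real" where
  "chain_expectation J Q p N G = (\<Sum>k\<in>PiE {..<N} (\<lambda>_. {..<J}). chain_weight Q p N k * G k)"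

lemma sum_PiE_lessThan_Suc:
  fixes g :: "(nat \<Rightarrow> nat) \<Rightarrow> real"
  shows "(\<Sum>k\<in>PiE {..<Suc M} (\<lambda>_. {..<J}). g k) =
    (\<Sum>k\<in>PiE {..<M} (\<lambda>_. {..<J}). \<Sum>b<J. g (k(M := b)))"
proof -
  let ?E = "PiE {..<M} (\<lambda>_. {..<J})"
  have inj: "inj_on (\<lambda>(y, h). h(M := y)) ({..<J} \<times> ?E)"
    by (rule inj_combinator) simp
  have "(\<Sum>k\<in>PiE {..<Suc M} (\<lambda>_. {..<J}). g k) = (\<Sum>(y, h)\<in>{..<J} \<times> ?E. g (h(M := y)))"
    unfolding lessThan_Suc PiE_insert_eq
    by (subst sum.reindex[OF inj]) (simp add: case_prod_beta)
  also have "\<dots> = (\<Sum>y<J. \<Sum>h\<in>?E. g (h(M := y)))"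
    by (simp add: sum.cartesian_product)
  also have "\<dots> = (\<Sum>h\<in>?E. \<Sum>y<J. g (h(M := y)))"
    by (rule sum.swap)
  finally show ?thesis .
qed

lemma chain_weight_upd:
  assumes "M \<ge> 1"
  shows "chain_weight Q p (Suc M) (k(M := b)) = chain_weight Q p M k * Q (k (M - 1)) b"
proof -
  obtain m where m: "M = Suc m" using assms by (cases M) auto
  have "(\<Prod>i<m. Q ((k(M := b)) i) ((k(M := b)) (Suc i))) = (\<Prod>i<m. Q (k i) (k (Suc i)))"
    by (intro prod.cong) (auto simp: m)
  then show ?thesis by (simp add: chain_weight_def m)
qed

lemma chain_expectation_Suc:
  assumes "M \<ge> 1"
  shows "chain_expectation J Q p (Suc M) G =
    chain_expectation J Q p M (\<lambda>k. \<Sum>b<J. Q (k (M - 1)) b * G (k(M := b)))"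
  unfolding chain_expectation_def sum_PiE_lessThan_Suc
  by (simp add: chain_weight_upd[OF assms] sum_distrib_left mult.assoc)

lemma chain_expectation_1:
  "chain_expectation J Q p 1 G = (\<Sum>a<J. p a * G ((\<lambda>_. undefined)(0 := a)))"
  unfolding chain_expectation_def One_nat_def sum_PiE_lessThan_Suc
  by (simp add: chain_weight_def fun_upd_def)

lemma chain_expectation_cong:
  assumes "\<And>k. k \<in> PiE {..<M} (\<lambda>_. {..<J}) \<Longrightarrow> G k = H k"
  shows "chain_expectation J Q p M G = chain_expectation J Q p M H"
  unfolding chain_expectation_def using assms by (intro sum.cong) auto

lemma chain_expectation_add:
  "chain_expectation J Q p M (\<lambda>k. G k + H k) = chain_expectation J Q p M G + chain_expectation J Q p M H"
  by (simp add: chain_expectation_def distrib_left sum.distrib)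

lemma chain_expectation_cmult:
  "chain_expectation J Q p M (\<lambda>k. c * G k) = c * chain_expectation J Q p M G"
  by (simp add: chain_expectation_def sum_distrib_left algebra_simps)

lemma chain_expectation_sum:
  "chain_expectation J Q p M (\<lambda>k. \<Sum>i\<in>I. G i k) = (\<Sum>i\<in>I. chain_expectation J Q p M (G i))"
  unfolding chain_expectation_def sum_distrib_left by (rule sum.swap)

section \<open>The transition operator and the stationary chain at every third step\<close>

definition trans_op :: "nat \<Rightarrow> (nat \<Rightarrow> nat \<Rightarrow> real) \<Rightarrow> (nat \<Rightarrow> real) \<Rightarrow> nat \<Rightarrow> real" where
  "trans_op J Q v i = (\<Sum>j<J. Q i j * v j)"

lemma mpow_Suc_apply:
  "(\<Sum>j<J. mpow J Q (Suc n) i j * v j) = (\<Sum>j<J. mpow J Q n i j * trans_op J Q v j)"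
proof -
  have "(\<Sum>j<J. mpow J Q (Suc n) i j * v j) = (\<Sum>j<J. \<Sum>l<J. mpow J Q n i l * (Q l j * v j))"
    by (simp add: sum_distrib_right mult.assoc)
  also have "\<dots> = (\<Sum>l<J. \<Sum>j<J. mpow J Q n i l * (Q l j * v j))"
    by (rule sum.swap)
  finally show ?thesis by (simp add: trans_op_def sum_distrib_left)
qed

lemma mpow_0_apply: "i < J \<Longrightarrow> (\<Sum>j<J. mpow J Q 0 i j * v j) = v i"
  by (simp add: if_distrib[of "\<lambda>x. x * _"] cong: if_cong)

locale ergodic_chain =
  fixes J :: nat and Q :: "nat \<Rightarrow> nat \<Rightarrow> real" and p :: "nat \<Rightarrow> real"
  assumes stochastic: "stochastic_matrix J Q"
    and irreducible: "irreducible_chain J Q"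
    and aperiodic: "aperiodic_chain J Q"
    and invariant: "invariant_distribution J Q p"
begin

abbreviation "P \<equiv> trans_op J Q"
abbreviation "E \<equiv> chain_expectation J Q p"

lemma Q_nonneg: "i < J \<Longrightarrow> j < J \<Longrightarrow> 0 \<le> Q i j"
  and Q_sum: "i < J \<Longrightarrow> (\<Sum>j<J. Q i j) = 1"
  using stochastic by (auto simp: stochastic_matrix_def)

lemma p_nonneg: "i < J \<Longrightarrow> 0 \<le> p i"
  and p_sum: "(\<Sum>i<J. p i) = 1"
  and p_invariant: "j < J \<Longrightarrow> (\<Sum>i<J. p i * Q i j) = p j"
  using invariant by (auto simp: invariant_distribution_def)

lemma J_pos: "J > 0"
  using p_sum by (cases J) auto

lemma p_trans_op: "(\<Sum>i<J. p i * P v i) = (\<Sum>i<J. p i * v i)"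
proof -
  have "(\<Sum>i<J. p i * P v i) = (\<Sum>i<J. \<Sum>j<J. p i * Q i j * v j)"
    by (simp add: trans_op_def sum_distrib_left mult.assoc)
  also have "\<dots> = (\<Sum>j<J. \<Sum>i<J. p i * Q i j * v j)"
    by (rule sum.swap)
  also have "\<dots> = (\<Sum>j<J. p j * v j)"
    by (simp add: p_invariant flip: sum_distrib_right)
  finally show ?thesis .
qed

lemma mpow_nonneg: "i < J \<Longrightarrow> j < J \<Longrightarrow> 0 \<le> mpow J Q n i j"
  by (induction n arbitrary: j) (auto intro!: sum_nonneg mult_nonneg_nonneg Q_nonneg)

lemma mpow_sum: "i < J \<Longrightarrow> (\<Sum>j<J. mpow J Q n i j) = 1"
proof (induction n)
  case 0
  then show ?case by simp
next
  case (Suc n)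
  have "(\<Sum>j<J. mpow J Q (Suc n) i j * 1) = (\<Sum>j<J. mpow J Q n i j * P (\<lambda>_. 1) j)"
    by (rule mpow_Suc_apply)
  also have "\<dots> = (\<Sum>j<J. mpow J Q n i j)"
    by (intro sum.cong) (auto simp: trans_op_def Q_sum)
  finally show ?case using Suc by simp
qed

lemma mpow_pos_add:
  assumes "mpow J Q m i l > 0" "mpow J Q n l j > 0" "i < J" "l < J" "j < J"
  shows "mpow J Q (m + n) i j > 0"
  using assms(2,5)
proof (induction n arbitrary: j)
  case 0
  then show ?case using assms by (simp split: if_splits)
next
  case (Suc n)
  have nn: "0 \<le> mpow J Q n l r * Q r j" if "r < J" for r
    using that assms Suc.prems by (intro mult_nonneg_nonneg mpow_nonneg Q_nonneg) auto
  have "\<exists>r<J. mpow J Q n l r * Q r j > 0"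
  proof (rule ccontr)
    assume "\<not> ?thesis"
    then have "(\<Sum>r<J. mpow J Q n l r * Q r j) \<le> 0"
      by (intro sum_nonpos) (metis lessThan_iff not_less)
    then show False using Suc.prems by simp
  qed
  then obtain r where r: "r < J" "mpow J Q n l r * Q r j > 0" by blast
  have "mpow J Q n l r > 0" "Q r j > 0"
    using r(2) mpow_nonneg[of l r n] Q_nonneg[of r j] r(1) assms(4) Suc.prems(2)
    by (auto simp: zero_less_mult_iff)
  then have "0 < mpow J Q (m + n) i r * Q r j"
    using Suc.IH r by simp
  also have "\<dots> \<le> (\<Sum>r<J. mpow J Q (m + n) i r * Q r j)"
    using r assms Suc.prems
    by (intro member_le_sum[where f = "\<lambda>r. mpow J Q (m + n) i r * Q r j"] mult_nonneg_nonneg mpow_nonneg Q_nonneg) auto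
  finally show ?case by simp
qed

text \<open>Some state carries mass, it reaches j, and invariance under every power of Q transports
  mass there. Positivity later allows the stationary weights to be cancelled when the first
  observation is used for identification.\<close>

lemma p_pos:
  assumes "j < J"
  shows "p j > 0"
proof -
  have "\<exists>i<J. p i > 0"
    using p_sum p_nonneg by (smt (verit) lessThan_iff sum_nonpos)
  then obtain i where i: "i < J" "p i > 0" by blast
  obtain n where n: "mpow J Q n i j > 0"
    using irreducible i assms by (auto simp: irreducible_chain_def)
  have inv: "(\<Sum>i<J. p i * mpow J Q n i j) = p j" if "j < J" for j n
    using that
  proof (induction n arbitrary: j)
    case 0
    then show ?case by (simp add: if_distrib[of "\<lambda>x. _ * x"] cong: if_cong)
  next
    case (Suc n)
    have "(\<Sum>i<J. p i * mpow J Q (Suc n) i j) = (\<Sum>i<J. \<Sum>l<J. (p i * mpow J Q n i l) * Q l j)"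
      by (simp add: sum_distrib_left mult.assoc)
    also have "\<dots> = (\<Sum>l<J. \<Sum>i<J. (p i * mpow J Q n i l) * Q l j)"
      by (rule sum.swap)
    also have "\<dots> = (\<Sum>l<J. p l * Q l j)"
      by (simp add: Suc.IH flip: sum_distrib_right)
    finally show ?case using Suc.prems by (simp add: p_invariant)
  qed
  have "0 < p i * mpow J Q n i j"
    using i n by simp
  also have "\<dots> \<le> (\<Sum>i<J. p i * mpow J Q n i j)"
    using i assms by (intro member_le_sum[where f = "\<lambda>i. p i * mpow J Q n i j"] mult_nonneg_nonneg p_nonneg mpow_nonneg) auto
  finally show ?thesis using inv assms by simp
qed

text \<open>A chain of period 3 would decompose along multiples of three. Aperiodicity gives a
  return time n at i that 3 does not divide; of the path lengths q, n + q and 2 n + q from i to j,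
  one is divisible by 3.\<close>

lemma three_step_irreducible:
  assumes "i < J" "j < J"
  shows "\<exists>m. mpow J Q (3 * m) i j > 0"
proof -
  obtain n where n: "n > 0" "mpow J Q n i i > 0" "\<not> 3 dvd n"
  proof -
    have "\<not> 3 dvd Gcd {n::nat. n > 0 \<and> mpow J Q n i i > 0}"
      using aperiodic assms by (auto simp: aperiodic_chain_def)
    then have "\<exists>n\<in>{n::nat. n > 0 \<and> mpow J Q n i i > 0}. \<not> 3 dvd n"
      using Gcd_greatest by blast
    then show ?thesis using that by blast
  qed
  obtain q where l: "mpow J Q q i j > 0"
    using irreducible assms by (auto simp: irreducible_chain_def)
  have l1: "mpow J Q (n + q) i j > 0"
    using mpow_pos_add[OF n(2) l] assms by simp
  have l2: "mpow J Q (n + (n + q)) i j > 0"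
    using mpow_pos_add[OF n(2) l1] assms by simp
  have "3 dvd q \<or> 3 dvd n + q \<or> 3 dvd n + (n + q)"
    using n(3) by presburger
  then show ?thesis
    using l l1 l2 by (metis dvdE)
qed

text \<open>Maximum principle: at a maximiser, a weighted mean of v can equal the maximum only if v
  is maximal wherever the weight is positive, and irreducibility in multiples of three steps reaches
  every state.\<close>

lemma three_step_harmonic_const:
  assumes "\<And>i. i < J \<Longrightarrow> P (P (P v)) i = v i" "i < J" "j < J"
  shows "v i = v j"
proof -
  have fix_v: "(\<Sum>j<J. mpow J Q (3 * m) i j * v j) = v i" if "i < J" for m i
  proof (induction m)
    case 0
    then show ?case using mpow_0_apply[OF that] by simp
  next
    case (Suc m)
    have "3 * Suc m = Suc (Suc (Suc (3 * m)))" by simp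
    then have "(\<Sum>j<J. mpow J Q (3 * Suc m) i j * v j) = (\<Sum>j<J. mpow J Q (3 * m) i j * P (P (P v)) j)"
      by (simp only: mpow_Suc_apply)
    also have "\<dots> = (\<Sum>j<J. mpow J Q (3 * m) i j * v j)"
      by (intro sum.cong) (auto simp: assms(1))
    finally show ?case using Suc by simp
  qed
  obtain i0 where i0: "i0 < J" "\<And>j. j < J \<Longrightarrow> v j \<le> v i0"
  proof -
    have "finite (v ` {..<J})" "v ` {..<J} \<noteq> {}" using J_pos by auto
    from Max_in[OF this] obtain i where "i < J" "v i = Max (v ` {..<J})" by force
    then show ?thesis
      by (intro that[of i]) auto
  qed
  have "v j = v i0" if "j < J" for j
  proof -
    obtain m where m: "mpow J Q (3 * m) i0 j > 0"
      using three_step_irreducible[OF i0(1) \<open>j < J\<close>] by blast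
    have "(\<Sum>l<J. mpow J Q (3 * m) i0 l * (v i0 - v l)) = 0"
      using fix_v[OF i0(1), of m] mpow_sum[OF i0(1), of "3 * m"]
      by (simp add: right_diff_distrib sum_subtractf flip: sum_distrib_right)
    moreover have "0 \<le> mpow J Q (3 * m) i0 l * (v i0 - v l)" if "l < J" for l
      using i0 that by (intro mult_nonneg_nonneg mpow_nonneg) auto
    ultimately have "mpow J Q (3 * m) i0 j * (v i0 - v j) = 0"
      using that sum_nonneg_0[of "{..<J}" "\<lambda>l. mpow J Q (3 * m) i0 l * (v i0 - v l)" j] by auto
    with m show ?thesis by simp
  qed
  with assms show ?thesis by metis
qed

text \<open>The kernel of I - Q^3 consists of the constants, so adding the projection onto constants
  along p makes it injective, hence invertible. If z has stationary mean 0, so has the solution, and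
  the added term disappears.\<close>

lemma poisson_equation:
  assumes "(\<Sum>i<J. p i * z i) = 0"
  shows "\<exists>u. \<forall>i<J. u i - P (P (P u)) i = z i"
proof -
  define A where "A i j = (if i = j then 1 else 0) - mpow J Q 3 i j + p j" for i j
  have A_apply: "(\<Sum>j<J. A i j * v j) = v i - P (P (P v)) i + (\<Sum>j<J. p j * v j)" if "i < J" for i v
  proof -
    have "(\<Sum>j<J. A i j * v j) = (\<Sum>j<J. (if i = j then v j else 0)) - (\<Sum>j<J. mpow J Q 3 i j * v j) + (\<Sum>j<J. p j * v j)"
      unfolding sum_subtractf[symmetric] sum.distrib[symmetric]
      by (intro sum.cong) (auto simp: A_def algebra_simps)
    also have "(\<Sum>j<J. mpow J Q 3 i j * v j) = P (P (P v)) i"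
      using mpow_0_apply[OF that, of Q "P (P (P v))"]
      by (simp only: numeral_3_eq_3 mpow_Suc_apply)
    finally show ?thesis using that by simp
  qed
  \<comment> \<open>By invariance of p, the stationary mean annihilates I - Q^3 and sees only the
    added projection.\<close>
  have pA: "(\<Sum>i<J. p i * (v i - P (P (P v)) i + (\<Sum>j<J. p j * v j))) = (\<Sum>j<J. p j * v j)" for v
    by (simp add: distrib_left right_diff_distrib sum.distrib sum_subtractf p_trans_op p_sum
        flip: sum_distrib_right)
  have "\<forall>i<J. v i = 0" if v: "\<forall>j<J. (\<Sum>i<J. v i * A j i) = 0" for v
  proof -
    have v': "v i - P (P (P v)) i + (\<Sum>j<J. p j * v j) = 0" if "i < J" for i
      using v that A_apply[OF that, of v] by (simp add: mult.commute)
    have pv: "(\<Sum>j<J. p j * v j) = 0"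
      using pA[of v] v' by simp
    have "P (P (P v)) i = v i" if "i < J" for i
      using v'[OF that] pv by simp
    note const = three_step_harmonic_const[OF this]
    have "v i = 0" if "i < J" for i
    proof -
      have "(\<Sum>j<J. p j * v j) = (\<Sum>j<J. p j * v i)"
        by (intro sum.cong refl arg_cong2[where f = "(*)"] const) (use that in auto)
      then show ?thesis using pv p_sum by (simp flip: sum_distrib_right)
    qed
    then show ?thesis by blast
  qed
  \<comment> \<open>The inversion lemma speaks of left kernels, so it is applied to the
    transpose.\<close>
  from left_kernel_trivial_imp_inverse[of J "\<lambda>i j. A j i", OF this] obtain B where
    B: "\<And>i j. i < J \<Longrightarrow> j < J \<Longrightarrow> (\<Sum>l<J. B i l * A j l) = (if i = j then 1 else 0)"
    by blast
  define u where "u l = (\<Sum>i<J. z i * B i l)" for l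
  have Au: "(\<Sum>l<J. A j l * u l) = z j" if "j < J" for j
  proof -
    have "(\<Sum>l<J. A j l * u l) = (\<Sum>l<J. \<Sum>i<J. z i * (B i l * A j l))"
      by (simp add: u_def sum_distrib_left algebra_simps)
    also have "\<dots> = (\<Sum>i<J. \<Sum>l<J. z i * (B i l * A j l))"
      by (rule sum.swap)
    also have "\<dots> = (\<Sum>i<J. if i = j then z i else 0)"
      using that by (intro sum.cong) (auto simp: B simp flip: sum_distrib_left)
    finally show ?thesis using that by simp
  qed
  have u': "u i - P (P (P u)) i + (\<Sum>j<J. p j * u j) = z i" if "i < J" for i
    using Au[OF that] A_apply[OF that] by simp
  have "(\<Sum>j<J. p j * u j) = (\<Sum>i<J. p i * z i)"
    using pA[of u] u' by simp
  with u' assms show ?thesis by (intro exI[of _ u]) auto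
qed

lemma E_mono:
  assumes "\<And>k. k \<in> PiE {..<M} (\<lambda>_. {..<J}) \<Longrightarrow> G k \<le> H k" "M \<ge> 1"
  shows "E M G \<le> E M H"
  unfolding chain_expectation_def chain_weight_def
  using assms
  by (intro sum_mono mult_left_mono mult_nonneg_nonneg prod_nonneg p_nonneg Q_nonneg ballI) (auto simp: PiE_iff)

lemma weight_nonneg: "k \<in> PiE {..<N} (\<lambda>_. {..<J}) \<Longrightarrow> N \<ge> 1 \<Longrightarrow> 0 \<le> chain_weight Q p N k"
  unfolding chain_weight_def
  by (intro mult_nonneg_nonneg prod_nonneg p_nonneg Q_nonneg ballI) (auto simp: PiE_iff)

lemma E_step_invariant:
  assumes "M \<ge> 1" "\<And>k b. k \<in> PiE {..<M} (\<lambda>_. {..<J}) \<Longrightarrow> b < J \<Longrightarrow> G (k(M := b)) = G k"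
  shows "E (Suc M) G = E M G"
  unfolding chain_expectation_Suc[OF assms(1)]
proof (rule chain_expectation_cong)
  fix k assume k: "k \<in> PiE {..<M} (\<lambda>_. {..<J})"
  then have "k (M - 1) < J" using assms(1) by (auto simp: PiE_iff)
  then show "(\<Sum>b<J. Q (k (M - 1)) b * G (k(M := b))) = G k"
    using assms(2)[OF k] by (simp add: Q_sum flip: sum_distrib_right)
qed

lemma E_const: "M \<ge> 1 \<Longrightarrow> E M (\<lambda>_. c) = c"
proof (induction M)
  case (Suc M)
  then show ?case
  proof (cases "M \<ge> 1")
    case True
    then show ?thesis using Suc E_step_invariant[of M "\<lambda>_. c"] by simp
  next
    case False
    then have "Suc M = 1" by simp
    then show ?thesis
      by (simp only: chain_expectation_1 p_sum flip: sum_distrib_right)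
  qed
qed simp

text \<open>Conditional mean of a function of a block of three states, given the last state of the
  preceding block.\<close>

definition T3 :: "(nat \<Rightarrow> nat \<Rightarrow> nat \<Rightarrow> real) \<Rightarrow> nat \<Rightarrow> real" where
  "T3 h c = (\<Sum>a<J. Q c a * (\<Sum>b<J. Q a b * (\<Sum>d<J. Q b d * h a b d)))"

lemma E_three_steps:
  assumes "M \<ge> 1"
  shows "E (M + 3) G = E M (\<lambda>k. T3 (\<lambda>a b d. G (k(M := a, M + 1 := b, M + 2 := d))) (k (M - 1)))"
proof -
  have "E (M + 3) G = E (Suc (Suc (Suc M))) G" by (simp add: numeral_3_eq_3)
  then show ?thesis
    using assms by (simp add: chain_expectation_Suc T3_def)
qed

lemma T3_add: "T3 (\<lambda>a b d. g a b d + h a b d) c = T3 g c + T3 h c"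
  by (simp add: T3_def distrib_left sum.distrib)

lemma T3_cmult: "T3 (\<lambda>a b d. r * g a b d) c = r * T3 g c"
  by (simp add: T3_def sum_distrib_left algebra_simps)

lemma T3_const: "c < J \<Longrightarrow> T3 (\<lambda>_ _ _. r) c = r"
  by (simp add: T3_def Q_sum flip: sum_distrib_right)

lemma T3_last: "T3 (\<lambda>a b d. u d) c = P (P (P u)) c"
  by (simp add: T3_def trans_op_def)

lemma T3_mono:
  assumes "c < J" "\<And>a b d. a < J \<Longrightarrow> b < J \<Longrightarrow> d < J \<Longrightarrow> g a b d \<le> h a b d"
  shows "T3 g c \<le> T3 h c"
  unfolding T3_def using assms
  by (intro sum_mono mult_left_mono Q_nonneg) auto

lemma p_T3: "(\<Sum>c<J. p c * T3 h c) = (\<Sum>a<J. p a * (\<Sum>b<J. Q a b * (\<Sum>d<J. Q b d * h a b d)))"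
proof -
  have "T3 h = P (\<lambda>a. \<Sum>b<J. Q a b * (\<Sum>d<J. Q b d * h a b d))"
    by (rule ext) (simp add: T3_def trans_op_def)
  then show ?thesis by (simp add: p_trans_op)
qed

text \<open>The partial sums are compensated by the solution of the Poisson equation into a martingale,
  whose second moment grows at most linearly.\<close>

lemma triple_sum_second_moment:
  fixes g :: "nat \<Rightarrow> nat \<Rightarrow> nat \<Rightarrow> real"
  defines "m \<equiv> (\<Sum>a<J. p a * (\<Sum>b<J. Q a b * (\<Sum>d<J. Q b d * g a b d)))"
  shows "\<exists>C\<ge>0. \<forall>n\<ge>1. E (3 * n) (\<lambda>k. (\<Sum>i<n. g (k (3*i)) (k (3*i+1)) (k (3*i+2)) - m)\<^sup>2) \<le> C * real n"
proof -
  define z where "z = T3 (\<lambda>a b d. g a b d + (- m))"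
  have m_const: "(\<Sum>c<J. p c * m) = m"
    by (simp add: p_sum flip: sum_distrib_right)
  have z': "z c = T3 g c - m" if "c < J" for c
    unfolding z_def T3_add by (simp add: T3_const that)
  have "(\<Sum>c<J. p c * z c) = (\<Sum>c<J. p c * T3 g c) - (\<Sum>c<J. p c * m)"
    unfolding sum_subtractf[symmetric] by (intro sum.cong) (auto simp: z' right_diff_distrib)
  also have "\<dots> = 0"
    by (simp only: m_const p_T3) (simp add: m_def)
  finally obtain u where u: "\<And>c. c < J \<Longrightarrow> u c - P (P (P u)) c = z c"
    using poisson_equation by blast
  \<comment> \<open>Increment of the compensated sum over a block a, b, d that follows the state c.
    The Poisson equation makes its conditional mean vanish, so squares add up without cross
    terms.\<close>
  define \<xi> where "\<xi> c a b d = g a b d + (- m) + (u d + (- u c))" for c a b d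
  have \<xi>0: "T3 (\<xi> c) c = 0" if "c < J" for c
  proof -
    have "T3 (\<xi> c) c = (T3 g c - m) + (P (P (P u)) c - u c)"
      unfolding \<xi>_def T3_add by (simp only: T3_const[OF that] T3_last[of u])
    with u[OF that] z'[OF that] show ?thesis by simp
  qed
  \<comment> \<open>One bound for the increments, for the first block, which has no predecessor, and
    for the boundary term by which the compensated sum differs from the plain one.\<close>
  define B where "B = (\<Sum>a<J. \<Sum>b<J. \<Sum>d<J. \<bar>g a b d\<bar>) + \<bar>m\<bar> + 2 * (\<Sum>c<J. \<bar>u c\<bar>)"
  have gB: "\<bar>g a b d\<bar> \<le> (\<Sum>a<J. \<Sum>b<J. \<Sum>d<J. \<bar>g a b d\<bar>)" if "a < J" "b < J" "d < J" for a b d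
  proof -
    have "\<bar>g a b d\<bar> \<le> (\<Sum>d<J. \<bar>g a b d\<bar>)"
      using that by (intro member_le_sum) auto
    also have "\<dots> \<le> (\<Sum>b<J. \<Sum>d<J. \<bar>g a b d\<bar>)"
      using that by (intro member_le_sum[of b _ "\<lambda>b. \<Sum>d<J. \<bar>g a b d\<bar>"]) (auto intro!: sum_nonneg)
    also have "\<dots> \<le> (\<Sum>a<J. \<Sum>b<J. \<Sum>d<J. \<bar>g a b d\<bar>)"
      using that by (intro member_le_sum[of a _ "\<lambda>a. \<Sum>b<J. \<Sum>d<J. \<bar>g a b d\<bar>"]) (auto intro!: sum_nonneg)
    finally show ?thesis .
  qed
  have uB: "\<bar>u c\<bar> \<le> (\<Sum>c<J. \<bar>u c\<bar>)" if "c < J" for c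
    using that by (intro member_le_sum) auto
  have B0: "B \<ge> 0" unfolding B_def by (intro add_nonneg_nonneg sum_nonneg mult_nonneg_nonneg) auto
  have \<xi>B: "(\<xi> c a b d)\<^sup>2 \<le> B\<^sup>2" if "a < J" "b < J" "c < J" "d < J" for a b c d
  proof -
    have "\<bar>\<xi> c a b d\<bar> \<le> \<bar>g a b d\<bar> + \<bar>m\<bar> + \<bar>u d\<bar> + \<bar>u c\<bar>"
      unfolding \<xi>_def by arith
    then have "\<bar>\<xi> c a b d\<bar> \<le> B"
      unfolding B_def using gB[OF that(1,2,4)] uB[OF that(3)] uB[OF that(4)] by linarith
    then show ?thesis by (metis abs_ge_zero power2_abs power_mono)
  qed
  define S where "S n k = (\<Sum>i<n. g (k (3*i)) (k (3*i+1)) (k (3*i+2)) - m)" for n :: nat and k :: "nat \<Rightarrow> nat"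
  \<comment> \<open>\<open>3 * n - 1\<close> is the last state of the n-th block.\<close>
  define M where "M n k = S n k + u (k (3 * n - 1))" for n :: nat and k :: "nat \<Rightarrow> nat"
  have M_upd: "M (Suc n) (k(3*n := a, 3*n + 1 := b, 3*n + 2 := d)) = M n k + \<xi> (k (3*n - 1)) a b d"
    if "n \<ge> 1" for n k a b d
  proof -
    let ?k = "k(3*n := a, 3*n + 1 := b, 3*n + 2 := d)"
    have "S n ?k = S n k"
      unfolding S_def by (intro sum.cong) auto
    moreover have "S (Suc n) ?k = S n ?k + (g a b d - m)"
      by (simp add: S_def)
    ultimately show ?thesis by (simp add: M_def \<xi>_def)
  qed
  have B1: "E 3 (\<lambda>k. (M 1 k)\<^sup>2) \<le> E 3 (\<lambda>k. B\<^sup>2)"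
  proof (rule E_mono)
    fix k :: "nat \<Rightarrow> nat" assume "k \<in> PiE {..<3} (\<lambda>_. {..<J})"
    then have k: "k 0 < J" "k 1 < J" "k 2 < J" by (auto simp: PiE_iff)
    have "M 1 k = g (k 0) (k 1) (k 2) - m + u (k 2)"
      by (simp add: M_def S_def numeral_2_eq_2)
    also have "\<bar>\<dots>\<bar> \<le> B"
      using gB[OF k] uB[OF k(3)] unfolding B_def by linarith
    finally show "(M 1 k)\<^sup>2 \<le> B\<^sup>2"
      by (metis abs_ge_zero power2_abs power_mono)
  qed simp
  have M_bound: "E (3 * n) (\<lambda>k. (M n k)\<^sup>2) \<le> B\<^sup>2 * n" if "n \<ge> 1" for n
    using that
  proof (induction n rule: nat_induct_at_least)
    case base
    then show ?case using B1 E_const[of 3 "B\<^sup>2"] by simp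
  next
    case (Suc n)
    have "E (3 * Suc n) (\<lambda>k. (M (Suc n) k)\<^sup>2) = E (3 * n + 3) (\<lambda>k. (M (Suc n) k)\<^sup>2)"
      by (simp add: add.commute)
    also have "\<dots> = E (3 * n) (\<lambda>k. T3 (\<lambda>a b d. (M n k + \<xi> (k (3*n - 1)) a b d)\<^sup>2) (k (3 * n - 1)))"
      using Suc.hyps by (simp only: E_three_steps[of "3 * n"] M_upd[OF Suc.hyps])
    also have "\<dots> \<le> E (3 * n) (\<lambda>k. (M n k)\<^sup>2 + B\<^sup>2)"
    proof (rule E_mono)
      fix k assume "k \<in> PiE {..<3 * n} (\<lambda>_. {..<J})"
      then have c: "k (3 * n - 1) < J" using Suc.hyps by (auto simp: PiE_iff)
      let ?c = "k (3 * n - 1)"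
      have "T3 (\<lambda>a b d. (\<xi> ?c a b d)\<^sup>2) ?c \<le> T3 (\<lambda>a b d. B\<^sup>2) ?c"
        using \<xi>B c by (intro T3_mono) auto
      then have \<xi>2: "T3 (\<lambda>a b d. (\<xi> ?c a b d)\<^sup>2) ?c \<le> B\<^sup>2"
        by (simp only: T3_const[OF c])
      have "T3 (\<lambda>a b d. (M n k + \<xi> ?c a b d)\<^sup>2) ?c
          = T3 (\<lambda>a b d. (M n k)\<^sup>2 + (2 * M n k * \<xi> ?c a b d + (\<xi> ?c a b d)\<^sup>2)) ?c"
        by (simp add: power2_sum algebra_simps)
      also have "\<dots> = (M n k)\<^sup>2 + T3 (\<lambda>a b d. (\<xi> ?c a b d)\<^sup>2) ?c"
        unfolding T3_add T3_cmult by (simp only: T3_const[OF c] \<xi>0[OF c])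
      finally show "T3 (\<lambda>a b d. (M n k + \<xi> ?c a b d)\<^sup>2) ?c \<le> (M n k)\<^sup>2 + B\<^sup>2"
        using \<xi>2 by simp
    qed (use Suc.hyps in simp)
    also have "\<dots> = E (3 * n) (\<lambda>k. (M n k)\<^sup>2) + B\<^sup>2"
      using Suc.hyps by (simp only: chain_expectation_add) (simp add: E_const)
    also have "\<dots> \<le> B\<^sup>2 * n + B\<^sup>2"
      using Suc.IH by simp
    also have "\<dots> = B\<^sup>2 * Suc n"
      by (simp add: algebra_simps)
    finally show ?case .
  qed
  have "E (3 * n) (\<lambda>k. (S n k)\<^sup>2) \<le> 4 * B\<^sup>2 * n" if n: "n \<ge> 1" for n
  proof -
    have "E (3 * n) (\<lambda>k. (S n k)\<^sup>2) \<le> E (3 * n) (\<lambda>k. 2 * (M n k)\<^sup>2 + 2 * B\<^sup>2)"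
    proof (rule E_mono)
      fix k assume "k \<in> PiE {..<3 * n} (\<lambda>_. {..<J})"
      then have c: "k (3 * n - 1) < J" using n by (auto simp: PiE_iff)
      have "\<bar>u (k (3 * n - 1))\<bar> \<le> B"
      proof -
        have "0 \<le> (\<Sum>a<J. \<Sum>b<J. \<Sum>d<J. \<bar>g a b d\<bar>)" "0 \<le> (\<Sum>c<J. \<bar>u c\<bar>)"
          by (auto intro!: sum_nonneg)
        then show ?thesis using uB[OF c] unfolding B_def by linarith
      qed
      then have "(u (k (3 * n - 1)))\<^sup>2 \<le> B\<^sup>2"
        by (metis abs_ge_zero power2_abs power_mono)
      moreover have "(S n k)\<^sup>2 \<le> 2 * (M n k)\<^sup>2 + 2 * (u (k (3 * n - 1)))\<^sup>2"
        using zero_le_power2[of "M n k + u (k (3 * n - 1))"]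
        by (simp add: M_def power2_eq_square algebra_simps)
      ultimately show "(S n k)\<^sup>2 \<le> 2 * (M n k)\<^sup>2 + 2 * B\<^sup>2" by simp
    qed (use n in simp)
    also have "\<dots> = 2 * E (3 * n) (\<lambda>k. (M n k)\<^sup>2) + 2 * B\<^sup>2"
      using n by (simp only: chain_expectation_add chain_expectation_cmult) (simp add: E_const)
    also have "\<dots> \<le> 2 * (B\<^sup>2 * n) + 2 * B\<^sup>2 * n"
      using M_bound[OF n] n by (intro add_mono mult_left_mono) (auto simp: mult_le_cancel_left1)
    finally show ?thesis by (simp add: algebra_simps)
  qed
  moreover have "4 * B\<^sup>2 \<ge> 0" by simp
  ultimately show ?thesis unfolding S_def by blast
qed

text \<open>Instead of the Cauchy-Schwarz inequality: after scaling by \<open>sqrt n\<close>, a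
  nonnegative number x is at most x^2 + 1, so the second moment bound yields the first moment.
  States left over after the last full block are summed out.\<close>

lemma triple_average_deviation:
  fixes g :: "nat \<Rightarrow> nat \<Rightarrow> nat \<Rightarrow> real"
  defines "m \<equiv> (\<Sum>a<J. p a * (\<Sum>b<J. Q a b * (\<Sum>d<J. Q b d * g a b d)))"
  shows "\<exists>C\<ge>0. \<forall>N n. n = N div 3 \<longrightarrow> n \<ge> 1 \<longrightarrow>
    E N (\<lambda>k. \<bar>(\<Sum>i<n. g (k (3*i)) (k (3*i+1)) (k (3*i+2))) / n - m\<bar>) \<le> C / sqrt n"
proof -
  from triple_sum_second_moment[of g, folded m_def] obtain C where C0: "C \<ge> 0" and
    C1: "\<forall>n\<ge>1. E (3 * n) (\<lambda>k. (\<Sum>i<n. g (k (3*i)) (k (3*i+1)) (k (3*i+2)) - m)\<^sup>2) \<le> C * real n"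
    by (elim exE conjE) (rule that)
  note C = C0 C1[rule_format]
  define S where "S n k = (\<Sum>i<n. g (k (3*i)) (k (3*i+1)) (k (3*i+2)) - m)" for n :: nat and k :: "nat \<Rightarrow> nat"
  have "E N (\<lambda>k. \<bar>(\<Sum>i<n. g (k (3*i)) (k (3*i+1)) (k (3*i+2))) / n - m\<bar>) \<le> (C + 1) / sqrt n"
    if n: "n = N div 3" "n \<ge> 1" for N n
  proof -
    have ext: "E (3 * n + r) (\<lambda>k. (S n k)\<^sup>2) = E (3 * n) (\<lambda>k. (S n k)\<^sup>2)" for r
    proof (induction r)
      case (Suc r)
      have "S n (k(3 * n + r := b)) = S n k" for k b
        unfolding S_def by (intro sum.cong) auto
      then have "E (Suc (3 * n + r)) (\<lambda>k. (S n k)\<^sup>2) = E (3 * n + r) (\<lambda>k. (S n k)\<^sup>2)"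
        using n by (intro E_step_invariant) auto
      with Suc show ?case by simp
    qed simp
    have "N = 3 * n + N mod 3" using n by simp
    then have EN: "E N (\<lambda>k. (S n k)\<^sup>2) \<le> C * n"
      using ext[of "N mod 3"] C(2)[OF n(2)] by (simp add: S_def)
    have N1: "N \<ge> 1" using n by (cases N) auto
    have "E N (\<lambda>k. \<bar>(\<Sum>i<n. g (k (3*i)) (k (3*i+1)) (k (3*i+2))) / n - m\<bar>)
        \<le> E N (\<lambda>k. inverse (n * sqrt n) * (S n k)\<^sup>2 + inverse (sqrt n))"
    proof (rule E_mono[OF _ N1])
      fix k
      define x where "x = \<bar>S n k\<bar> / sqrt n"
      have "(\<Sum>i<n. g (k (3*i)) (k (3*i+1)) (k (3*i+2))) / n - m = S n k / n"
        using n by (simp add: S_def sum_subtractf field_simps)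
      then have "\<bar>(\<Sum>i<n. g (k (3*i)) (k (3*i+1)) (k (3*i+2))) / n - m\<bar> = x / sqrt n"
        using n by (simp add: x_def abs_divide field_simps)
      also have "\<dots> \<le> (x\<^sup>2 + 1) / sqrt n"
        using zero_le_power2[of "x - 1/2"] n
        by (intro divide_right_mono) (auto simp: power2_eq_square algebra_simps)
      also have "\<dots> = inverse (n * sqrt n) * (S n k)\<^sup>2 + inverse (sqrt n)"
        using n by (simp add: x_def field_simps power2_eq_square)
      finally show "\<bar>(\<Sum>i<n. g (k (3*i)) (k (3*i+1)) (k (3*i+2))) / n - m\<bar>
        \<le> inverse (n * sqrt n) * (S n k)\<^sup>2 + inverse (sqrt n)" .
    qed
    also have "\<dots> = inverse (n * sqrt n) * E N (\<lambda>k. (S n k)\<^sup>2) + inverse (sqrt n)"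
      by (simp only: chain_expectation_add chain_expectation_cmult E_const[OF N1])
    also have "\<dots> \<le> inverse (n * sqrt n) * (C * n) + inverse (sqrt n)"
      using EN n by (intro add_mono mult_left_mono) auto
    also have "\<dots> = (C + 1) / sqrt n"
      using n by (simp add: field_simps)
    finally show ?thesis .
  qed
  moreover have "C + 1 \<ge> 0" using C(1) by simp
  ultimately show ?thesis by blast
qed

end

subsection \<open>A smoothing kernel for Hoelder functions\<close>

text \<open>This is (I - S)^r for the shift S by t. The sign convention gives \<open>g x\<close> the
  coefficient 1, so that the other terms, moved to the other side, approximate
  \<open>g x\<close>.\<close>

fun idiff :: "nat \<Rightarrow> real \<Rightarrow> (real \<Rightarrow> real) \<Rightarrow> real \<Rightarrow> real" where
  "idiff 0 t g x = g x"
| "idiff (Suc r) t g x = idiff r t g x - idiff r t g (x + t)"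

lemma idiff_coeffs:
  "\<exists>a. a 0 = 1 \<and> (\<forall>g t x. idiff r t g x = (\<Sum>i\<le>r. a i * g (x + real i * t)))"
proof (induction r)
  case 0
  then show ?case by (intro exI[of _ "\<lambda>_. 1"]) simp
next
  case (Suc r)
  then obtain a where a: "a 0 = (1::real)" "\<And>g t x. idiff r t g x = (\<Sum>i\<le>r. a i * g (x + real i * t))"
    by blast
  define a' where "a' i = (if i \<le> r then a i else 0) - (if i = 0 then 0 else a (i - 1))" for i
  have "idiff (Suc r) t g x = (\<Sum>i\<le>Suc r. a' i * g (x + real i * t))" for g t x
  proof -
    have "(\<Sum>i\<le>Suc r. (if i \<le> r then a i else 0) * g (x + real i * t)) = idiff r t g x"
      by (simp add: a(2))
    moreover have "(\<Sum>i\<le>Suc r. (if i = 0 then 0 else a (i - 1)) * g (x + real i * t)) = idiff r t g (x + t)"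
      by (subst sum.atMost_Suc_shift) (simp add: a(2) algebra_simps)
    ultimately show ?thesis
      by (simp only: idiff.simps a'_def left_diff_distrib sum_subtractf)
  qed
  moreover have "a' 0 = 1" by (simp add: a'_def a)
  ultimately show ?case by blast
qed

lemma idiff_has_derivative:
  assumes "\<And>x. g differentiable (at x)"
  shows "(idiff r t g has_field_derivative idiff r t (deriv g) x) (at x)"
proof (induction r arbitrary: x)
  case 0
  have "idiff 0 t g = g" by (rule ext) simp
  then show ?case
    using assms[of x] by (simp add: DERIV_deriv_iff_real_differentiable)
next
  case (Suc r)
  have *: "idiff (Suc r) t g = (\<lambda>x. idiff r t g x - idiff r t g (x + t))"
    by (rule ext) simp
  have "((\<lambda>x. idiff r t g (x + t)) has_field_derivative idiff r t (deriv g) (x + t)) (at x)"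
    using Suc.IH[of "x + t"] by (simp add: DERIV_shift)
  then show ?case
    unfolding * by (auto intro!: DERIV_diff Suc.IH)
qed

text \<open>By the mean value inequality each differencing is exchanged for one derivative and one
  factor |t|; the last one falls on the k-th derivative and meets its modulus of continuity.\<close>

lemma idiff_bound:
  assumes "\<And>m x. m < k \<Longrightarrow> (deriv ^^ m) g differentiable (at x)"
    and "\<And>x. \<bar>(deriv ^^ k) g x - (deriv ^^ k) g (x + t)\<bar> \<le> M"
  shows "\<bar>idiff (Suc k) t g x\<bar> \<le> \<bar>t\<bar> ^ k * M"
  using assms
proof (induction k arbitrary: g x)
  case 0
  then show ?case by simp
next
  case (Suc k)
  have D: "\<bar>idiff (Suc k) t (deriv g) x\<bar> \<le> \<bar>t\<bar> ^ k * M" for x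
  proof (rule Suc.IH)
    show "(deriv ^^ m) (deriv g) differentiable at x" if "m < k" for m x
      using Suc.prems(1)[of "Suc m" x] that by (simp add: funpow_swap1)
    show "\<bar>(deriv ^^ k) (deriv g) x - (deriv ^^ k) (deriv g) (x + t)\<bar> \<le> M" for x
      using Suc.prems(2)[of x] by (simp add: funpow_swap1)
  qed
  have g: "g differentiable (at x)" for x
    using Suc.prems(1)[of 0 x] by simp
  have "norm (idiff (Suc k) t g x - idiff (Suc k) t g (x + t)) \<le> (\<bar>t\<bar> ^ k * M) * norm (x - (x + t))"
    by (rule field_differentiable_bound[OF convex_UNIV idiff_has_derivative[OF g]])
      (use D in \<open>auto simp del: idiff.simps\<close>)
  then show ?case by (simp add: mult.commute mult.left_commute)
qed

lemma holder_space_idiff: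
  assumes "f \<in> holder_space s" "s > 0"
  shows "\<exists>M\<ge>0. \<forall>t x. \<bar>t\<bar> \<le> 1 \<longrightarrow> \<bar>idiff (Suc (nat \<lfloor>s\<rfloor>)) t f x\<bar> \<le> M * \<bar>t\<bar> powr s"
proof -
  define k where "k = nat \<lfloor>s\<rfloor>"
  define D where "D = (deriv ^^ k) f"
  have diff: "(deriv ^^ m) f differentiable (at x)" if "m < k" for m x
    using assms that by (auto simp: holder_space_def k_def Let_def)
  have hf: "holder_frac (s - real k) D"
    using assms by (auto simp: holder_space_def k_def D_def Let_def)
  have ks: "real k \<le> s" using assms(2) by (simp add: k_def)
  obtain B where B: "\<And>x. \<bar>D x\<bar> \<le> B"
    using hf by (auto simp: holder_frac_def bounded_iff)
  have B0: "B \<ge> 0" using B[of 0] by linarith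
  have "\<exists>M\<ge>0. \<forall>t x. \<bar>t\<bar> \<le> 1 \<longrightarrow> \<bar>D x - D (x + t)\<bar> \<le> M * \<bar>t\<bar> powr (s - real k)"
  proof (cases "s - real k > 0")
    case True
    then obtain M where M: "\<And>x y. 0 < \<bar>x - y\<bar> \<Longrightarrow> \<bar>x - y\<bar> \<le> 1 \<Longrightarrow> \<bar>D x - D y\<bar> \<le> M * \<bar>x - y\<bar> powr (s - real k)"
      using hf unfolding holder_frac_def by blast
    have "M \<ge> 0" using M[of 0 1] by simp
    moreover have "\<bar>D x - D (x + t)\<bar> \<le> M * \<bar>t\<bar> powr (s - real k)" if "\<bar>t\<bar> \<le> 1" for t x
      using M[of x "x + t"] that by (cases "t = 0") auto
    ultimately show ?thesis by blast
  next
    \<comment> \<open>Integer s: the k-th derivative is only known to be bounded and continuous, and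
      twice its bound serves as an increment of exponent 0. At \<open>t = 0\<close>, where
      \<open>0 powr 0 = 0\<close>, both sides vanish.\<close>
    case False
    with ks have eq: "s - real k = 0" by simp
    have "\<bar>D x - D (x + t)\<bar> \<le> (2 * B) * \<bar>t\<bar> powr (s - real k)" for t x
      using B[of x] B[of "x + t"] by (cases "t = 0") (auto simp: eq)
    then show ?thesis using B0 by (intro exI[of _ "2 * B"]) auto
  qed
  then obtain M where M: "M \<ge> 0" "\<And>t x. \<bar>t\<bar> \<le> 1 \<Longrightarrow> \<bar>D x - D (x + t)\<bar> \<le> M * \<bar>t\<bar> powr (s - real k)"
    by blast
  have "\<bar>idiff (Suc k) t f x\<bar> \<le> M * \<bar>t\<bar> powr s" if "\<bar>t\<bar> \<le> 1" for t x
  proof -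
    have "\<bar>idiff (Suc k) t f x\<bar> \<le> \<bar>t\<bar> ^ k * (M * \<bar>t\<bar> powr (s - real k))"
      by (rule idiff_bound[OF diff]) (use M(2)[OF that] in \<open>auto simp: D_def\<close>)
    also have "\<dots> \<le> M * \<bar>t\<bar> powr s"
    proof (cases "t = 0")
      case False
      then have "\<bar>t\<bar> ^ k * \<bar>t\<bar> powr (s - real k) = \<bar>t\<bar> powr s"
        by (simp add: powr_realpow[symmetric] powr_add[symmetric])
      then show ?thesis by (simp add: algebra_simps)
    qed simp
    finally show ?thesis .
  qed
  then show ?thesis using M(1) unfolding k_def by blast
qed

lemma holder_space_continuous:
  assumes "f \<in> holder_space s"
  shows "continuous_on UNIV f"
proof (cases "nat \<lfloor>s\<rfloor> = 0")
  case True
  then show ?thesis using assms by (auto simp: holder_space_def holder_frac_def)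
next
  case False
  then have "f differentiable (at x)" for x
    using assms by (auto simp: holder_space_def Let_def dest!: spec[of _ "0::nat"])
  then show ?thesis
    by (simp add: continuous_at_imp_continuous_on differentiable_imp_continuous_within)
qed

definition tent :: "real \<Rightarrow> real" where
  "tent u = max 0 (1 - \<bar>u\<bar>)"

lemma tent_measurable [measurable]: "tent \<in> borel_measurable borel"
  unfolding tent_def by measurable

lemma tent_nonneg: "0 \<le> tent u"
  and tent_le_1: "tent u \<le> 1"
  and tent_eq_0: "\<bar>u\<bar> \<ge> 1 \<Longrightarrow> tent u = 0"
  and tent_lipschitz: "\<bar>tent u - tent v\<bar> \<le> \<bar>u - v\<bar>"
  by (auto simp: tent_def max_def)

lemma tent_integrable: "integrable lborel tent"
proof (rule Bochner_Integration.integrable_bound)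
  show "integrable lborel (indicator {-1..1} :: real \<Rightarrow> real)" by simp
  show "AE x in lborel. norm (tent x) \<le> norm (indicator {-1..1} x :: real)"
    by (auto simp: tent_def indicator_def)
qed simp

lemma tent_integral_pos: "integral\<^sup>L lborel tent > 0"
proof -
  have "(\<integral>x. indicator {-1/2..1/2::real} x * (1/2) \<partial>lborel) \<le> integral\<^sup>L lborel tent"
  proof (rule integral_mono_AE)
    show "AE x in lborel. indicator {-1/2..1/2} x * (1/2) \<le> tent x"
      by (auto simp: tent_def indicator_def)
  qed (simp_all add: tent_integrable)
  moreover have "(\<integral>x. indicator {-1/2..1/2::real} x * (1/2) \<partial>lborel) = (1/2 :: real)"
    by simp
  ultimately show ?thesis by linarith
qed

text \<open>The iterated difference of f at x with step h u is of order h to the power s. Averaged over u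
  with weight tent, its term at x is a multiple of f x, and the remaining terms form the convolution
  of f with a rescaled kernel.\<close>

lemma higher_order_kernel:
  assumes s: "s > 0"
  obtains K R where "R \<ge> 1" "\<And>u. \<bar>K u\<bar> \<le> R" "\<And>u. \<bar>u\<bar> > R \<Longrightarrow> K u = 0"
    "\<And>u v. \<bar>K u - K v\<bar> \<le> R * \<bar>u - v\<bar>"
    "\<forall>f\<in>holder_space s. integrable lborel f \<longrightarrow> (\<exists>C\<ge>0. \<forall>h x. 0 < h \<and> h \<le> 1 \<longrightarrow>
       \<bar>(\<integral>y. K ((x - y) / h) * f y \<partial>lborel) / h - f x\<bar> \<le> C * h powr s)"
proof -
  define r where "r = Suc (nat \<lfloor>s\<rfloor>)"
  obtain a :: "nat \<Rightarrow> real" where a: "a 0 = 1" "\<And>g t x. idiff r t g x = (\<Sum>i\<le>r. a i * g (x + real i * t))"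
    using idiff_coeffs by blast
  define c where "c = integral\<^sup>L lborel tent"
  have c: "c > 0" using tent_integral_pos by (simp add: c_def)
  define T where "T u = tent u / c" for u
  have T_int: "integrable lborel T" and T1: "integral\<^sup>L lborel T = 1"
    using tent_integrable c by (auto simp: T_def[abs_def] c_def)
  have T0: "0 \<le> T u" for u using tent_nonneg c by (simp add: T_def)
  have Tm[measurable]: "T \<in> borel_measurable borel" unfolding T_def[abs_def] by measurable
  \<comment> \<open>The substitution y = x - i h v turns the i-th shifted term of the averaged
    difference into a convolution with the tent stretched by i, whence the factors 1/i; the minus
    sign comes from moving these terms to the other side of f.\<close>
  define K where "K u = - (\<Sum>i=1..r. a i / real i * T (u / real i))" for u
  define S where "S = (\<Sum>i=1..r. \<bar>a i\<bar> / c)"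
  \<comment> \<open>One constant serves as bound, as support radius and as Lipschitz constant of the
    kernel.\<close>
  define R where "R = 1 + real r + S"
  have S0: "S \<ge> 0" using c by (auto simp: S_def intro!: sum_nonneg)
  have Kb: "\<bar>K u\<bar> \<le> S" for u
  proof -
    have "\<bar>K u\<bar> \<le> (\<Sum>i=1..r. \<bar>a i / real i * T (u / real i)\<bar>)"
      unfolding K_def abs_minus_cancel by (rule sum_abs)
    also have "\<dots> \<le> S"
      unfolding S_def
    proof (rule sum_mono)
      fix i assume "i \<in> {1..r}"
      then have "\<bar>a i / real i\<bar> \<le> \<bar>a i\<bar>"
        by (auto simp: abs_divide divide_le_eq mult_le_cancel_left1)
      moreover have "\<bar>T (u / real i)\<bar> \<le> 1 / c"
        using c tent_le_1 tent_nonneg by (auto simp: T_def abs_divide intro!: divide_right_mono)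
      ultimately show "\<bar>a i / real i * T (u / real i)\<bar> \<le> \<bar>a i\<bar> / c"
        unfolding abs_mult using mult_mono[of "\<bar>a i / real i\<bar>" "\<bar>a i\<bar>" "\<bar>T (u / real i)\<bar>" "1 / c"] by simp
    qed
    finally show ?thesis .
  qed
  have Kl: "\<bar>K u - K v\<bar> \<le> S * \<bar>u - v\<bar>" for u v
  proof -
    have "K u - K v = - (\<Sum>i=1..r. a i / real i * (T (u / real i) - T (v / real i)))"
      by (simp add: K_def right_diff_distrib sum_subtractf)
    then have "\<bar>K u - K v\<bar> \<le> (\<Sum>i=1..r. \<bar>a i / real i * (T (u / real i) - T (v / real i))\<bar>)"
      unfolding abs_minus_cancel by (simp only: abs_minus_cancel sum_abs)
    also have "\<dots> \<le> (\<Sum>i=1..r. \<bar>a i\<bar> / c * \<bar>u - v\<bar>)"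
    proof (rule sum_mono)
      fix i assume i: "i \<in> {1..r}"
      then have "\<bar>a i / real i\<bar> \<le> \<bar>a i\<bar>"
        by (auto simp: abs_divide divide_le_eq mult_le_cancel_left1)
      moreover have "\<bar>T (u / real i) - T (v / real i)\<bar> \<le> \<bar>u - v\<bar> / c"
      proof -
        have "\<bar>tent (u / real i) - tent (v / real i)\<bar> \<le> \<bar>u / real i - v / real i\<bar>"
          by (rule tent_lipschitz)
        also have "\<dots> = \<bar>u - v\<bar> / real i"
          by (simp add: diff_divide_distrib[symmetric] abs_divide)
        also have "\<dots> \<le> \<bar>u - v\<bar>"
          using i by (auto simp: divide_le_eq mult_le_cancel_left1)
        finally show ?thesis
          using c by (simp add: T_def diff_divide_distrib[symmetric] abs_divide divide_right_mono)
      qed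
      ultimately show "\<bar>a i / real i * (T (u / real i) - T (v / real i))\<bar> \<le> \<bar>a i\<bar> / c * \<bar>u - v\<bar>"
        unfolding abs_mult
        using mult_mono[of "\<bar>a i / real i\<bar>" "\<bar>a i\<bar>" "\<bar>T (u / real i) - T (v / real i)\<bar>" "\<bar>u - v\<bar> / c"] by simp
    qed
    finally show ?thesis by (simp add: S_def sum_distrib_right)
  qed
  have Ks: "K u = 0" if "\<bar>u\<bar> > real r" for u
  proof -
    have "T (u / real i) = 0" if "i \<in> {1..r}" for i
      using that \<open>\<bar>u\<bar> > real r\<close> by (auto simp: T_def abs_divide le_divide_eq intro!: tent_eq_0)
    then show ?thesis by (simp add: K_def)
  qed
  have bias: "\<exists>C\<ge>0. \<forall>h x. 0 < h \<and> h \<le> 1 \<longrightarrow>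
       \<bar>(\<integral>y. K ((x - y) / h) * f y \<partial>lborel) / h - f x\<bar> \<le> C * h powr s"
    if f: "f \<in> holder_space s" "integrable lborel f" for f
  proof -
    obtain M where M: "M \<ge> 0" "\<And>t x. \<bar>t\<bar> \<le> 1 \<Longrightarrow> \<bar>idiff r t f x\<bar> \<le> M * \<bar>t\<bar> powr s"
      using holder_space_idiff[OF f(1) s] unfolding r_def by blast
    have fm[measurable]: "f \<in> borel_measurable borel" using f(2) by auto
    have "\<bar>(\<integral>y. K ((x - y) / h) * f y \<partial>lborel) / h - f x\<bar> \<le> M * h powr s" if h: "0 < h" "h \<le> 1" for h x
    proof -
      have int: "integrable lborel (\<lambda>v. T v * f (x + real i * (- h * v)))" for i
      proof (cases "i = 0")
        case True
        then show ?thesis using T_int by simp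
      next
        case False
        have "integrable lborel (\<lambda>v. f (x + (- real i * h) * v))"
          using False h by (intro lborel_integrable_real_affine f(2)) auto
        then have "integrable lborel (\<lambda>v. (1 / c) * f (x + (- real i * h) * v))"
          by simp
        then show ?thesis
        proof (rule Bochner_Integration.integrable_bound)
          show "AE v in lborel. norm (T v * f (x + real i * (- h * v))) \<le> norm ((1 / c) * f (x + (- real i * h) * v))"
          proof (rule AE_I2)
            fix v
            have "\<bar>T v\<bar> \<le> 1 / c"
              using c tent_le_1 tent_nonneg by (auto simp: T_def abs_divide intro!: divide_right_mono)
            from mult_right_mono[OF this, of "\<bar>f (x + (- real i * h) * v)\<bar>"]
            show "norm (T v * f (x + real i * (- h * v))) \<le> norm ((1 / c) * f (x + (- real i * h) * v))"
              using c by (simp add: abs_mult abs_divide mult.assoc)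
          qed
        qed simp
      qed
      have aff: "integrable lborel (\<lambda>y. T ((x - y) / h / real i) * f y)"
        "(\<integral>y. T ((x - y) / h / real i) * f y \<partial>lborel) = (real i * h) * (\<integral>v. T v * f (x + real i * (- h * v)) \<partial>lborel)"
        if "i \<ge> 1" for i
      proof -
        have eq: "T ((x - (x + - (real i * h) * v)) / h / real i) * f (x + - (real i * h) * v) = T v * f (x + real i * (- h * v))" for v
          using that h by (simp add: mult.assoc)
        have nz: "- (real i * h) \<noteq> 0" using that h by simp
        show "integrable lborel (\<lambda>y. T ((x - y) / h / real i) * f y)"
          using int[of i] lborel_integrable_real_affine_iff[OF nz, of "\<lambda>y. T ((x - y) / h / real i) * f y" x]
          unfolding eq by simp
        show "(\<integral>y. T ((x - y) / h / real i) * f y \<partial>lborel) = (real i * h) * (\<integral>v. T v * f (x + real i * (- h * v)) \<partial>lborel)"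
          using lborel_integral_real_affine[OF nz, of "\<lambda>y. T ((x - y) / h / real i) * f y" x] h
          unfolding eq by simp
      qed
      have "(\<integral>y. K ((x - y) / h) * f y \<partial>lborel) = (\<integral>y. - (\<Sum>i=1..r. a i / real i * (T ((x - y) / h / real i) * f y)) \<partial>lborel)"
        by (simp add: K_def sum_distrib_right mult.assoc)
      also have "\<dots> = - (\<Sum>i=1..r. a i / real i * (\<integral>y. T ((x - y) / h / real i) * f y \<partial>lborel))"
        using aff(1) by (simp add: Bochner_Integration.integral_sum)
      also have "\<dots> = - (\<Sum>i=1..r. h * (a i * (\<integral>v. T v * f (x + real i * (- h * v)) \<partial>lborel)))"
        using aff(2) by (intro arg_cong[where f = uminus] sum.cong) auto
      finally have "(\<integral>y. K ((x - y) / h) * f y \<partial>lborel) / h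
          = - (\<Sum>i=1..r. a i * (\<integral>v. T v * f (x + real i * (- h * v)) \<partial>lborel))"
        using h by (simp add: sum_distrib_left[symmetric])
      \<comment> \<open>\<open>a 0 = 1\<close> and T integrates to 1, so \<open>f x\<close> is the
        missing term of index 0.\<close>
      moreover have "f x = a 0 * (\<integral>v. T v * f (x + real 0 * (- h * v)) \<partial>lborel)"
        using T1 by (simp add: a)
      moreover have "{..r} = insert 0 {1..r}" by auto
      ultimately have "(\<integral>y. K ((x - y) / h) * f y \<partial>lborel) / h - f x
          = - (\<Sum>i\<le>r. a i * (\<integral>v. T v * f (x + real i * (- h * v)) \<partial>lborel))"
        by simp
      moreover have "(\<Sum>i\<le>r. a i * (\<integral>v. T v * f (x + real i * (- h * v)) \<partial>lborel))
          = (\<integral>v. (\<Sum>i\<le>r. a i * (T v * f (x + real i * (- h * v)))) \<partial>lborel)"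
        using int by (simp add: Bochner_Integration.integral_sum)
      moreover have idT: "(\<Sum>i\<le>r. a i * (T v * f (x + real i * (- h * v)))) = T v * idiff r (- h * v) f x" for v
        by (simp only: a(2) sum_distrib_left mult.left_commute[of "T v"])
      ultimately have eq: "\<bar>(\<integral>y. K ((x - y) / h) * f y \<partial>lborel) / h - f x\<bar> = \<bar>\<integral>v. T v * idiff r (- h * v) f x \<partial>lborel\<bar>"
        by (simp only: abs_minus_cancel)
      have intT: "integrable lborel (\<lambda>v. T v * idiff r (- h * v) f x)"
        unfolding idT[symmetric] by (intro Bochner_Integration.integrable_sum integrable_mult_right int)
      have bnd: "\<bar>T v * idiff r (- h * v) f x\<bar> \<le> T v * (M * h powr s)" for v
      proof (cases "\<bar>v\<bar> \<le> 1")
        case True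
        then have hv: "\<bar>- h * v\<bar> \<le> h" using h by (simp add: abs_mult mult_le_cancel_left1)
        then have "\<bar>idiff r (- h * v) f x\<bar> \<le> M * \<bar>- h * v\<bar> powr s"
          using h by (intro M(2)) auto
        also have "\<dots> \<le> M * h powr s"
          using hv M(1) s h by (intro mult_left_mono powr_mono2) auto
        finally show ?thesis using T0[of v] by (simp add: abs_mult mult_left_mono)
      next
        case False
        then show ?thesis using tent_eq_0[of v] by (simp add: T_def)
      qed
      have "\<bar>\<integral>v. T v * idiff r (- h * v) f x \<partial>lborel\<bar> \<le> (\<integral>v. T v * (M * h powr s) \<partial>lborel)"
        using bnd T_int intT by (intro integral_abs_bound_integral) auto
      then show ?thesis unfolding eq using T1 by simp
    qed
    then show ?thesis using M(1) by blast
  qed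
  show thesis
  proof (rule that[of R K])
    show "R \<ge> 1" using S0 by (simp add: R_def)
    show "\<bar>K u\<bar> \<le> R" for u using Kb[of u] by (simp add: R_def)
    show "K u = 0" if "\<bar>u\<bar> > R" for u using that S0 by (intro Ks) (simp add: R_def)
    show "\<bar>K u - K v\<bar> \<le> R * \<bar>u - v\<bar>" for u v
    proof -
      have "S * \<bar>u - v\<bar> \<le> R * \<bar>u - v\<bar>" by (intro mult_right_mono) (auto simp: R_def)
      with Kl[of u v] show ?thesis by linarith
    qed
  qed (use bias in blast)
qed

section \<open>Rational half-lines as test functions\<close>

definition halfline :: "nat \<Rightarrow> real \<Rightarrow> real" where
  "halfline l y = (if l = 0 then 1 else indicator {..real_of_rat (from_nat (l - 1))} y)"

lemma halfline_measurable [measurable]: "halfline l \<in> borel_measurable borel"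
  unfolding halfline_def[abs_def] by measurable

lemma halfline_bounds: "0 \<le> halfline l y" "halfline l y \<le> 1"
  by (auto simp: halfline_def indicator_def)

lemma halfline_0 [simp]: "halfline 0 y = 1"
  by (simp add: halfline_def)

lemma halfline_integrable:
  "integrable lborel g \<Longrightarrow> integrable lborel (\<lambda>y. halfline l y * g y)"
  by (rule Bochner_Integration.integrable_bound[of _ g])
    (auto simp: abs_mult mult_left_le_one_le halfline_bounds)

text \<open>Differences of half-lines are intervals with rational ends, and a continuous function
  that is positive at x has a positive integral over a small enough one around x; the same holds for
  -g.\<close>

lemma halfline_separating:
  assumes cont: "continuous_on UNIV g" and int: "integrable lborel g"
    and zero: "\<And>l. (\<integral>y. halfline l y * g y \<partial>lborel) = 0"
  shows "g x = 0"
proof -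
  have "\<not> g x > 0" if cont: "continuous_on UNIV g" and int: "integrable lborel g"
    and zero: "\<And>l. (\<integral>y. halfline l y * g y \<partial>lborel) = 0" for g :: "real \<Rightarrow> real"
  proof
    assume gx: "g x > 0"
    have "isCont g x" using cont by (simp add: continuous_on_eq_continuous_at)
    then obtain d where d: "d > 0" "\<And>y. dist y x < d \<Longrightarrow> dist (g y) (g x) < g x / 2"
      using gx unfolding continuous_at_eps_delta by (metis half_gt_zero)
    obtain q1 where q1: "x - d < real_of_rat q1" "real_of_rat q1 < x"
      using of_rat_dense[of "x - d" x] d by auto
    obtain q2 where q2: "x < real_of_rat q2" "real_of_rat q2 < x + d"
      using of_rat_dense[of x "x + d"] d by auto
    have H: "halfline (Suc (to_nat q)) y = indicator {..real_of_rat q} y" for q y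
      by (simp add: halfline_def)
    have zq: "(\<integral>y. indicator {..real_of_rat q} y * g y \<partial>lborel) = 0"
      and iq: "integrable lborel (\<lambda>y. indicator {..real_of_rat q} y * g y)" for q
      using zero[of "Suc (to_nat q)"] halfline_integrable[OF int, of "Suc (to_nat q)"] by (simp_all add: H)
    define I where "I = {real_of_rat q1<..real_of_rat q2}"
    have ind: "indicator I y = (indicator {..real_of_rat q2} y - indicator {..real_of_rat q1} y :: real)" for y
      using q1 q2 by (auto simp: I_def indicator_def)
    have z: "(\<integral>y. indicator I y * g y \<partial>lborel) = 0"
      and intI: "integrable lborel (\<lambda>y. indicator I y * g y)"
      unfolding ind left_diff_distrib using zq iq by auto
    have "(\<integral>y. indicator I y * (g x / 2) \<partial>lborel) \<le> (\<integral>y. indicator I y * g y \<partial>lborel)"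
    proof (rule integral_mono_AE[OF _ intI AE_I2])
      show "integrable lborel (\<lambda>y. indicator I y * (g x / 2))"
        using q1 q2 by (auto simp: I_def)
      show "indicator I y * (g x / 2) \<le> indicator I y * g y" for y
      proof (cases "y \<in> I")
        case True
        then have "dist y x < d" using q1 q2 by (auto simp: I_def dist_real_def)
        then have "dist (g y) (g x) < g x / 2" by (rule d)
        then show ?thesis using True by (simp add: dist_real_def abs_if split: if_splits)
      qed simp
    qed
    moreover have "(\<integral>y. indicator I y * (g x / 2) \<partial>lborel) = (real_of_rat q2 - real_of_rat q1) * (g x / 2)"
      using q1 q2 by (simp add: I_def)
    moreover have "(real_of_rat q2 - real_of_rat q1) * (g x / 2) > 0"
      using q1 q2 gx by (intro mult_pos_pos) auto
    ultimately show False using z by linarith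
  qed
  note * = this
  have "\<not> g x > 0" by (rule *[OF cont int zero])
  moreover have "\<not> - g x > 0"
    by (rule *[of "\<lambda>y. - g y"]) (use assms in \<open>auto intro: continuous_on_minus\<close>)
  ultimately show ?thesis by linarith
qed

subsection \<open>Exponential moments and suprema\<close>

lemma exp_le_one_plus_sq:
  fixes u :: real
  assumes "\<bar>u\<bar> \<le> 1"
  shows "exp u \<le> 1 + u + u\<^sup>2"
proof (cases "u \<ge> 0")
  case True
  then show ?thesis using assms by (intro exp_bound) auto
next
  case False
  define v where "v = - u"
  have v: "0 < v" "v \<le> 1" using False assms by (auto simp: v_def)
  have "1 + v \<le> exp v" by (rule exp_ge_add_one_self)
  then have "exp (- v) \<le> 1 / (1 + v)"
    using v by (simp add: exp_minus field_simps)
  also have "\<dots> \<le> 1 - v + v\<^sup>2"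
    using v by (simp add: field_simps power2_eq_square)
  finally show ?thesis by (simp add: v_def)
qed

text \<open>Bound exp u by 1 + u + u^2, valid for |u| at most 1: the centred terms are bounded by 2,
  whence \<beta> up to 1/2. The linear term has mean 0 and independence multiplies the factors. What
  enters is the second moment \<open>q\<close>, of the order of the bandwidth for a kernel, and not
  the range.\<close>

lemma (in prob_space) bernstein_exp_moment:
  fixes W :: "'i \<Rightarrow> 'a \<Rightarrow> real"
  assumes I: "finite I" and ind: "indep_vars (\<lambda>_. borel) W I"
    and bnd: "\<And>i \<omega>. i \<in> I \<Longrightarrow> \<bar>W i \<omega>\<bar> \<le> 1"
    and q: "\<And>i. i \<in> I \<Longrightarrow> expectation (\<lambda>\<omega>. (W i \<omega>)\<^sup>2) \<le> q i"
    and lam: "\<bar>\<beta>\<bar> \<le> 1/2"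
  shows "integrable M (\<lambda>\<omega>. exp (\<beta> * (\<Sum>i\<in>I. W i \<omega> - expectation (W i))))"
    and "expectation (\<lambda>\<omega>. exp (\<beta> * (\<Sum>i\<in>I. W i \<omega> - expectation (W i)))) \<le> exp (\<beta>\<^sup>2 * (\<Sum>i\<in>I. q i))"
proof -
  have Wm: "W i \<in> borel_measurable M" if "i \<in> I" for i
    using ind that by (auto simp: indep_vars_def)
  have Wint: "integrable M (W i)" if "i \<in> I" for i
    using Wm[OF that] bnd[OF that] by (intro integrable_const_bound[where B = 1]) auto
  have Wint2: "integrable M (\<lambda>\<omega>. (W i \<omega>)\<^sup>2)" if "i \<in> I" for i
    using Wm[OF that] bnd[OF that]
    by (intro integrable_const_bound[where B = 1]) (auto simp: abs_square_le_1)
  define m where "m i = expectation (W i)" for i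
  have m1: "\<bar>m i\<bar> \<le> 1" if "i \<in> I" for i
  proof -
    have "\<bar>m i\<bar> \<le> expectation (\<lambda>\<omega>. \<bar>W i \<omega>\<bar>)"
      unfolding m_def by (rule integral_abs_bound)
    also have "\<dots> \<le> expectation (\<lambda>_. 1)"
      using Wint[OF that] bnd[OF that] by (intro integral_mono_AE) auto
    finally show ?thesis by (simp add: prob_space)
  qed
  define Z where "Z i \<omega> = exp (\<beta> * (W i \<omega> - m i))" for i \<omega>
  have indZ: "indep_vars (\<lambda>_. borel) Z I"
    unfolding Z_def by (rule indep_vars_compose2[OF ind, where Y = "\<lambda>i x. exp (\<beta> * (x - m i))"]) auto
  have small: "\<bar>\<beta> * (W i \<omega> - m i)\<bar> \<le> 1" if "i \<in> I" for i \<omega>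
  proof -
    have "\<bar>W i \<omega> - m i\<bar> \<le> 2" using bnd[OF that, of \<omega>] m1[OF that] by linarith
    then have "\<bar>\<beta>\<bar> * \<bar>W i \<omega> - m i\<bar> \<le> (1/2) * 2" using lam by (intro mult_mono) auto
    then show ?thesis by (simp add: abs_mult)
  qed
  have Zm: "Z i \<in> borel_measurable M" if "i \<in> I" for i
    using Wm[OF that] unfolding Z_def[abs_def] by measurable
  have Zint: "integrable M (Z i)" if "i \<in> I" for i
  proof (rule integrable_const_bound[where B = "exp 1"])
    show "AE \<omega> in M. norm (Z i \<omega>) \<le> exp 1"
      using small[OF that] by (auto simp: Z_def intro: order_trans[OF abs_ge_self])
  qed (rule Zm[OF that])
  have EZ: "expectation (Z i) \<le> exp (\<beta>\<^sup>2 * q i)" if i: "i \<in> I" for i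
  proof -
    have sq: "integrable M (\<lambda>\<omega>. (W i \<omega> - m i)\<^sup>2)"
      using Wint[OF i] Wint2[OF i] by (simp add: power2_diff)
    have "expectation (Z i) \<le> expectation (\<lambda>\<omega>. 1 + \<beta> * (W i \<omega> - m i) + \<beta>\<^sup>2 * (W i \<omega> - m i)\<^sup>2)"
    proof (rule integral_mono_AE[OF Zint[OF i]])
      show "integrable M (\<lambda>\<omega>. 1 + \<beta> * (W i \<omega> - m i) + \<beta>\<^sup>2 * (W i \<omega> - m i)\<^sup>2)"
        using Wint[OF i] sq by simp
      show "AE \<omega> in M. Z i \<omega> \<le> 1 + \<beta> * (W i \<omega> - m i) + \<beta>\<^sup>2 * (W i \<omega> - m i)\<^sup>2"
        using exp_le_one_plus_sq[OF small[OF i]] by (auto simp: Z_def power_mult_distrib)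
    qed
    also have "\<dots> = 1 + \<beta>\<^sup>2 * expectation (\<lambda>\<omega>. (W i \<omega> - m i)\<^sup>2)"
      using Wint[OF i] sq by (simp add: prob_space m_def)
    also have "expectation (\<lambda>\<omega>. (W i \<omega> - m i)\<^sup>2) = expectation (\<lambda>\<omega>. (W i \<omega>)\<^sup>2) - (m i)\<^sup>2"
      unfolding m_def using Wint[OF i] Wint2[OF i] by (rule variance_eq)
    also have "1 + \<beta>\<^sup>2 * (expectation (\<lambda>\<omega>. (W i \<omega>)\<^sup>2) - (m i)\<^sup>2) \<le> 1 + \<beta>\<^sup>2 * q i"
      using q[OF i] zero_le_power2[of "m i"] by (intro add_left_mono mult_left_mono) (linarith, simp)
    also have "\<dots> \<le> exp (\<beta>\<^sup>2 * q i)" by (rule exp_ge_add_one_self)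
    finally show ?thesis .
  qed
  have prod: "exp (\<beta> * (\<Sum>i\<in>I. W i \<omega> - m i)) = (\<Prod>i\<in>I. Z i \<omega>)" for \<omega>
    using I by (simp add: Z_def exp_sum sum_distrib_left)
  show "integrable M (\<lambda>\<omega>. exp (\<beta> * (\<Sum>i\<in>I. W i \<omega> - expectation (W i))))"
    using indep_vars_integrable[OF I indZ Zint] unfolding m_def[symmetric] prod .
  have "expectation (\<lambda>\<omega>. exp (\<beta> * (\<Sum>i\<in>I. W i \<omega> - m i))) = (\<Prod>i\<in>I. expectation (Z i))"
    unfolding prod by (rule indep_vars_lebesgue_integral[OF I indZ Zint])
  also have "\<dots> \<le> (\<Prod>i\<in>I. exp (\<beta>\<^sup>2 * q i))"
    using EZ by (intro prod_mono) (auto simp: Z_def intro!: integral_nonneg_AE)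
  also have "\<dots> = exp (\<beta>\<^sup>2 * (\<Sum>i\<in>I. q i))"
    using I by (simp add: exp_sum sum_distrib_left)
  finally show "expectation (\<lambda>\<omega>. exp (\<beta> * (\<Sum>i\<in>I. W i \<omega> - expectation (W i)))) \<le> exp (\<beta>\<^sup>2 * (\<Sum>i\<in>I. q i))"
    unfolding m_def .
qed

lemma (in prob_space) bernstein_cosh_moment:
  fixes W :: "'i \<Rightarrow> 'a \<Rightarrow> real"
  assumes "finite I" "indep_vars (\<lambda>_. borel) W I"
    and "\<And>i \<omega>. i \<in> I \<Longrightarrow> \<bar>W i \<omega>\<bar> \<le> 1"
    and "\<And>i. i \<in> I \<Longrightarrow> expectation (\<lambda>\<omega>. (W i \<omega>)\<^sup>2) \<le> q i"
    and "\<bar>\<beta>\<bar> \<le> 1/2"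
  shows "integrable M (\<lambda>\<omega>. cosh (\<beta> * (\<Sum>i\<in>I. W i \<omega> - expectation (W i))))"
    and "expectation (\<lambda>\<omega>. cosh (\<beta> * (\<Sum>i\<in>I. W i \<omega> - expectation (W i)))) \<le> exp (\<beta>\<^sup>2 * (\<Sum>i\<in>I. q i))"
proof -
  have eq: "cosh (\<beta> * x) = exp (\<beta> * x) / 2 + exp (- \<beta> * x) / 2" for x
    by (simp add: cosh_def)
  have m: "\<bar>- \<beta>\<bar> \<le> 1/2" using assms(5) by simp
  note p = bernstein_exp_moment[OF assms(1-4) assms(5)]
  note n = bernstein_exp_moment[OF assms(1-4) m]
  show "integrable M (\<lambda>\<omega>. cosh (\<beta> * (\<Sum>i\<in>I. W i \<omega> - expectation (W i))))"
    unfolding eq using p(1) n(1) by simp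
  show "expectation (\<lambda>\<omega>. cosh (\<beta> * (\<Sum>i\<in>I. W i \<omega> - expectation (W i)))) \<le> exp (\<beta>\<^sup>2 * (\<Sum>i\<in>I. q i))"
    unfolding eq using p n by simp
qed

text \<open>A Lipschitz function that is large somewhere is large on an interval, so its supremum over the
  whole line is controlled by an exponential integral; no discretisation is needed.\<close>

lemma sup_le_cosh_integral:
  fixes S :: "real \<Rightarrow> real"
  assumes lip: "\<And>x y. \<bar>S x - S y\<bar> \<le> \<bar>x - y\<bar> / \<Delta>" and "\<Delta> > 0" "\<beta> > 0" "a \<ge> 0"
  shows "ennreal \<bar>S x0\<bar> \<le> ennreal (1 + (a + 2 * exp (- a)) / \<beta>) +
     ennreal (2 * exp (- a) / (\<beta> * \<Delta>)) * (\<integral>\<^sup>+x. ennreal (cosh (\<beta> * S x) - 1) \<partial>lborel)"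
proof (cases "\<bar>S x0\<bar> < 1")
  case True
  have "0 \<le> (a + 2 * exp (- a)) / \<beta>" using assms by simp
  with True have "\<bar>S x0\<bar> \<le> 1 + (a + 2 * exp (- a)) / \<beta>" by linarith
  then have "ennreal \<bar>S x0\<bar> \<le> ennreal (1 + (a + 2 * exp (- a)) / \<beta>)" by (rule ennreal_leI)
  then show ?thesis by (rule order_trans) simp
next
  case False
  define t where "t = \<bar>S x0\<bar>"
  have t: "t \<ge> 1" using False by (simp add: t_def)
  \<comment> \<open>Within distance \<Delta> of \<open>x0\<close> the function S loses at most 1 in
    absolute value, which is the shift in u.\<close>
  define u where "u = \<beta> * (t - 1)"
  have u: "u \<ge> 0" using t assms by (simp add: u_def)
  have "ennreal ((cosh u - 1) * \<Delta>) = (\<integral>\<^sup>+x. ennreal (cosh u - 1) * indicator {x0..x0+\<Delta>} x \<partial>lborel)"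
    using assms by (subst nn_integral_cmult_indicator) (auto simp: ennreal_mult cosh_real_ge_1)
  also have "\<dots> \<le> (\<integral>\<^sup>+x. ennreal (cosh (\<beta> * S x) - 1) \<partial>lborel)"
  proof (rule nn_integral_mono)
    fix x
    show "ennreal (cosh u - 1) * indicator {x0..x0+\<Delta>} x \<le> ennreal (cosh (\<beta> * S x) - 1)"
    proof (cases "x \<in> {x0..x0+\<Delta>}")
      case True
      then have "\<bar>x0 - x\<bar> / \<Delta> \<le> 1" using assms by auto
      with lip[of x0 x] have "\<bar>S x\<bar> \<ge> t - 1" unfolding t_def by linarith
      then have "u \<le> \<beta> * \<bar>S x\<bar>" unfolding u_def using assms by (intro mult_left_mono) auto
      then have "cosh u \<le> cosh (\<beta> * \<bar>S x\<bar>)" using u assms by (subst cosh_real_nonneg_le_iff) auto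
      also have "\<dots> = cosh (\<beta> * S x)"
        by (cases "S x \<ge> 0") auto
      finally show ?thesis using True by (simp add: ennreal_leI)
    qed simp
  qed
  finally have I: "ennreal ((cosh u - 1) * \<Delta>) \<le> (\<integral>\<^sup>+x. ennreal (cosh (\<beta> * S x) - 1) \<partial>lborel)" .
  \<comment> \<open>The function exp (u - a) lies above its tangent at u = a. The free parameter a
    costs a/\<beta> and in exchange weights the integral with exp (-a).\<close>
  have "1 + (u - a) \<le> exp (u - a)" by (rule exp_ge_add_one_self)
  also have "\<dots> = exp (- a) * exp u" by (simp add: exp_diff exp_minus field_simps)
  also have "\<dots> \<le> exp (- a) * (2 * cosh u)"
    by (intro mult_left_mono) (auto simp: cosh_def)
  finally have "\<beta> * (t - 1) \<le> a + 2 * exp (- a) + 2 * exp (- a) * (cosh u - 1)"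
    by (simp add: u_def algebra_simps)
  then have "t - 1 \<le> (a + 2 * exp (- a) + 2 * exp (- a) * (cosh u - 1)) / \<beta>"
    using assms by (simp add: le_divide_eq mult.commute)
  also have "\<dots> = (a + 2 * exp (- a)) / \<beta> + 2 * exp (- a) / (\<beta> * \<Delta>) * ((cosh u - 1) * \<Delta>)"
    using assms by (simp add: field_simps)
  finally have "t \<le> 1 + (a + 2 * exp (- a)) / \<beta> + 2 * exp (- a) / (\<beta> * \<Delta>) * ((cosh u - 1) * \<Delta>)"
    by linarith
  then have "ennreal t \<le> ennreal (1 + (a + 2 * exp (- a)) / \<beta> + 2 * exp (- a) / (\<beta> * \<Delta>) * ((cosh u - 1) * \<Delta>))"
    by (rule ennreal_leI)
  also have "\<dots> = ennreal (1 + (a + 2 * exp (- a)) / \<beta>) + ennreal (2 * exp (- a) / (\<beta> * \<Delta>)) * ennreal ((cosh u - 1) * \<Delta>)"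
    using assms cosh_real_ge_1[of u] by (simp add: ennreal_plus[symmetric] ennreal_mult[symmetric] del: ennreal_plus)
  also have "\<dots> \<le> ennreal (1 + (a + 2 * exp (- a)) / \<beta>) +
     ennreal (2 * exp (- a) / (\<beta> * \<Delta>)) * (\<integral>\<^sup>+x. ennreal (cosh (\<beta> * S x) - 1) \<partial>lborel)"
    by (intro add_left_mono mult_left_mono I) auto
  finally show ?thesis by (simp add: t_def)
qed

section \<open>Product densities and independent coordinates\<close>

lemma PiM_density_lborel:
  fixes g :: "'i \<Rightarrow> real \<Rightarrow> real"
  assumes "finite I" and g: "\<And>i. prob_space (density lborel (g i))" "\<And>i. g i \<in> borel_measurable borel" "\<And>i x. 0 \<le> g i x"
  shows "PiM I (\<lambda>i. density lborel (g i)) = density (PiM I (\<lambda>_. lborel)) (\<lambda>x. ennreal (\<Prod>i\<in>I. g i (x i)))"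
proof -
  interpret P: product_sigma_finite "\<lambda>i. density lborel (\<lambda>x. ennreal (g i x))"
    unfolding product_sigma_finite_def using prob_space_imp_sigma_finite[OF g(1)] by blast
  interpret L: product_sigma_finite "\<lambda>_::'i. lborel :: real measure"
    by standard
  note [measurable] = g(2)
  have "density (PiM I (\<lambda>_. lborel)) (\<lambda>x. ennreal (\<Prod>i\<in>I. g i (x i))) = PiM I (\<lambda>i. density lborel (g i))"
  proof (rule P.PiM_eqI)
    show "sets (density (PiM I (\<lambda>_. lborel)) (\<lambda>x. ennreal (\<Prod>i\<in>I. g i (x i)))) = sets (PiM I (\<lambda>i. density lborel (\<lambda>x. ennreal (g i x))))"
      unfolding sets_density by (rule sets_PiM_cong) auto
    fix A assume "\<And>i. i \<in> I \<Longrightarrow> A i \<in> sets (density lborel (\<lambda>x. ennreal (g i x)))"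
    then have A[measurable]: "\<And>i. i \<in> I \<Longrightarrow> A i \<in> sets lborel" by simp
    have AE: "PiE I A \<in> sets (PiM I (\<lambda>_. lborel))"
      using assms(1) A by (intro sets_PiM_I_finite) auto
    have "emeasure (density (PiM I (\<lambda>_. lborel)) (\<lambda>x. ennreal (\<Prod>i\<in>I. g i (x i)))) (PiE I A)
        = (\<integral>\<^sup>+x. ennreal (\<Prod>i\<in>I. g i (x i)) * indicator (PiE I A) x \<partial>PiM I (\<lambda>_. lborel))"
      by (rule emeasure_density[OF _ AE]) measurable
    also have "\<dots> = (\<integral>\<^sup>+x. (\<Prod>i\<in>I. ennreal (g i (x i)) * indicator (A i) (x i)) \<partial>PiM I (\<lambda>_. lborel))"
    proof (rule nn_integral_cong)
      fix x assume "x \<in> space (PiM I (\<lambda>_. lborel :: real measure))"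
      then have "x \<in> extensional I" by (auto simp: space_PiM PiE_iff)
      then have "(\<Prod>i\<in>I. indicator (A i) (x i)) = (indicator (PiE I A) x :: ennreal)"
        using assms(1) by (auto simp: indicator_def PiE_iff intro!: prod_zero)
      then show "ennreal (\<Prod>i\<in>I. g i (x i)) * indicator (PiE I A) x = (\<Prod>i\<in>I. ennreal (g i (x i)) * indicator (A i) (x i))"
        using g(3) by (simp add: prod.distrib prod_ennreal)
    qed
    also have "\<dots> = (\<Prod>i\<in>I. \<integral>\<^sup>+y. ennreal (g i y) * indicator (A i) y \<partial>lborel)"
      using assms(1) by (intro L.product_nn_integral_prod) auto
    also have "\<dots> = (\<Prod>i\<in>I. emeasure (density lborel (\<lambda>x. ennreal (g i x))) (A i))"
    proof (intro prod.cong refl)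
      fix i assume "i \<in> I"
      with A have [measurable]: "A i \<in> sets borel" by simp
      show "(\<integral>\<^sup>+y. ennreal (g i y) * indicator (A i) y \<partial>lborel) = emeasure (density lborel (\<lambda>x. ennreal (g i x))) (A i)"
        by (subst emeasure_density) auto
    qed
    finally show "emeasure (density (PiM I (\<lambda>_. lborel)) (\<lambda>x. ennreal (\<Prod>i\<in>I. g i (x i)))) (PiE I A)
        = (\<Prod>i\<in>I. emeasure (density lborel (\<lambda>x. ennreal (g i x))) (A i))" .
  qed (rule assms(1))
  then show ?thesis by (rule sym)
qed

lemma nn_integral_le_of_simple:
  assumes "\<And>g. g \<in> borel_measurable M \<Longrightarrow> g \<le> F \<Longrightarrow> integral\<^sup>N M g \<le> B"
  shows "integral\<^sup>N M F \<le> B"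
  unfolding nn_integral_def[of M F]
proof (rule SUP_least)
  fix g assume "g \<in> {g. simple_function M g \<and> g \<le> F}"
  then show "integral\<^sup>S M g \<le> B"
    using assms[of g] by (simp add: nn_integral_eq_simple_integral borel_measurable_simple_function)
qed

lemma indep_vars_coordinates:
  assumes "finite I" "I \<noteq> {}" "\<And>i. i \<in> I \<Longrightarrow> prob_space (M i)"
  shows "prob_space.indep_vars (PiM I M) M (\<lambda>i x. x i) I"
proof -
  interpret prob_space "PiM I M" using assms by (intro prob_space_PiM) auto
  have "distr (PiM I M) (PiM I M) (\<lambda>x. \<lambda>i\<in>I. x i) = distr (PiM I M) (PiM I M) (\<lambda>x. x)"
    by (intro distr_cong) (auto simp: space_PiM PiE_def extensional_restrict)
  also have "\<dots> = PiM I M" by (simp add: distr_id[unfolded id_def])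
  also have "\<dots> = PiM I (\<lambda>i. distr (PiM I M) (M i) (\<lambda>x. x i))"
    by (intro PiM_cong refl distr_PiM_component[symmetric] assms(3))
  finally have eq: "distr (PiM I M) (PiM I M) (\<lambda>x. \<lambda>i\<in>I. x i) = PiM I (\<lambda>i. distr (PiM I M) (M i) (\<lambda>x. x i))" .
  show ?thesis
  proof (rule iffD2[OF indep_vars_iff_distr_eq_PiM'[OF assms(2)]])
    show "(\<lambda>x. x i) \<in> PiM I M \<rightarrow>\<^sub>M M i" if "i \<in> I" for i
      by (rule measurable_component_singleton[OF that])
  qed (rule eq)
qed

definition block :: "(real \<Rightarrow> real) \<Rightarrow> (real \<Rightarrow> real) \<Rightarrow> (real \<Rightarrow> real) \<Rightarrow> nat \<Rightarrow> (nat \<Rightarrow> real) \<Rightarrow> real" where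
  "block u v w i X = u (X (3 * i)) * v (X (3 * i + 1)) * w (X (3 * i + 2))"

lemma block_measurable_PiM:
  assumes i: "i < N div 3"
    and [measurable]: "u \<in> borel_measurable borel" "v \<in> borel_measurable borel" "w \<in> borel_measurable borel"
  shows "block u v w i \<in> borel_measurable (PiM {..<N} (\<lambda>_. lborel))"
proof -
  have c: "(\<lambda>X. X a) \<in> borel_measurable (PiM {..<N} (\<lambda>_. lborel :: real measure))" if "a < N" for a
    using measurable_component_singleton[of a "{..<N}" "\<lambda>_. lborel :: real measure"] that by simp
  have iN: "3 * i + 2 < N" using i by auto
  have [measurable]: "(\<lambda>X. X (3 * i)) \<in> borel_measurable (PiM {..<N} (\<lambda>_. lborel :: real measure))"
      "(\<lambda>X. X (3 * i + 1)) \<in> borel_measurable (PiM {..<N} (\<lambda>_. lborel :: real measure))"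
      "(\<lambda>X. X (3 * i + 2)) \<in> borel_measurable (PiM {..<N} (\<lambda>_. lborel :: real measure))"
    using iN by (auto intro!: c)
  show ?thesis unfolding block_def[abs_def] by measurable
qed

subsection \<open>Observations given the states\<close>

locale hmm =
  fixes J :: nat and s :: real and Q :: "nat \<Rightarrow> nat \<Rightarrow> real" and p :: "nat \<Rightarrow> real"
    and f :: "nat \<Rightarrow> real \<Rightarrow> real"
  assumes params: "hmm_params J s Q p f" and s_pos: "s > 0"

sublocale hmm \<subseteq> ergodic_chain J Q p
  using params by unfold_locales (auto simp: hmm_params_def)

context hmm
begin

definition mean :: "(real \<Rightarrow> real) \<Rightarrow> nat \<Rightarrow> real" where
  "mean g j = (\<integral>y. g y * f j y \<partial>lborel)"

lemma f_measurable [measurable]: "j < J \<Longrightarrow> f j \<in> borel_measurable borel"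
  and f_nonneg: "j < J \<Longrightarrow> 0 \<le> f j x"
  and f_integrable: "j < J \<Longrightarrow> integrable lborel (f j)"
  and f_integral: "j < J \<Longrightarrow> integral\<^sup>L lborel (f j) = 1"
  and f_holder: "j < J \<Longrightarrow> f j \<in> holder_space s"
  using params by (auto simp: hmm_params_def prob_density_def)

lemma mean_integrable:
  assumes "j < J" "g \<in> borel_measurable borel" "\<And>y. \<bar>g y\<bar> \<le> c"
  shows "integrable lborel (\<lambda>y. g y * f j y)"
proof (rule Bochner_Integration.integrable_bound)
  show "integrable lborel (\<lambda>y. c * f j y)" using f_integrable[OF assms(1)] by simp
  show "(\<lambda>y. g y * f j y) \<in> borel_measurable lborel" using assms(1,2) by simp
  have c: "c \<ge> 0" using assms(3)[of 0] by linarith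
  show "AE y in lborel. norm (g y * f j y) \<le> norm (c * f j y)"
    using assms(3) c by (auto simp: abs_mult intro!: mult_right_mono)
qed

lemma mean_abs_le:
  assumes "j < J" "g \<in> borel_measurable borel" "\<And>y. \<bar>g y\<bar> \<le> c"
  shows "\<bar>mean g j\<bar> \<le> c"
proof -
  have "\<bar>mean g j\<bar> \<le> (\<integral>y. c * f j y \<partial>lborel)"
    unfolding mean_def
  proof (rule integral_abs_bound_integral[OF mean_integrable[OF assms]])
    show "\<bar>g y * f j y\<bar> \<le> c * f j y" for y
      using assms(3)[of y] f_nonneg[OF assms(1), of y] by (simp add: abs_mult mult_right_mono)
  qed (use f_integrable[OF assms(1)] in simp)
  then show ?thesis using f_integral[OF assms(1)] by simp
qed

lemma mean_1: "j < J \<Longrightarrow> mean (\<lambda>_. 1) j = 1"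
  by (simp add: mean_def f_integral)

lemma mean_divide: "mean (\<lambda>y. g y / c) j = mean g j / c"
  by (simp add: mean_def)

text \<open>Emission laws, with a default for indices that are not states.\<close>

definition emission :: "nat \<Rightarrow> real measure" where
  "emission j = density lborel (\<lambda>y. ennreal (f (if j < J then j else 0) y))"

definition given_states :: "nat \<Rightarrow> (nat \<Rightarrow> nat) \<Rightarrow> (nat \<Rightarrow> real) measure" where
  "given_states N k = PiM {..<N} (\<lambda>i. emission (k i))"

lemma sets_emission [simp, measurable_cong]: "sets (emission j) = sets borel"
  by (simp add: emission_def)

lemma measurable_emission: "measurable (emission j) M = measurable borel M"
  "measurable M (emission j) = measurable M borel"
  by (simp_all cong: measurable_cong_sets)

lemma prob_space_emission: "prob_space (emission j)"
proof -
  have "prob_space (density lborel (\<lambda>y. ennreal (f j y)))" if "j < J" for j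
  proof (rule prob_spaceI)
    have "(\<integral>\<^sup>+y. ennreal (f j y) \<partial>lborel) = 1"
      using f_integral[OF that] f_integrable[OF that] f_nonneg[OF that]
      by (subst nn_integral_eq_integral) auto
    then show "emeasure (density lborel (\<lambda>y. ennreal (f j y))) (space (density lborel (\<lambda>y. ennreal (f j y)))) = 1"
      using that by (simp add: emeasure_density)
  qed
  then show ?thesis using J_pos by (simp add: emission_def)
qed

lemma prob_space_given_states: "prob_space (given_states N k)"
  unfolding given_states_def by (intro prob_space_PiM prob_space_emission)

lemma given_states_density:
  assumes "k \<in> PiE {..<N} (\<lambda>_. {..<J})"
  shows "given_states N k = density (PiM {..<N} (\<lambda>_. lborel)) (\<lambda>x. ennreal (\<Prod>i<N. f (k i) (x i)))"
proof -
  let ?g = "\<lambda>i. f (if k i < J then k i else 0)"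
  have "given_states N k = density (PiM {..<N} (\<lambda>_. lborel)) (\<lambda>x. ennreal (\<Prod>i<N. ?g i (x i)))"
    unfolding given_states_def emission_def
  proof (rule PiM_density_lborel)
    show "prob_space (density lborel (\<lambda>x. ennreal (?g i x)))" for i
      using prob_space_emission[of "k i"] by (simp add: emission_def)
  qed (use f_nonneg J_pos in auto)
  also have "(\<lambda>x. ennreal (\<Prod>i<N. ?g i (x i))) = (\<lambda>x. ennreal (\<Prod>i<N. f (k i) (x i)))"
    using assms by (intro ext arg_cong[where f = ennreal] prod.cong) (auto simp: PiE_iff)
  finally show ?thesis .
qed

lemma sets_given_states: "sets (given_states N k) = sets (PiM {..<N} (\<lambda>_. lborel))"
  unfolding given_states_def by (intro sets_PiM_cong) auto

lemma coordinate_measurable: "a < N \<Longrightarrow> (\<lambda>X. X a) \<in> borel_measurable (given_states N k)"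
  using measurable_component_singleton[of a "{..<N}" "\<lambda>i. emission (k i)"]
  unfolding given_states_def by simp

text \<open>No measurability of F is assumed: the nonnegative integral only sees simple functions below F.\<close>

lemma nn_integral_law_le:
  assumes N: "N \<ge> 1"
    and B: "\<And>k. k \<in> PiE {..<N} (\<lambda>_. {..<J}) \<Longrightarrow> 0 \<le> B k"
      "\<And>k. k \<in> PiE {..<N} (\<lambda>_. {..<J}) \<Longrightarrow> (\<integral>\<^sup>+X. F X \<partial>given_states N k) \<le> ennreal (B k)"
  shows "(\<integral>\<^sup>+X. F X \<partial>hmm_law J Q p f N) \<le> ennreal (E N B)"
proof (rule nn_integral_le_of_simple)
  let ?PM = "PiM {..<N} (\<lambda>_. lborel :: real measure)"
  let ?S = "PiE {..<N} (\<lambda>_. {..<J})"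
  let ?w = "\<lambda>k. ennreal (chain_weight Q p N k)"
  let ?d = "\<lambda>k x. ennreal (\<Prod>i<N. f (k i) (x i))"
  have fin: "finite ?S" by (intro finite_PiE) auto
  fix g assume g: "g \<in> borel_measurable (hmm_law J Q p f N)" "g \<le> F"
  have gm[measurable]: "g \<in> borel_measurable ?PM"
    using g(1) by (simp add: hmm_law_def)
  have dm[measurable]: "?d k \<in> borel_measurable ?PM" if "k \<in> ?S" for k
  proof -
    have "(\<lambda>x. f (k i) (x i)) \<in> borel_measurable ?PM" if "i < N" for i
    proof (rule measurable_compose[of "\<lambda>x. x i"])
      show "(\<lambda>x. x i) \<in> borel_measurable ?PM"
        using measurable_component_singleton[of i "{..<N}" "\<lambda>_. lborel"] that by simp
      show "f (k i) \<in> borel_measurable borel"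
        using \<open>k \<in> ?S\<close> that by (intro f_measurable) (auto simp: PiE_iff)
    qed
    then show ?thesis by (intro measurable_compose[OF _ measurable_ennreal] borel_measurable_prod) auto
  qed
  \<comment> \<open>The law of the data is the mixture, with the path weights, of the product laws
    given the paths.\<close>
  have dens: "ennreal (\<Sum>k\<in>?S. p (k 0) * (\<Prod>i<N - 1. Q (k i) (k (Suc i))) * (\<Prod>i<N. f (k i) (x i)))
      = (\<Sum>k\<in>?S. ?w k * ?d k x)" for x
  proof -
    have nn: "0 \<le> chain_weight Q p N k" "0 \<le> (\<Prod>i<N. f (k i) (x i))" if "k \<in> ?S" for k
      using weight_nonneg[OF that N] that by (auto intro!: prod_nonneg f_nonneg simp: PiE_iff)
    have "ennreal (\<Sum>k\<in>?S. chain_weight Q p N k * (\<Prod>i<N. f (k i) (x i)))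
        = (\<Sum>k\<in>?S. ennreal (chain_weight Q p N k * (\<Prod>i<N. f (k i) (x i))))"
      using nn by (intro sum_ennreal[symmetric] mult_nonneg_nonneg) auto
    also have "\<dots> = (\<Sum>k\<in>?S. ?w k * ?d k x)"
      using nn by (intro sum.cong refl ennreal_mult) auto
    finally show ?thesis by (simp add: chain_weight_def)
  qed
  have "integral\<^sup>N (hmm_law J Q p f N) g = (\<integral>\<^sup>+x. (\<Sum>k\<in>?S. ?w k * ?d k x) * g x \<partial>?PM)"
    unfolding hmm_law_def dens by (rule nn_integral_density) measurable
  also have "\<dots> = (\<integral>\<^sup>+x. (\<Sum>k\<in>?S. ?w k * (?d k x * g x)) \<partial>?PM)"
    by (simp add: sum_distrib_right mult.assoc)
  also have "\<dots> = (\<Sum>k\<in>?S. ?w k * (\<integral>\<^sup>+x. ?d k x * g x \<partial>?PM))"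
  proof (subst nn_integral_sum)
    show "(\<lambda>x. ?w k * (?d k x * g x)) \<in> borel_measurable ?PM" if "k \<in> ?S" for k
      using dm[OF that] gm by measurable
    show "(\<Sum>k\<in>?S. \<integral>\<^sup>+x. ?w k * (?d k x * g x) \<partial>?PM) = (\<Sum>k\<in>?S. ?w k * (\<integral>\<^sup>+x. ?d k x * g x \<partial>?PM))"
    proof (intro sum.cong refl nn_integral_cmult)
      show "(\<lambda>x. ?d k x * g x) \<in> borel_measurable ?PM" if "k \<in> ?S" for k
        using dm[OF that] gm by measurable
    qed
  qed
  also have "\<dots> = (\<Sum>k\<in>?S. ?w k * (\<integral>\<^sup>+x. g x \<partial>given_states N k))"
  proof (intro sum.cong refl arg_cong2[where f = "(*)"])
    fix k assume k: "k \<in> ?S"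
    show "(\<integral>\<^sup>+x. ?d k x * g x \<partial>?PM) = (\<integral>\<^sup>+x. g x \<partial>given_states N k)"
      unfolding given_states_density[OF k] using k by (subst nn_integral_density) auto
  qed
  also have "\<dots> \<le> (\<Sum>k\<in>?S. ?w k * ennreal (B k))"
  proof (intro sum_mono mult_left_mono)
    fix k assume k: "k \<in> ?S"
    have "(\<integral>\<^sup>+x. g x \<partial>given_states N k) \<le> (\<integral>\<^sup>+x. F x \<partial>given_states N k)"
      using g(2) by (intro nn_integral_mono) (auto simp: le_fun_def)
    with B(2)[OF k] show "(\<integral>\<^sup>+x. g x \<partial>given_states N k) \<le> ennreal (B k)" by simp
  qed auto
  also have "\<dots> = (\<Sum>k\<in>?S. ennreal (chain_weight Q p N k * B k))"
    using B(1) weight_nonneg[OF _ N] by (intro sum.cong refl ennreal_mult[symmetric]) auto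
  also have "\<dots> = ennreal (E N B)"
    unfolding chain_expectation_def
    using B(1) weight_nonneg[OF _ N] by (intro sum_ennreal mult_nonneg_nonneg) auto
  finally show "integral\<^sup>N (hmm_law J Q p f N) g \<le> ennreal (E N B)" .
qed

definition block_mean ::
    "(real \<Rightarrow> real) \<Rightarrow> (real \<Rightarrow> real) \<Rightarrow> (real \<Rightarrow> real) \<Rightarrow> (nat \<Rightarrow> nat) \<Rightarrow> nat \<Rightarrow> real" where
  "block_mean u v w k i = mean u (k (3 * i)) * mean v (k (3 * i + 1)) * mean w (k (3 * i + 2))"

lemma expectation_coordinate:
  assumes k: "k \<in> PiE {..<N} (\<lambda>_. {..<J})" and a: "a < N" and g: "g \<in> borel_measurable borel"
  shows "(\<integral>X. g (X a) \<partial>given_states N k) = mean g (k a)"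
proof -
  have ka: "k a < J" using k a by (auto simp: PiE_iff)
  have "(\<integral>X. g (X a) \<partial>given_states N k) = (\<integral>y. g y \<partial>distr (given_states N k) (emission (k a)) (\<lambda>X. X a))"
    using coordinate_measurable[OF a, of k] g by (subst integral_distr) (auto simp: measurable_emission)
  also have "distr (given_states N k) (emission (k a)) (\<lambda>X. X a) = emission (k a)"
    unfolding given_states_def using a prob_space_emission by (intro distr_PiM_component) auto
  also have "(\<integral>y. g y \<partial>emission (k a)) = mean g (k a)"
    unfolding emission_def mean_def using ka g f_nonneg
    by (subst integral_density) (auto simp: mult.commute)
  finally show ?thesis .
qed

lemma expectation_block:
  assumes k: "k \<in> PiE {..<N} (\<lambda>_. {..<J})" and i: "i < N div 3"
    and [measurable]: "u \<in> borel_measurable borel" "v \<in> borel_measurable borel" "w \<in> borel_measurable borel"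
    and bnd: "\<And>y. \<bar>u y\<bar> \<le> 1" "\<And>y. \<bar>v y\<bar> \<le> 1" "\<And>y. \<bar>w y\<bar> \<le> 1"
  shows "(\<integral>X. block u v w i X \<partial>given_states N k) = block_mean u v w k i"
proof -
  interpret prob_space "given_states N k" by (rule prob_space_given_states)
  have iN: "3 * i + 2 < N" using i by auto
  define G where "G a = (if a = 3 * i then u else if a = 3 * i + 1 then v else w)" for a
  have Gm: "G a \<in> borel_measurable borel" for a by (simp add: G_def)
  have Gb: "\<bar>G a y\<bar> \<le> 1" for a y using bnd by (simp add: G_def)
  let ?A = "{3 * i, 3 * i + 1, 3 * i + 2}"
  have "indep_vars (\<lambda>i. emission (k i)) (\<lambda>i X. X i) {..<N}"
    unfolding given_states_def
    by (rule indep_vars_coordinates) (use iN prob_space_emission in auto)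
  then have "indep_vars (\<lambda>i. emission (k i)) (\<lambda>i X. X i) ?A"
    by (rule indep_vars_subset) (use iN in auto)
  then have ind: "indep_vars (\<lambda>_. borel) (\<lambda>a X. G a (X a)) ?A"
    by (rule indep_vars_compose2) (use Gm in \<open>auto simp: measurable_emission\<close>)
  have int: "integrable (given_states N k) (\<lambda>X. G a (X a))" if "a \<in> ?A" for a
  proof (rule integrable_const_bound[where B = 1])
    show "(\<lambda>X. G a (X a)) \<in> borel_measurable (given_states N k)"
      using that iN by (intro measurable_compose[OF coordinate_measurable Gm]) auto
  qed (use Gb in auto)
  have "(\<integral>X. block u v w i X \<partial>given_states N k) = (\<integral>X. (\<Prod>a\<in>?A. G a (X a)) \<partial>given_states N k)"
    by (simp add: block_def G_def mult.assoc)
  also have "\<dots> = (\<Prod>a\<in>?A. \<integral>X. G a (X a) \<partial>given_states N k)"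
    by (rule indep_vars_lebesgue_integral[OF _ ind int]) auto
  also have "\<dots> = (\<Prod>a\<in>?A. mean (G a) (k a))"
    using iN by (intro prod.cong refl expectation_coordinate[OF k _ Gm]) auto
  also have "\<dots> = block_mean u v w k i"
    by (simp add: block_mean_def G_def mult.assoc)
  finally show ?thesis .
qed

text \<open>Given the states, the blocks use disjoint coordinates and are independent, so the
  exponential moment bound applies. The outer factors are bounded by 1; only the second moment of
  the middle one, which may be a narrow kernel, is kept.\<close>

lemma block_cosh_moment:
  assumes k: "k \<in> PiE {..<N} (\<lambda>_. {..<J})" and n: "n = N div 3" and N: "N \<ge> 1"
    and [measurable]: "u \<in> borel_measurable borel" "v \<in> borel_measurable borel" "w \<in> borel_measurable borel"
    and bnd: "\<And>y. \<bar>u y\<bar> \<le> 1" "\<And>y. \<bar>v y\<bar> \<le> 1" "\<And>y. \<bar>w y\<bar> \<le> 1"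
    and \<beta>: "\<bar>\<beta>\<bar> \<le> 1/2"
  shows "(\<integral>\<^sup>+X. ennreal (cosh (\<beta> * (\<Sum>i<n. block u v w i X - block_mean u v w k i)) - 1) \<partial>given_states N k)
    \<le> ennreal (exp (\<beta>\<^sup>2 * (\<Sum>i<n. mean (\<lambda>y. (v y)\<^sup>2) (k (3 * i + 1)))) - 1)"
proof -
  interpret prob_space "given_states N k" by (rule prob_space_given_states)
  define W where "W i X = block u v w i X" for i X
  have ind0: "indep_vars (\<lambda>i. emission (k i)) (\<lambda>i X. X i) {..<N}"
    unfolding given_states_def
    by (rule indep_vars_coordinates) (use N prob_space_emission in \<open>auto simp: lessThan_empty_iff\<close>)
  define A where "A i = {3 * i, 3 * i + 1, 3 * i + 2}" for i :: nat
  have "indep_vars (\<lambda>j. PiM (A j) (\<lambda>i. emission (k i))) (\<lambda>j X. restrict (\<lambda>i. X i) (A j)) {..<n}"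
    by (rule indep_vars_restrict[OF ind0]) (use n in \<open>auto simp: A_def disjoint_family_on_def\<close>)
  then have "indep_vars (\<lambda>_. borel) (\<lambda>i X. W i (restrict X (A i))) {..<n}"
  proof (rule indep_vars_compose2)
    fix i
    have c: "(\<lambda>X. X a) \<in> borel_measurable (PiM (A i) (\<lambda>i. emission (k i)))" if "a \<in> A i" for a
      using measurable_component_singleton[OF that, of "\<lambda>i. emission (k i)"] by (simp add: measurable_emission)
    have [measurable]: "(\<lambda>X. X (3 * i)) \<in> borel_measurable (PiM (A i) (\<lambda>i. emission (k i)))"
      "(\<lambda>X. X (3 * i + 1)) \<in> borel_measurable (PiM (A i) (\<lambda>i. emission (k i)))"
      "(\<lambda>X. X (3 * i + 2)) \<in> borel_measurable (PiM (A i) (\<lambda>i. emission (k i)))"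
      by (auto intro!: c simp: A_def)
    show "W i \<in> borel_measurable (PiM (A i) (\<lambda>i. emission (k i)))"
      unfolding W_def[abs_def] block_def by measurable
  qed
  moreover have "W i (restrict X (A i)) = W i X" for i X
    by (simp add: W_def block_def A_def)
  ultimately have ind: "indep_vars (\<lambda>_. borel) W {..<n}" by simp
  have Wb: "\<bar>W i X\<bar> \<le> 1" for i X
    unfolding W_def block_def abs_mult
    by (intro mult_le_one bnd mult_nonneg_nonneg) auto
  have Wexp: "expectation (W i) = block_mean u v w k i" if "i < n" for i
    unfolding W_def using that n bnd by (intro expectation_block[OF k]) auto
  have sq1: "\<bar>(g y)\<^sup>2\<bar> \<le> 1" if "\<And>y. \<bar>g y\<bar> \<le> 1" for g :: "real \<Rightarrow> real" and y
    using that[of y] by (simp add: abs_square_le_1)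
  have Wsq: "expectation (\<lambda>X. (W i X)\<^sup>2) \<le> mean (\<lambda>y. (v y)\<^sup>2) (k (3 * i + 1))" if "i < n" for i
  proof -
    have iN: "3 * i + 2 < N" using that n by auto
    have kJ: "k (3 * i) < J" "k (3 * i + 1) < J" "k (3 * i + 2) < J"
      using k iN by (auto simp: PiE_iff)
    have "(\<lambda>X. (W i X)\<^sup>2) = block (\<lambda>y. (u y)\<^sup>2) (\<lambda>y. (v y)\<^sup>2) (\<lambda>y. (w y)\<^sup>2) i"
      by (auto simp: W_def block_def power_mult_distrib)
    moreover have "expectation (block (\<lambda>y. (u y)\<^sup>2) (\<lambda>y. (v y)\<^sup>2) (\<lambda>y. (w y)\<^sup>2) i)
        = block_mean (\<lambda>y. (u y)\<^sup>2) (\<lambda>y. (v y)\<^sup>2) (\<lambda>y. (w y)\<^sup>2) k i"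
      by (rule expectation_block[OF k]) (use that n sq1[OF bnd(1)] sq1[OF bnd(2)] sq1[OF bnd(3)] in auto)
    ultimately have eq: "expectation (\<lambda>X. (W i X)\<^sup>2) = block_mean (\<lambda>y. (u y)\<^sup>2) (\<lambda>y. (v y)\<^sup>2) (\<lambda>y. (w y)\<^sup>2) k i"
      by simp
    have nn: "0 \<le> mean (\<lambda>y. (g y)\<^sup>2) j" if "j < J" for g :: "real \<Rightarrow> real" and j
      unfolding mean_def using f_nonneg[OF that] by (intro integral_nonneg_AE) auto
    have m1: "mean (\<lambda>y. (u y)\<^sup>2) (k (3 * i)) \<le> 1" "mean (\<lambda>y. (w y)\<^sup>2) (k (3 * i + 2)) \<le> 1"
      using mean_abs_le[OF kJ(1), of "\<lambda>y. (u y)\<^sup>2" 1] mean_abs_le[OF kJ(3), of "\<lambda>y. (w y)\<^sup>2" 1]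
        sq1[of u, OF bnd(1)] sq1[of w, OF bnd(3)] by auto
    have "block_mean (\<lambda>y. (u y)\<^sup>2) (\<lambda>y. (v y)\<^sup>2) (\<lambda>y. (w y)\<^sup>2) k i \<le> 1 * mean (\<lambda>y. (v y)\<^sup>2) (k (3 * i + 1)) * 1"
      unfolding block_mean_def
      using m1 nn[OF kJ(1), of u] nn[OF kJ(2), of v] nn[OF kJ(3), of w]
      by (intro mult_mono) auto
    then show ?thesis using eq by simp
  qed
  have sums: "(\<Sum>i<n. block u v w i X - block_mean u v w k i) = (\<Sum>i<n. W i X - expectation (W i))" for X
    by (intro sum.cong) (auto simp: Wexp W_def)
  note c = bernstein_cosh_moment[OF finite_lessThan ind Wb _ \<beta>, where q = "\<lambda>i. mean (\<lambda>y. (v y)\<^sup>2) (k (3 * i + 1))"]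
  have int: "integrable (given_states N k) (\<lambda>X. cosh (\<beta> * (\<Sum>i<n. W i X - expectation (W i))) - 1)"
    using c(1) Wsq by simp
  have "(\<integral>\<^sup>+X. ennreal (cosh (\<beta> * (\<Sum>i<n. W i X - expectation (W i))) - 1) \<partial>given_states N k)
    = ennreal (expectation (\<lambda>X. cosh (\<beta> * (\<Sum>i<n. W i X - expectation (W i))) - 1))"
    by (rule nn_integral_eq_integral[OF int]) (auto simp: cosh_real_ge_1)
  also have "\<dots> \<le> ennreal (exp (\<beta>\<^sup>2 * (\<Sum>i<n. mean (\<lambda>y. (v y)\<^sup>2) (k (3 * i + 1)))) - 1)"
    using c Wsq by (intro ennreal_leI) (simp add: prob_space)
  finally show ?thesis unfolding sums .
qed

end

lemma cosh_measurable [measurable]: "(cosh :: real \<Rightarrow> real) \<in> borel_measurable borel"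
  unfolding cosh_def[abs_def] by measurable

section \<open>Frequencies of state triples and deviations of block averages\<close>

context hmm
begin

definition triple_prob :: "nat \<Rightarrow> nat \<Rightarrow> nat \<Rightarrow> real" where
  "triple_prob a b d = p a * Q a b * Q b d"

definition at_triple :: "nat \<Rightarrow> nat \<Rightarrow> nat \<Rightarrow> nat \<Rightarrow> nat \<Rightarrow> nat \<Rightarrow> real" where
  "at_triple a b d a' b' d' = of_bool (a = a') * of_bool (b = b') * of_bool (d = d')"

lemma sum_at_triple:
  assumes "a' < J" "b' < J" "d' < J"
  shows "(\<Sum>a<J. \<Sum>b<J. \<Sum>d<J. at_triple a b d a' b' d' * g a b d) = g a' b' d'"
proof -
  have "(\<Sum>d<J. at_triple a b d a' b' d' * g a b d) = of_bool (a = a') * of_bool (b = b') * g a b d'" for a b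
  proof -
    have "(\<Sum>d<J. at_triple a b d a' b' d' * g a b d) = (\<Sum>d<J. if d = d' then of_bool (a = a') * of_bool (b = b') * g a b d else 0)"
      by (rule sum.cong) (auto simp: at_triple_def)
    then show ?thesis using assms by simp
  qed
  moreover have "(\<Sum>b<J. of_bool (a = a') * of_bool (b = b') * g a b d') = of_bool (a = a') * g a b' d'" for a
  proof -
    have "(\<Sum>b<J. of_bool (a = a') * of_bool (b = b') * g a b d') = (\<Sum>b<J. if b = b' then of_bool (a = a') * g a b d' else 0)"
      by (rule sum.cong) auto
    then show ?thesis using assms by simp
  qed
  moreover have "(\<Sum>a<J. of_bool (a = a') * g a b' d') = g a' b' d'"
  proof -
    have "(\<Sum>a<J. of_bool (a = a') * g a b' d') = (\<Sum>a<J. if a = a' then g a b' d' else 0)"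
      by (rule sum.cong) auto
    then show ?thesis using assms by simp
  qed
  ultimately show ?thesis by (simp only:)
qed

text \<open>The l1 distance between the empirical and the stationary law of state triples. One
  random quantity then serves every test function, in particular all points x of the supremum at
  once.\<close>

definition triple_dev :: "nat \<Rightarrow> (nat \<Rightarrow> nat) \<Rightarrow> real" where
  "triple_dev n k = (\<Sum>a<J. \<Sum>b<J. \<Sum>d<J.
     \<bar>(\<Sum>i<n. at_triple a b d (k (3*i)) (k (3*i+1)) (k (3*i+2))) / n - triple_prob a b d\<bar>)"

lemma triple_dev_nonneg: "triple_dev n k \<ge> 0"
  unfolding triple_dev_def by (intro sum_nonneg) auto

lemma triple_dev_expectation:
  "\<exists>C\<ge>0. \<forall>N n. n = N div 3 \<longrightarrow> n \<ge> 1 \<longrightarrow> E N (triple_dev n) \<le> C / sqrt n"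
proof -
  have "\<exists>C\<ge>0. \<forall>N n. n = N div 3 \<longrightarrow> n \<ge> 1 \<longrightarrow>
     E N (\<lambda>k. \<bar>(\<Sum>i<n. at_triple a b d (k (3*i)) (k (3*i+1)) (k (3*i+2))) / n - triple_prob a b d\<bar>) \<le> C / sqrt n"
    if "a < J" "b < J" "d < J" for a b d
  proof -
    have "(\<Sum>a'<J. p a' * (\<Sum>b'<J. Q a' b' * (\<Sum>d'<J. Q b' d' * at_triple a b d a' b' d')))
        = (\<Sum>a'<J. \<Sum>b'<J. \<Sum>d'<J. at_triple a' b' d' a b d * triple_prob a' b' d')"
      unfolding sum_distrib_left
      by (intro sum.cong refl) (auto simp: at_triple_def triple_prob_def)
    also have "\<dots> = triple_prob a b d"
      using that by (rule sum_at_triple)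
    finally have eq: "(\<Sum>a'<J. p a' * (\<Sum>b'<J. Q a' b' * (\<Sum>d'<J. Q b' d' * at_triple a b d a' b' d'))) = triple_prob a b d" .
    show ?thesis
      using triple_average_deviation[of "at_triple a b d"] unfolding eq .
  qed
  then have ex: "\<exists>C. a < J \<longrightarrow> b < J \<longrightarrow> d < J \<longrightarrow> C \<ge> 0 \<and> (\<forall>N n. n = N div 3 \<longrightarrow> n \<ge> 1 \<longrightarrow>
     E N (\<lambda>k. \<bar>(\<Sum>i<n. at_triple a b d (k (3*i)) (k (3*i+1)) (k (3*i+2))) / n - triple_prob a b d\<bar>) \<le> C / sqrt n)"
    for a b d
    by (cases "a < J \<and> b < J \<and> d < J") auto
  define C where "C a b d = (SOME C. a < J \<longrightarrow> b < J \<longrightarrow> d < J \<longrightarrow> C \<ge> 0 \<and> (\<forall>N n. n = N div 3 \<longrightarrow> n \<ge> 1 \<longrightarrow>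
     E N (\<lambda>k. \<bar>(\<Sum>i<n. at_triple a b d (k (3*i)) (k (3*i+1)) (k (3*i+2))) / n - triple_prob a b d\<bar>) \<le> C / sqrt n))" for a b d
  have C: "C a b d \<ge> 0"
    "n = N div 3 \<Longrightarrow> n \<ge> 1 \<Longrightarrow>
     E N (\<lambda>k. \<bar>(\<Sum>i<n. at_triple a b d (k (3*i)) (k (3*i+1)) (k (3*i+2))) / n - triple_prob a b d\<bar>) \<le> C a b d / sqrt n"
    if "a < J" "b < J" "d < J" for a b d N n
    using someI_ex[OF ex[of a b d]] that unfolding C_def[symmetric] by blast+
  define C' where "C' = (\<Sum>a<J. \<Sum>b<J. \<Sum>d<J. C a b d)"
  have "E N (triple_dev n) \<le> C' / sqrt n" if "n = N div 3" "n \<ge> 1" for N n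
    unfolding triple_dev_def[abs_def] C'_def chain_expectation_sum sum_divide_distrib[of _ _ "sqrt n"]
    by (intro sum_mono C(2) that) auto
  moreover have "C' \<ge> 0" unfolding C'_def using C(1) by (intro sum_nonneg) auto
  ultimately show ?thesis by blast
qed

text \<open>A function of a triple is a combination of the indicators \<open>at_triple\<close>, so
  the duality of l1 norm and supremum norm applies.\<close>

lemma triple_dev_bound:
  assumes k: "k \<in> PiE {..<N} (\<lambda>_. {..<J})" and n: "n = N div 3"
    and g: "\<And>a b d. a < J \<Longrightarrow> b < J \<Longrightarrow> d < J \<Longrightarrow> \<bar>g a b d\<bar> \<le> c"
  shows "\<bar>(\<Sum>i<n. g (k (3*i)) (k (3*i+1)) (k (3*i+2))) / n
     - (\<Sum>a<J. \<Sum>b<J. \<Sum>d<J. triple_prob a b d * g a b d)\<bar> \<le> c * triple_dev n k"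
proof -
  let ?I = "\<lambda>a b d i. at_triple a b d (k (3*i)) (k (3*i+1)) (k (3*i+2))"
  have gi: "g (k (3*i)) (k (3*i+1)) (k (3*i+2)) = (\<Sum>a<J. \<Sum>b<J. \<Sum>d<J. ?I a b d i * g a b d)" if "i < n" for i
  proof -
    have kJ: "k (3*i) < J" "k (3*i+1) < J" "k (3*i+2) < J"
      using k that n by (auto simp: PiE_iff)
    then show ?thesis using sum_at_triple[OF kJ, of g] by (simp add: at_triple_def)
  qed
  have swap3: "(\<Sum>i<n. \<Sum>a<J. \<Sum>b<J. \<Sum>d<J. F a b d i) = (\<Sum>a<J. \<Sum>b<J. \<Sum>d<J. \<Sum>i<n. F a b d i)"
    for F :: "nat \<Rightarrow> nat \<Rightarrow> nat \<Rightarrow> nat \<Rightarrow> real"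
  proof -
    have "(\<Sum>i<n. \<Sum>a<J. \<Sum>b<J. \<Sum>d<J. F a b d i) = (\<Sum>a<J. \<Sum>i<n. \<Sum>b<J. \<Sum>d<J. F a b d i)"
      by (rule sum.swap)
    also have "\<dots> = (\<Sum>a<J. \<Sum>b<J. \<Sum>i<n. \<Sum>d<J. F a b d i)"
      by (rule sum.cong[OF refl], rule sum.swap)
    also have "\<dots> = (\<Sum>a<J. \<Sum>b<J. \<Sum>d<J. \<Sum>i<n. F a b d i)"
      by (rule sum.cong[OF refl], rule sum.cong[OF refl], rule sum.swap)
    finally show ?thesis .
  qed
  have "(\<Sum>i<n. g (k (3*i)) (k (3*i+1)) (k (3*i+2))) = (\<Sum>i<n. \<Sum>a<J. \<Sum>b<J. \<Sum>d<J. ?I a b d i * g a b d)"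
    by (intro sum.cong refl gi) simp
  also have "\<dots> = (\<Sum>a<J. \<Sum>b<J. \<Sum>d<J. \<Sum>i<n. ?I a b d i * g a b d)"
    by (rule swap3)
  finally have "(\<Sum>i<n. g (k (3*i)) (k (3*i+1)) (k (3*i+2))) / n = (\<Sum>a<J. \<Sum>b<J. \<Sum>d<J. \<Sum>i<n. ?I a b d i * g a b d) / n"
    by (rule arg_cong)
  also have "\<dots> = (\<Sum>a<J. \<Sum>b<J. \<Sum>d<J. (\<Sum>i<n. ?I a b d i) / n * g a b d)"
    by (simp only: sum_divide_distrib sum_distrib_right times_divide_eq_left)
  finally have eq: "(\<Sum>i<n. g (k (3*i)) (k (3*i+1)) (k (3*i+2))) / n
      = (\<Sum>a<J. \<Sum>b<J. \<Sum>d<J. (\<Sum>i<n. ?I a b d i) / n * g a b d)" .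
  have "\<bar>(\<Sum>i<n. g (k (3*i)) (k (3*i+1)) (k (3*i+2))) / n
     - (\<Sum>a<J. \<Sum>b<J. \<Sum>d<J. triple_prob a b d * g a b d)\<bar>
    = \<bar>\<Sum>a<J. \<Sum>b<J. \<Sum>d<J. ((\<Sum>i<n. ?I a b d i) / n - triple_prob a b d) * g a b d\<bar>"
    unfolding eq by (simp only: sum_subtractf[symmetric] left_diff_distrib)
  also have "\<dots> \<le> (\<Sum>a<J. \<Sum>b<J. \<Sum>d<J. \<bar>((\<Sum>i<n. ?I a b d i) / n - triple_prob a b d) * g a b d\<bar>)"
    by (intro order_trans[OF sum_abs] sum_mono order_refl)
  also have "\<dots> \<le> (\<Sum>a<J. \<Sum>b<J. \<Sum>d<J. \<bar>(\<Sum>i<n. ?I a b d i) / n - triple_prob a b d\<bar> * c)"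
    unfolding abs_mult by (intro sum_mono mult_left_mono g) auto
  also have "\<dots> = c * triple_dev n k"
    unfolding triple_dev_def sum_distrib_left by (intro sum.cong refl) (rule mult.commute)
  finally show ?thesis .
qed

text \<open>Not normalised: the mean of u at the first observation on the event that the middle
  state is b. It carries the stationary weight of b, whereas \<open>after\<close> is a conditional
  mean.\<close>

definition before :: "(real \<Rightarrow> real) \<Rightarrow> nat \<Rightarrow> real" where
  "before u b = (\<Sum>a<J. p a * Q a b * mean u a)"

definition after :: "(real \<Rightarrow> real) \<Rightarrow> nat \<Rightarrow> real" where
  "after w b = (\<Sum>d<J. Q b d * mean w d)"

definition triple_mean :: "(real \<Rightarrow> real) \<Rightarrow> (real \<Rightarrow> real) \<Rightarrow> (real \<Rightarrow> real) \<Rightarrow> real" where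
  "triple_mean u v w = (\<Sum>b<J. before u b * mean v b * after w b)"

lemma triple_mean_eq:
  "triple_mean u v w = (\<Sum>a<J. \<Sum>b<J. \<Sum>d<J. triple_prob a b d * (mean u a * mean v b * mean w d))"
proof -
  have "triple_mean u v w = (\<Sum>b<J. \<Sum>a<J. \<Sum>d<J. triple_prob a b d * (mean u a * mean v b * mean w d))"
    unfolding triple_mean_def before_def after_def triple_prob_def sum_product sum_distrib_right
    by (intro sum.cong refl) (simp add: sum_distrib_left algebra_simps)
  also have "\<dots> = (\<Sum>a<J. \<Sum>b<J. \<Sum>d<J. triple_prob a b d * (mean u a * mean v b * mean w d))"
    by (rule sum.swap)
  finally show ?thesis .
qed

lemma block_mean_deviation:
  assumes "k \<in> PiE {..<N} (\<lambda>_. {..<J})" "n = N div 3"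
    and [measurable]: "u \<in> borel_measurable borel" "w \<in> borel_measurable borel"
    and u: "\<And>y. \<bar>u y\<bar> \<le> 1" and w: "\<And>y. \<bar>w y\<bar> \<le> 1"
    and v: "\<And>b. b < J \<Longrightarrow> \<bar>mean v b\<bar> \<le> c"
  shows "\<bar>(\<Sum>i<n. block_mean u v w k i) / n - triple_mean u v w\<bar> \<le> c * triple_dev n k"
  unfolding block_mean_def triple_mean_eq
proof (rule triple_dev_bound[OF assms(1,2)])
  fix a b d assume J: "a < J" "b < J" "d < J"
  have "\<bar>mean u a\<bar> \<le> 1" "\<bar>mean w d\<bar> \<le> 1"
    using J u w by (auto intro!: mean_abs_le)
  then have "\<bar>mean u a\<bar> * \<bar>mean v b\<bar> * \<bar>mean w d\<bar> \<le> 1 * c * 1"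
    using v[OF J(2)] by (intro mult_mono mult_nonneg_nonneg) auto
  then show "\<bar>mean u a * mean v b * mean w d\<bar> \<le> c" by (simp add: abs_mult)
qed

lemma block_measurable:
  assumes i: "i < N div 3"
    and [measurable]: "u \<in> borel_measurable borel" "v \<in> borel_measurable borel" "w \<in> borel_measurable borel"
  shows "block u v w i \<in> borel_measurable (given_states N k)"
  using block_measurable_PiM[OF assms] measurable_cong_sets[OF sets_given_states refl] by blast

text \<open>The error splits into the fluctuation of the blocks around their conditional means, of
  order 1/sqrt n by the exponential moment, and the fluctuation of the state frequencies.\<close>

lemma moment_deviation:
  "\<exists>C\<ge>0. \<forall>N n u v w. n = N div 3 \<longrightarrow> n \<ge> 1 \<longrightarrow>
    u \<in> borel_measurable borel \<longrightarrow> v \<in> borel_measurable borel \<longrightarrow> w \<in> borel_measurable borel \<longrightarrow>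
    (\<forall>y. \<bar>u y\<bar> \<le> 1) \<longrightarrow> (\<forall>y. \<bar>v y\<bar> \<le> 1) \<longrightarrow> (\<forall>y. \<bar>w y\<bar> \<le> 1) \<longrightarrow>
    (\<integral>\<^sup>+X. ennreal \<bar>(\<Sum>i<n. block u v w i X) / n - triple_mean u v w\<bar> \<partial>hmm_law J Q p f N) \<le> ennreal (C / sqrt n)"
proof -
  obtain C where C: "C \<ge> 0" "\<And>N n. n = N div 3 \<Longrightarrow> n \<ge> 1 \<Longrightarrow> E N (triple_dev n) \<le> C / sqrt n"
    using triple_dev_expectation by blast
  have "(\<integral>\<^sup>+X. ennreal \<bar>(\<Sum>i<n. block u v w i X) / n - triple_mean u v w\<bar> \<partial>hmm_law J Q p f N) \<le> ennreal ((2 * exp 1 + C) / sqrt n)"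
    if n: "n = N div 3" "n \<ge> 1"
      and meas: "u \<in> borel_measurable borel" "v \<in> borel_measurable borel" "w \<in> borel_measurable borel"
      and bnd: "\<forall>y. \<bar>u y\<bar> \<le> 1" "\<forall>y. \<bar>v y\<bar> \<le> 1" "\<forall>y. \<bar>w y\<bar> \<le> 1" for N n u v w
  proof -
    have N1: "N \<ge> 1" using n by (cases N) auto
    have per_k: "(\<integral>\<^sup>+X. ennreal \<bar>(\<Sum>i<n. block u v w i X) / n - triple_mean u v w\<bar> \<partial>given_states N k)
        \<le> ennreal (2 * exp 1 / sqrt n + triple_dev n k)" if k: "k \<in> PiE {..<N} (\<lambda>_. {..<J})" for k
    proof -
      interpret prob_space "given_states N k" by (rule prob_space_given_states)
      define S where "S X = (\<Sum>i<n. block u v w i X - block_mean u v w k i)" for X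
      \<comment> \<open>The inverse scale of S: \<beta>^2 n is 1/4, so the exponential moment stays
        bounded, while |S| is at most the hyperbolic cosine divided by \<beta>.\<close>
      define \<beta> where "\<beta> = 1 / (2 * sqrt n)"
      have \<beta>: "\<beta> > 0" "\<bar>\<beta>\<bar> \<le> 1/2" using n by (auto simp: \<beta>_def field_simps)
      have \<beta>n: "\<beta>\<^sup>2 * n = 1/4" using n by (simp add: \<beta>_def field_simps power2_eq_square)
      have S_bound: "\<bar>(\<Sum>i<n. block u v w i X) / n - triple_mean u v w\<bar>
          \<le> (2 / sqrt n + triple_dev n k) + 2 / sqrt n * (cosh (\<beta> * S X) - 1)" for X
      proof -
        have "\<bar>\<beta> * S X\<bar> \<le> cosh (\<beta> * S X)"
        proof -
          have "y \<le> cosh y" if "y \<ge> 0" for y :: real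
          proof -
            have "2 * y \<le> exp y"
              using exp_lower_Taylor_quadratic[OF that] zero_le_power2[of "y - 1"]
              by (simp add: power2_eq_square algebra_simps)
            then have "2 * y \<le> exp y + exp (- y)"
              by (rule add_increasing2[OF exp_ge_zero])
            then show ?thesis by (simp add: cosh_def)
          qed
          from this[of "\<bar>\<beta> * S X\<bar>"] have "\<bar>\<beta> * S X\<bar> \<le> cosh \<bar>\<beta> * S X\<bar>" by simp
          then show ?thesis by (cases "\<beta> * S X \<ge> 0") auto
        qed
        then have "\<bar>S X\<bar> \<le> cosh (\<beta> * S X) / \<beta>"
          using \<beta> by (simp add: abs_mult le_divide_eq mult.commute)
        then have "\<bar>S X\<bar> / n \<le> (cosh (\<beta> * S X) / \<beta>) / n"
          by (intro divide_right_mono) auto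
        also have "\<dots> = 2 / sqrt n * cosh (\<beta> * S X)"
          using n by (simp add: \<beta>_def field_simps)
        finally have 1: "\<bar>S X / n\<bar> \<le> 2 / sqrt n + 2 / sqrt n * (cosh (\<beta> * S X) - 1)"
          by (simp add: abs_divide right_diff_distrib)
        have 2: "\<bar>(\<Sum>i<n. block_mean u v w k i) / n - triple_mean u v w\<bar> \<le> 1 * triple_dev n k"
          using meas bnd by (intro block_mean_deviation[OF k n(1)] mean_abs_le) auto
        have "(\<Sum>i<n. block u v w i X) / n = S X / n + (\<Sum>i<n. block_mean u v w k i) / n"
          by (simp add: S_def sum_subtractf diff_divide_distrib)
        with 1 2 show ?thesis by linarith
      qed
      have Sm: "S \<in> borel_measurable (given_states N k)"
        unfolding S_def[abs_def] using n meas
        by (intro borel_measurable_sum borel_measurable_diff block_measurable) auto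
      have q: "(\<Sum>i<n. mean (\<lambda>y. (v y)\<^sup>2) (k (3 * i + 1))) \<le> (\<Sum>i<n. 1)"
      proof (intro sum_mono)
        fix i assume "i \<in> {..<n}"
        then have "k (3 * i + 1) < J" using k n by (auto simp: PiE_iff)
        then have "\<bar>mean (\<lambda>y. (v y)\<^sup>2) (k (3 * i + 1))\<bar> \<le> 1"
          using meas bnd by (intro mean_abs_le) (auto simp: abs_square_le_1)
        then show "mean (\<lambda>y. (v y)\<^sup>2) (k (3 * i + 1)) \<le> 1" by linarith
      qed
      have "(\<integral>\<^sup>+X. ennreal (cosh (\<beta> * S X) - 1) \<partial>given_states N k)
          \<le> ennreal (exp (\<beta>\<^sup>2 * (\<Sum>i<n. mean (\<lambda>y. (v y)\<^sup>2) (k (3 * i + 1)))) - 1)"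
        unfolding S_def using bnd \<beta>(2) by (intro block_cosh_moment[OF k n(1) N1 meas]) auto
      also have "\<dots> \<le> ennreal (exp 1 - 1)"
      proof (intro ennreal_leI diff_right_mono)
        have "\<beta>\<^sup>2 * (\<Sum>i<n. mean (\<lambda>y. (v y)\<^sup>2) (k (3 * i + 1))) \<le> \<beta>\<^sup>2 * n"
          using q by (intro mult_left_mono) auto
        then show "exp (\<beta>\<^sup>2 * (\<Sum>i<n. mean (\<lambda>y. (v y)\<^sup>2) (k (3 * i + 1)))) \<le> exp 1"
          using \<beta>n by simp
      qed
      finally have cosh: "(\<integral>\<^sup>+X. ennreal (cosh (\<beta> * S X) - 1) \<partial>given_states N k) \<le> ennreal (exp 1 - 1)" .
      have "(\<integral>\<^sup>+X. ennreal \<bar>(\<Sum>i<n. block u v w i X) / n - triple_mean u v w\<bar> \<partial>given_states N k)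
          \<le> (\<integral>\<^sup>+X. ennreal (2 / sqrt n + triple_dev n k) + ennreal (2 / sqrt n) * ennreal (cosh (\<beta> * S X) - 1) \<partial>given_states N k)"
      proof (intro nn_integral_mono)
        fix X
        have "ennreal \<bar>(\<Sum>i<n. block u v w i X) / n - triple_mean u v w\<bar>
          \<le> ennreal ((2 / sqrt n + triple_dev n k) + 2 / sqrt n * (cosh (\<beta> * S X) - 1))"
          by (intro ennreal_leI S_bound)
        also have "\<dots> = ennreal (2 / sqrt n + triple_dev n k) + ennreal (2 / sqrt n) * ennreal (cosh (\<beta> * S X) - 1)"
          using triple_dev_nonneg[of n k] cosh_real_ge_1[of "\<beta> * S X"]
          by (subst ennreal_plus) (auto simp del: times_divide_eq_left intro!: ennreal_mult)
        finally show "ennreal \<bar>(\<Sum>i<n. block u v w i X) / n - triple_mean u v w\<bar>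
          \<le> ennreal (2 / sqrt n + triple_dev n k) + ennreal (2 / sqrt n) * ennreal (cosh (\<beta> * S X) - 1)" .
      qed
      also have "\<dots> = ennreal (2 / sqrt n + triple_dev n k)
          + ennreal (2 / sqrt n) * (\<integral>\<^sup>+X. ennreal (cosh (\<beta> * S X) - 1) \<partial>given_states N k)"
        using Sm cosh_measurable
        by (subst nn_integral_add) (simp_all add: nn_integral_cmult emeasure_space_1)
      also have "\<dots> \<le> ennreal (2 / sqrt n + triple_dev n k) + ennreal (2 / sqrt n) * ennreal (exp 1 - 1)"
        by (intro add_left_mono mult_left_mono cosh) auto
      also have "\<dots> = ennreal (2 * exp 1 / sqrt n + triple_dev n k)"
      proof -
        have "ennreal (2 / sqrt n + triple_dev n k) + ennreal (2 / sqrt n) * ennreal (exp 1 - 1)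
            = ennreal (2 / sqrt n + triple_dev n k) + ennreal (2 / sqrt n * (exp 1 - 1))"
          by (intro arg_cong2[where f = "(+)"] refl ennreal_mult[symmetric]) auto
        also have "\<dots> = ennreal (2 / sqrt n + triple_dev n k + 2 / sqrt n * (exp 1 - 1))"
          using triple_dev_nonneg[of n k] by (intro ennreal_plus[symmetric] add_nonneg_nonneg mult_nonneg_nonneg) auto
        also have "2 / sqrt n + triple_dev n k + 2 / sqrt n * (exp 1 - 1) = 2 * exp 1 / sqrt n + triple_dev n k"
          by (simp add: right_diff_distrib)
        finally show ?thesis .
      qed
      finally show ?thesis .
    qed
    have "(\<integral>\<^sup>+X. ennreal \<bar>(\<Sum>i<n. block u v w i X) / n - triple_mean u v w\<bar> \<partial>hmm_law J Q p f N)
       \<le> ennreal (E N (\<lambda>k. 2 * exp 1 / sqrt n + triple_dev n k))"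
      using per_k triple_dev_nonneg by (intro nn_integral_law_le[OF N1]) auto
    also have "\<dots> \<le> ennreal ((2 * exp 1 + C) / sqrt n)"
      using C(2)[OF n] by (intro ennreal_leI) (simp add: chain_expectation_add E_const[OF N1] add_divide_distrib)
    finally show ?thesis .
  qed
  moreover have "2 * exp 1 + C \<ge> 0" using C(1) by simp
  ultimately show ?thesis by blast
qed

end

text \<open>Reduces a supremum over the line to countably many points, from which the kernel error
  obtains its measurability.\<close>

lemma SUP_ennreal_continuous:
  fixes g :: "real \<Rightarrow> real"
  assumes "continuous_on UNIV g"
  shows "(SUP x. ennreal (g x)) = (SUP x\<in>\<rat>. ennreal (g x))"
proof (rule antisym)
  let ?S = "SUP x\<in>\<rat>. ennreal (g x)"
  show "(SUP x. ennreal (g x)) \<le> ?S"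
  proof (rule SUP_least, rule ccontr)
    fix x assume "\<not> ennreal (g x) \<le> ?S"
    then have x: "x \<in> {y. ?S < ennreal (g y)}" by simp
    have "open {y. ?S < ennreal (g y)}"
      using assms by (intro open_Collect_less continuous_on_const continuous_on_ennreal)
    then obtain e where e: "e > 0" "\<And>y. dist y x < e \<Longrightarrow> ?S < ennreal (g y)"
      using x unfolding open_dist by blast
    obtain q where q: "q \<in> \<rat>" "x < q" "q < x + e" using Rats_dense_in_real[of x "x + e"] e by auto
    then have "?S < ennreal (g q)" by (intro e(2)) (simp add: dist_real_def)
    moreover have "ennreal (g q) \<le> ?S" using q by (intro SUP_upper)
    ultimately show False by simp
  qed
  show "?S \<le> (SUP x. ennreal (g x))" by (rule SUP_subset_mono) auto
qed

context hmm
begin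

lemma after_1: "b < J \<Longrightarrow> after (\<lambda>_. 1) b = 1"
  by (simp add: after_def mean_1 Q_sum)

section \<open>Kernel averages, uniformly over the line\<close>

context
  fixes v :: "real \<Rightarrow> real \<Rightarrow> real" and h R B :: real
  assumes h: "0 < h" and R: "R \<ge> 1" and B: "B \<ge> 0" "\<And>j x. j < J \<Longrightarrow> f j x \<le> B"
    and v_meas: "(\<lambda>(x, y). v x y) \<in> borel_measurable (borel \<Otimes>\<^sub>M borel)"
    and v_bound: "\<And>x y. \<bar>v x y\<bar> \<le> 1"
    and v_supp: "\<And>x y. \<bar>x - y\<bar> > R * h \<Longrightarrow> v x y = 0"
    and v_lip: "\<And>x x' y. \<bar>v x y - v x' y\<bar> \<le> \<bar>x - x'\<bar> / h"
begin

lemma v_measurable: "v x \<in> borel_measurable borel"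
  using measurable_compose[OF measurable_Pair1'[of x borel borel] v_meas] by simp

lemma mean_v_lipschitz:
  assumes j: "j < J"
  shows "\<bar>mean (v x) j - mean (v x') j\<bar> \<le> \<bar>x - x'\<bar> / h"
proof -
  have "mean (v x) j - mean (v x') j = mean (\<lambda>y. v x y - v x' y) j"
    unfolding mean_def left_diff_distrib
    by (intro Bochner_Integration.integral_diff[symmetric] mean_integrable[OF j v_measurable v_bound])
  also have "\<bar>\<dots>\<bar> \<le> \<bar>x - x'\<bar> / h"
    using v_measurable by (intro mean_abs_le[OF j _ v_lip]) simp
  finally show ?thesis .
qed

lemma mean_v_measurable:
  assumes j: "j < J"
  shows "(\<lambda>x. mean (v x) j) \<in> borel_measurable borel"
proof -
  have "(1 / h)-lipschitz_on UNIV (\<lambda>x. mean (v x) j)"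
    using mean_v_lipschitz[OF j] h by (intro lipschitz_onI) (auto simp: dist_real_def)
  then show ?thesis
    by (intro borel_measurable_continuous_onI lipschitz_on_continuous_on)
qed

lemma v_square_le: "(v x y)\<^sup>2 \<le> indicator {x - R * h..x + R * h} y"
proof (cases "\<bar>x - y\<bar> > R * h")
  case True
  then show ?thesis using v_supp[of x y] by simp
next
  case False
  then have "y \<in> {x - R * h..x + R * h}" by auto
  then show ?thesis using v_bound[of x y] by (simp add: abs_square_le_1)
qed

lemma v_abs_le: "\<bar>v x y\<bar> \<le> indicator {x - R * h..x + R * h} y"
proof (cases "\<bar>x - y\<bar> > R * h")
  case True
  then show ?thesis using v_supp[of x y] by simp
next
  case False
  then have "y \<in> {x - R * h..x + R * h}" by auto
  then show ?thesis using v_bound[of x y] by simp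
qed

lemma mean_window_le:
  assumes j: "j < J" and g: "g \<in> borel_measurable borel" "\<And>y. \<bar>g y\<bar> \<le> indicator {x - R * h..x + R * h} y"
  shows "\<bar>mean g j\<bar> \<le> 2 * R * h * B"
proof -
  have g1: "\<bar>g y\<bar> \<le> 1" for y
    using g(2)[of y] by (rule order_trans) (simp add: indicator_def)
  have "\<bar>mean g j\<bar> \<le> (\<integral>y. indicator {x - R * h..x + R * h} y * B \<partial>lborel)"
    unfolding mean_def
  proof (rule integral_abs_bound_integral[OF mean_integrable[OF j g(1) g1]])
    show "integrable lborel (\<lambda>y. indicator {x - R * h..x + R * h} y * B)"
      by (intro integrable_mult_left) (simp add: emeasure_lborel_Icc_eq)
    show "\<bar>g y * f j y\<bar> \<le> indicator {x - R * h..x + R * h} y * B" for y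
      using mult_mono[OF g(2)[of y] B(2)[OF j, of y]] f_nonneg[OF j, of y] by (simp add: abs_mult)
  qed
  also have "\<dots> = 2 * R * h * B"
    using R h by simp
  finally show ?thesis .
qed

lemma mean_square_nonneg: "j < J \<Longrightarrow> 0 \<le> mean (\<lambda>y. (g y)\<^sup>2) j"
  unfolding mean_def using f_nonneg by (intro integral_nonneg_AE) auto

text \<open>Tonelli: for fixed y, the centres x whose window contains y fill an interval of length 2
  R h, and \<open>f j\<close> has integral 1. The total is finite although x runs over the whole
  line.\<close>

lemma mean_v_square_integral:
  assumes j: "j < J"
  shows "(\<integral>\<^sup>+x. ennreal (mean (\<lambda>y. (v x y)\<^sup>2) j) \<partial>lborel) \<le> ennreal (2 * R * h)"
proof -
  have fm[measurable]: "f j \<in> borel_measurable borel" by (rule f_measurable[OF j])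
  have "(\<integral>\<^sup>+x. ennreal (mean (\<lambda>y. (v x y)\<^sup>2) j) \<partial>lborel)
      \<le> (\<integral>\<^sup>+x. \<integral>\<^sup>+y. indicator {(x, y). \<bar>x - y\<bar> \<le> R * h} (x, y) * ennreal (f j y) \<partial>lborel \<partial>lborel)"
  proof (rule nn_integral_mono)
    fix x
    have "ennreal (mean (\<lambda>y. (v x y)\<^sup>2) j) = (\<integral>\<^sup>+y. ennreal ((v x y)\<^sup>2 * f j y) \<partial>lborel)"
      unfolding mean_def
    proof (rule nn_integral_eq_integral[symmetric])
      show "integrable lborel (\<lambda>y. (v x y)\<^sup>2 * f j y)"
        using v_measurable v_bound by (intro mean_integrable[OF j, where c = 1]) (auto simp: abs_square_le_1)
    qed (use f_nonneg[OF j] in auto)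
    also have "\<dots> \<le> (\<integral>\<^sup>+y. indicator {(x, y). \<bar>x - y\<bar> \<le> R * h} (x, y) * ennreal (f j y) \<partial>lborel)"
    proof (rule nn_integral_mono)
      fix y
      show "ennreal ((v x y)\<^sup>2 * f j y) \<le> indicator {(x, y). \<bar>x - y\<bar> \<le> R * h} (x, y) * ennreal (f j y)"
      proof (cases "\<bar>x - y\<bar> \<le> R * h")
        case True
        have "(v x y)\<^sup>2 \<le> 1" using v_bound[of x y] by (simp add: abs_square_le_1)
        then have "(v x y)\<^sup>2 * f j y \<le> 1 * f j y"
          using f_nonneg[OF j, of y] by (intro mult_right_mono) auto
        then show ?thesis using True by (simp add: ennreal_leI)
      next
        case False
        then show ?thesis using v_supp[of x y] by simp
      qed
    qed
    finally show "ennreal (mean (\<lambda>y. (v x y)\<^sup>2) j) \<le> (\<integral>\<^sup>+y. indicator {(x, y). \<bar>x - y\<bar> \<le> R * h} (x, y) * ennreal (f j y) \<partial>lborel)" .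
  qed
  also have "\<dots> = (\<integral>\<^sup>+y. \<integral>\<^sup>+x. indicator {(x, y). \<bar>x - y\<bar> \<le> R * h} (x, y) * ennreal (f j y) \<partial>lborel \<partial>lborel)"
    by (rule lborel_pair.Fubini'[symmetric]) measurable
  also have "\<dots> = (\<integral>\<^sup>+y. ennreal (2 * R * h) * ennreal (f j y) \<partial>lborel)"
  proof (rule nn_integral_cong)
    fix y
    have "(\<integral>\<^sup>+x. indicator {(x, y). \<bar>x - y\<bar> \<le> R * h} (x, y) * ennreal (f j y) \<partial>lborel)
       = (\<integral>\<^sup>+x. ennreal (f j y) * indicator {y - R * h..y + R * h} x \<partial>lborel)"
      by (intro nn_integral_cong) (auto simp: indicator_def)
    also have "\<dots> = ennreal (f j y) * ennreal (2 * R * h)"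
      using R h by (subst nn_integral_cmult_indicator) (auto simp: mult.assoc)
    finally show "(\<integral>\<^sup>+x. indicator {(x, y). \<bar>x - y\<bar> \<le> R * h} (x, y) * ennreal (f j y) \<partial>lborel) = ennreal (2 * R * h) * ennreal (f j y)"
      by (simp add: mult.commute)
  qed
  also have "\<dots> = ennreal (2 * R * h) * (\<integral>\<^sup>+y. ennreal (f j y) \<partial>lborel)"
    by (rule nn_integral_cmult) simp
  also have "(\<integral>\<^sup>+y. ennreal (f j y) \<partial>lborel) = 1"
    using f_integral[OF j] f_integrable[OF j] f_nonneg[OF j]
    by (subst nn_integral_eq_integral) auto
  finally show ?thesis by simp
qed

text \<open>Subtracting 1 from the hyperbolic cosine leaves a conditional mean of at most a constant
  times the sum of the second moments of the kernel at x, and these are integrable in x.\<close>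

lemma kernel_sum_cosh_integral:
  assumes k: "k \<in> PiE {..<N} (\<lambda>_. {..<J})" and n: "n = N div 3" and N: "N \<ge> 1"
    and u[measurable]: "u \<in> borel_measurable borel" and u1: "\<And>y. \<bar>u y\<bar> \<le> 1" and \<beta>: "\<bar>\<beta>\<bar> \<le> 1/2"
  defines "S \<equiv> \<lambda>X x. \<Sum>i<n. block u (v x) (\<lambda>_. 1) i X - block_mean u (v x) (\<lambda>_. 1) k i"
  shows "(\<lambda>X. \<integral>\<^sup>+x. ennreal (cosh (\<beta> * S X x) - 1) \<partial>lborel) \<in> borel_measurable (given_states N k)" (is ?m)
    and "(\<integral>\<^sup>+X. \<integral>\<^sup>+x. ennreal (cosh (\<beta> * S X x) - 1) \<partial>lborel \<partial>given_states N k)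
      \<le> ennreal (\<beta>\<^sup>2 * (n * (2 * R * h)) * exp (\<beta>\<^sup>2 * (n * (2 * R * h * B))))" (is ?i)
proof -
  interpret P: prob_space "given_states N k" by (rule prob_space_given_states)
  interpret pair_sigma_finite "given_states N k" lborel ..
  have kJ: "k (3 * i) < J" "k (3 * i + 1) < J" "k (3 * i + 2) < J" if "i < n" for i
    using k n that by (auto simp: PiE_iff)
  have Sm: "(\<lambda>(X, x). S X x) \<in> borel_measurable (given_states N k \<Otimes>\<^sub>M lborel)"
  proof -
    have "(\<lambda>z. block u (v (snd z)) (\<lambda>_. 1) i (fst z) - block_mean u (v (snd z)) (\<lambda>_. 1) k i)
        \<in> borel_measurable (given_states N k \<Otimes>\<^sub>M lborel)" if i: "i < n" for i
    proof -
      have iN: "3 * i + 2 < N" using i n by auto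
      have [measurable]: "(\<lambda>z. fst z (3 * i)) \<in> borel_measurable (given_states N k \<Otimes>\<^sub>M lborel)"
        "(\<lambda>z. fst z (3 * i + 1)) \<in> borel_measurable (given_states N k \<Otimes>\<^sub>M lborel)"
        using iN by (auto intro!: measurable_compose[OF measurable_fst coordinate_measurable])
      have "(\<lambda>z. (snd z, fst z (3 * i + 1))) \<in> (given_states N k \<Otimes>\<^sub>M lborel) \<rightarrow>\<^sub>M (borel \<Otimes>\<^sub>M borel)"
        by measurable
      from measurable_compose[OF this v_meas]
      have [measurable]: "(\<lambda>z. v (snd z) (fst z (3 * i + 1))) \<in> borel_measurable (given_states N k \<Otimes>\<^sub>M lborel)"
        by simp
      have "(\<lambda>z. mean (v (snd z)) (k (3 * i + 1))) \<in> borel_measurable (given_states N k \<Otimes>\<^sub>M lborel)"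
      proof (rule measurable_compose[OF measurable_snd])
        show "(\<lambda>x. mean (v x) (k (3 * i + 1))) \<in> borel_measurable lborel"
          using mean_v_measurable[OF kJ(2)[OF i]] by simp
      qed
      then show ?thesis
        unfolding block_def block_mean_def by measurable
    qed
    then show ?thesis
      unfolding S_def case_prod_beta by (intro borel_measurable_sum) auto
  qed
  have gm: "(\<lambda>(X, x). ennreal (cosh (\<beta> * S X x) - 1)) \<in> borel_measurable (given_states N k \<Otimes>\<^sub>M lborel)"
    using Sm unfolding case_prod_beta by measurable
  show ?m
    using lborel.borel_measurable_nn_integral[OF gm] by simp
  have inner: "(\<integral>\<^sup>+X. ennreal (cosh (\<beta> * S X x) - 1) \<partial>given_states N k)
      \<le> ennreal (\<beta>\<^sup>2 * exp (\<beta>\<^sup>2 * (n * (2 * R * h * B)))) * (\<Sum>i<n. ennreal (mean (\<lambda>y. (v x y)\<^sup>2) (k (3 * i + 1))))" for x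
  proof -
    let ?q = "\<Sum>i<n. mean (\<lambda>y. (v x y)\<^sup>2) (k (3 * i + 1))"
    have q0: "?q \<ge> 0" using kJ by (intro sum_nonneg mean_square_nonneg) auto
    have "?q \<le> (\<Sum>i<n. 2 * R * h * B)"
    proof (intro sum_mono)
      fix i assume "i \<in> {..<n}"
      then have "\<bar>mean (\<lambda>y. (v x y)\<^sup>2) (k (3 * i + 1))\<bar> \<le> 2 * R * h * B"
        using v_measurable v_square_le[of x] kJ by (intro mean_window_le[where x = x]) auto
      then show "mean (\<lambda>y. (v x y)\<^sup>2) (k (3 * i + 1)) \<le> 2 * R * h * B" by linarith
    qed
    then have q1: "?q \<le> n * (2 * R * h * B)" by simp
    have "(\<integral>\<^sup>+X. ennreal (cosh (\<beta> * S X x) - 1) \<partial>given_states N k) \<le> ennreal (exp (\<beta>\<^sup>2 * ?q) - 1)"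
      unfolding S_def using u1 v_bound v_measurable
      by (intro block_cosh_moment[OF k n N u _ _ _ _ _ \<beta>]) auto
    also have "\<dots> \<le> ennreal (\<beta>\<^sup>2 * exp (\<beta>\<^sup>2 * (n * (2 * R * h * B))) * ?q)"
    proof (rule ennreal_leI)
      \<comment> \<open>exp t - 1 is at most t exp t: the factor t keeps the dependence on x that is
        integrated afterwards, while the exponential is bounded uniformly in x.\<close>
      let ?t = "\<beta>\<^sup>2 * ?q"
      have "1 - ?t \<le> exp (- ?t)" using exp_ge_add_one_self[of "- ?t"] by simp
      then have "exp ?t * (1 - ?t) \<le> exp ?t * exp (- ?t)" by (intro mult_left_mono) auto
      then have "exp ?t - 1 \<le> ?t * exp ?t" by (simp add: exp_minus algebra_simps)
      also have "\<dots> \<le> ?t * exp (\<beta>\<^sup>2 * (n * (2 * R * h * B)))"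
        using q0 q1 by (intro mult_left_mono) (auto intro!: mult_left_mono)
      finally show "exp ?t - 1 \<le> \<beta>\<^sup>2 * exp (\<beta>\<^sup>2 * (n * (2 * R * h * B))) * ?q"
        by (simp add: algebra_simps)
    qed
    also have "\<dots> = ennreal (\<beta>\<^sup>2 * exp (\<beta>\<^sup>2 * (n * (2 * R * h * B)))) * ennreal ?q"
      using q0 by (intro ennreal_mult) auto
    also have "ennreal ?q = (\<Sum>i<n. ennreal (mean (\<lambda>y. (v x y)\<^sup>2) (k (3 * i + 1))))"
      using kJ by (intro sum_ennreal[symmetric] mean_square_nonneg) auto
    finally show ?thesis .
  qed
  have mqm: "(\<lambda>x. ennreal (mean (\<lambda>y. (v x y)\<^sup>2) j)) \<in> borel_measurable lborel" if "j < J" for j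
  proof -
    note v_meas[measurable] f_measurable[OF that, measurable]
    have [measurable]: "(\<lambda>z. v (fst z) (snd z)) \<in> borel_measurable (borel \<Otimes>\<^sub>M borel)"
      using v_meas by (simp add: case_prod_beta')
    have "(\<lambda>x. mean (\<lambda>y. (v x y)\<^sup>2) j) \<in> borel_measurable lborel"
      unfolding mean_def
      by (rule lborel.borel_measurable_lebesgue_integral) (simp add: case_prod_beta')
    then show ?thesis by measurable
  qed
  have "(\<integral>\<^sup>+X. \<integral>\<^sup>+x. ennreal (cosh (\<beta> * S X x) - 1) \<partial>lborel \<partial>given_states N k)
      = (\<integral>\<^sup>+x. \<integral>\<^sup>+X. ennreal (cosh (\<beta> * S X x) - 1) \<partial>given_states N k \<partial>lborel)"
    by (rule Fubini'[symmetric, OF gm])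
  also have "\<dots> \<le> (\<integral>\<^sup>+x. ennreal (\<beta>\<^sup>2 * exp (\<beta>\<^sup>2 * (n * (2 * R * h * B)))) * (\<Sum>i<n. ennreal (mean (\<lambda>y. (v x y)\<^sup>2) (k (3 * i + 1)))) \<partial>lborel)"
    by (intro nn_integral_mono inner)
  also have "\<dots> = ennreal (\<beta>\<^sup>2 * exp (\<beta>\<^sup>2 * (n * (2 * R * h * B)))) *
      (\<Sum>i<n. \<integral>\<^sup>+x. ennreal (mean (\<lambda>y. (v x y)\<^sup>2) (k (3 * i + 1))) \<partial>lborel)"
  proof (subst nn_integral_cmult)
    show "(\<lambda>x. \<Sum>i<n. ennreal (mean (\<lambda>y. (v x y)\<^sup>2) (k (3 * i + 1)))) \<in> borel_measurable lborel"
      using kJ by (intro borel_measurable_sum mqm) auto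
    show "ennreal (\<beta>\<^sup>2 * exp (\<beta>\<^sup>2 * (n * (2 * R * h * B)))) * (\<integral>\<^sup>+x. (\<Sum>i<n. ennreal (mean (\<lambda>y. (v x y)\<^sup>2) (k (3 * i + 1)))) \<partial>lborel)
      = ennreal (\<beta>\<^sup>2 * exp (\<beta>\<^sup>2 * (n * (2 * R * h * B)))) *
      (\<Sum>i<n. \<integral>\<^sup>+x. ennreal (mean (\<lambda>y. (v x y)\<^sup>2) (k (3 * i + 1))) \<partial>lborel)"
      using kJ by (intro arg_cong2[where f = "(*)"] refl nn_integral_sum mqm) auto
  qed
  also have "\<dots> \<le> ennreal (\<beta>\<^sup>2 * exp (\<beta>\<^sup>2 * (n * (2 * R * h * B)))) * (\<Sum>i<n. ennreal (2 * R * h))"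
    using kJ by (intro mult_left_mono sum_mono mean_v_square_integral) auto
  also have "(\<Sum>i<n. ennreal (2 * R * h)) = ennreal (n * (2 * R * h))"
    using R h by (subst sum_ennreal) auto
  also have "ennreal (\<beta>\<^sup>2 * exp (\<beta>\<^sup>2 * (n * (2 * R * h * B)))) * ennreal (n * (2 * R * h))
     = ennreal (\<beta>\<^sup>2 * exp (\<beta>\<^sup>2 * (n * (2 * R * h * B))) * (n * (2 * R * h)))"
    using R h by (intro ennreal_mult[symmetric]) auto
  also have "\<beta>\<^sup>2 * exp (\<beta>\<^sup>2 * (n * (2 * R * h * B))) * (n * (2 * R * h)) = \<beta>\<^sup>2 * (n * (2 * R * h)) * exp (\<beta>\<^sup>2 * (n * (2 * R * h * B)))"
    by (simp only: mult.commute mult.left_commute mult.assoc)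
  finally show ?i .
qed

text \<open>Two contributions: the fluctuation given the states, paid by the cosh integral, and the
  frequency error, where a window of length 2 R h under a density of at most B cancels the factor
  1/h.\<close>

lemma kernel_sup_given_states:
  assumes k: "k \<in> PiE {..<N} (\<lambda>_. {..<J})" and n: "n = N div 3" "n \<ge> 1"
    and u: "u \<in> borel_measurable borel" "\<And>y. \<bar>u y\<bar> \<le> 1"
    and \<beta>: "0 < \<beta>" "\<beta> \<le> 1/2" and a: "a \<ge> 0"
  shows "(\<integral>\<^sup>+X. (SUP x. ennreal (R / h * \<bar>(\<Sum>i<n. block u (v x) (\<lambda>_. 1) i X) / n - triple_mean u (v x) (\<lambda>_. 1)\<bar>)) \<partial>given_states N k)
    \<le> ennreal (R / (n * h) * (1 + (a + 2 * exp (- a)) / \<beta> + 2 * exp (- a) / (\<beta> * (h / (2 * real n))) *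
         (\<beta>\<^sup>2 * (n * (2 * R * h)) * exp (\<beta>\<^sup>2 * (n * (2 * R * h * B))))) + 2 * R\<^sup>2 * B * triple_dev n k)"
proof -
  interpret P: prob_space "given_states N k" by (rule prob_space_given_states)
  have N: "N \<ge> 1" using n by (cases N) auto
  have \<beta>': "\<bar>\<beta>\<bar> \<le> 1/2" using \<beta> by simp
  define S where "S = (\<lambda>X x. \<Sum>i<n. block u (v x) (\<lambda>_. 1) i X - block_mean u (v x) (\<lambda>_. 1) k i)"
  have cosh: "(\<lambda>X. \<integral>\<^sup>+x. ennreal (cosh (\<beta> * S X x) - 1) \<partial>lborel) \<in> borel_measurable (given_states N k)"
    "(\<integral>\<^sup>+X. \<integral>\<^sup>+x. ennreal (cosh (\<beta> * S X x) - 1) \<partial>lborel \<partial>given_states N k)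
      \<le> ennreal (\<beta>\<^sup>2 * (n * (2 * R * h)) * exp (\<beta>\<^sup>2 * (n * (2 * R * h * B))))"
    unfolding S_def by (rule kernel_sum_cosh_integral[OF k n(1) N u \<beta>'])+
  define \<Psi> where "\<Psi> X = (\<integral>\<^sup>+x. ennreal (cosh (\<beta> * S X x) - 1) \<partial>lborel)" for X
  \<comment> \<open>Each block and each conditional mean is Lipschitz in x with constant 1/h, so the
    n differences together have the constant 2 n / h.\<close>
  define \<Delta> where "\<Delta> = h / (2 * n)"
  have \<Delta>: "\<Delta> > 0" using h n by (simp add: \<Delta>_def)
  have kJ: "k (3 * i) < J" "k (3 * i + 1) < J" "k (3 * i + 2) < J" if "i < n" for i
    using k n that by (auto simp: PiE_iff)
  have lip: "\<bar>S X x - S X x'\<bar> \<le> \<bar>x - x'\<bar> / \<Delta>" for X x x'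
  proof -
    have "\<bar>S X x - S X x'\<bar> \<le> (\<Sum>i<n. 2 * (\<bar>x - x'\<bar> / h))"
      unfolding S_def sum_subtractf[symmetric]
    proof (rule order_trans[OF sum_abs], rule sum_mono)
      fix i assume "i \<in> {..<n}"
      then have i: "i < n" by simp
      have "\<bar>block u (v x) (\<lambda>_. 1) i X - block u (v x') (\<lambda>_. 1) i X\<bar> = \<bar>u (X (3 * i))\<bar> * \<bar>v x (X (3 * i + 1)) - v x' (X (3 * i + 1))\<bar>"
        by (simp add: block_def right_diff_distrib[symmetric] abs_mult)
      also have "\<dots> \<le> 1 * (\<bar>x - x'\<bar> / h)"
        by (intro mult_mono u v_lip) auto
      finally have 1: "\<bar>block u (v x) (\<lambda>_. 1) i X - block u (v x') (\<lambda>_. 1) i X\<bar> \<le> \<bar>x - x'\<bar> / h" by simp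
      have "\<bar>block_mean u (v x) (\<lambda>_. 1) k i - block_mean u (v x') (\<lambda>_. 1) k i\<bar>
          = \<bar>mean u (k (3 * i))\<bar> * \<bar>mean (v x) (k (3 * i + 1)) - mean (v x') (k (3 * i + 1))\<bar>"
        using kJ[OF i] by (simp add: block_mean_def mean_1 right_diff_distrib[symmetric] abs_mult)
      also have "\<dots> \<le> 1 * (\<bar>x - x'\<bar> / h)"
        using kJ[OF i] u by (intro mult_mono mean_abs_le mean_v_lipschitz) auto
      finally have 2: "\<bar>block_mean u (v x) (\<lambda>_. 1) k i - block_mean u (v x') (\<lambda>_. 1) k i\<bar> \<le> \<bar>x - x'\<bar> / h" by simp
      show "\<bar>block u (v x) (\<lambda>_. 1) i X - block_mean u (v x) (\<lambda>_. 1) k i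
          - (block u (v x') (\<lambda>_. 1) i X - block_mean u (v x') (\<lambda>_. 1) k i)\<bar> \<le> 2 * (\<bar>x - x'\<bar> / h)"
        using 1 2 by linarith
    qed
    also have "\<dots> = \<bar>x - x'\<bar> / \<Delta>" using h n by (simp add: \<Delta>_def field_simps)
    finally show ?thesis .
  qed
  let ?A = "1 + (a + 2 * exp (- a)) / \<beta>" and ?B = "2 * exp (- a) / (\<beta> * \<Delta>)"
  let ?G = "\<beta>\<^sup>2 * (n * (2 * R * h)) * exp (\<beta>\<^sup>2 * (n * (2 * R * h * B)))"
  have A0: "?A \<ge> 0" using a \<beta> by (intro add_nonneg_nonneg divide_nonneg_nonneg) auto
  have B0: "?B \<ge> 0" using \<Delta> \<beta> by auto
  have G0: "?G \<ge> 0" using R h by auto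
  have dev0: "2 * R\<^sup>2 * B * triple_dev n k \<ge> 0" using B triple_dev_nonneg by auto
  have bound: "(SUP x. ennreal (R / h * \<bar>(\<Sum>i<n. block u (v x) (\<lambda>_. 1) i X) / n - triple_mean u (v x) (\<lambda>_. 1)\<bar>))
      \<le> ennreal (R / (n * h)) * (ennreal ?A + ennreal ?B * \<Psi> X) + ennreal (2 * R\<^sup>2 * B * triple_dev n k)" for X
  proof (rule SUP_least)
    fix x
    have 1: "\<bar>(\<Sum>i<n. block_mean u (v x) (\<lambda>_. 1) k i) / n - triple_mean u (v x) (\<lambda>_. 1)\<bar> \<le> (2 * R * h * B) * triple_dev n k"
      using v_measurable v_abs_le u
      by (intro block_mean_deviation[OF k n(1)] mean_window_le[where x = x]) auto
    have "(\<Sum>i<n. block u (v x) (\<lambda>_. 1) i X) / n = S X x / n + (\<Sum>i<n. block_mean u (v x) (\<lambda>_. 1) k i) / n"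
      by (simp add: S_def sum_subtractf diff_divide_distrib)
    then have "\<bar>(\<Sum>i<n. block u (v x) (\<lambda>_. 1) i X) / n - triple_mean u (v x) (\<lambda>_. 1)\<bar> \<le> \<bar>S X x / n\<bar> + (2 * R * h * B) * triple_dev n k"
      using 1 by linarith
    then have "R / h * \<bar>(\<Sum>i<n. block u (v x) (\<lambda>_. 1) i X) / n - triple_mean u (v x) (\<lambda>_. 1)\<bar>
        \<le> R / h * (\<bar>S X x / n\<bar> + (2 * R * h * B) * triple_dev n k)"
      using R h by (intro mult_left_mono) auto
    also have "\<dots> = R / (n * h) * \<bar>S X x\<bar> + 2 * R\<^sup>2 * B * triple_dev n k"
      using h n by (simp add: field_simps power2_eq_square abs_divide)
    finally have "ennreal (R / h * \<bar>(\<Sum>i<n. block u (v x) (\<lambda>_. 1) i X) / n - triple_mean u (v x) (\<lambda>_. 1)\<bar>)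
        \<le> ennreal (R / (n * h) * \<bar>S X x\<bar> + 2 * R\<^sup>2 * B * triple_dev n k)"
      by (rule ennreal_leI)
    also have "\<dots> = ennreal (R / (n * h) * \<bar>S X x\<bar>) + ennreal (2 * R\<^sup>2 * B * triple_dev n k)"
      using R h dev0 by (intro ennreal_plus) auto
    also have "ennreal (R / (n * h) * \<bar>S X x\<bar>) = ennreal (R / (n * h)) * ennreal \<bar>S X x\<bar>"
      using R h by (intro ennreal_mult) auto
    also have "ennreal (R / (n * h)) * ennreal \<bar>S X x\<bar> + ennreal (2 * R\<^sup>2 * B * triple_dev n k)
        \<le> ennreal (R / (n * h)) * (ennreal ?A + ennreal ?B * \<Psi> X) + ennreal (2 * R\<^sup>2 * B * triple_dev n k)"
      unfolding \<Psi>_def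
      by (intro add_right_mono mult_left_mono sup_le_cosh_integral[OF lip \<Delta> \<beta>(1) a]) auto
    finally show "ennreal (R / h * \<bar>(\<Sum>i<n. block u (v x) (\<lambda>_. 1) i X) / n - triple_mean u (v x) (\<lambda>_. 1)\<bar>)
       \<le> ennreal (R / (n * h)) * (ennreal ?A + ennreal ?B * \<Psi> X) + ennreal (2 * R\<^sup>2 * B * triple_dev n k)" .
  qed
  have \<Psi>m[measurable]: "\<Psi> \<in> borel_measurable (given_states N k)"
    unfolding \<Psi>_def[abs_def] by (rule cosh(1))
  have "(\<integral>\<^sup>+X. (SUP x. ennreal (R / h * \<bar>(\<Sum>i<n. block u (v x) (\<lambda>_. 1) i X) / n - triple_mean u (v x) (\<lambda>_. 1)\<bar>)) \<partial>given_states N k)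
     \<le> (\<integral>\<^sup>+X. ennreal (R / (n * h)) * (ennreal ?A + ennreal ?B * \<Psi> X) + ennreal (2 * R\<^sup>2 * B * triple_dev n k) \<partial>given_states N k)"
    by (intro nn_integral_mono bound)
  also have "\<dots> = ennreal (R / (n * h)) * (ennreal ?A + ennreal ?B * (\<integral>\<^sup>+X. \<Psi> X \<partial>given_states N k)) + ennreal (2 * R\<^sup>2 * B * triple_dev n k)"
    by (simp add: nn_integral_add nn_integral_cmult P.emeasure_space_1)
  also have "\<dots> \<le> ennreal (R / (n * h)) * (ennreal ?A + ennreal ?B * ennreal ?G) + ennreal (2 * R\<^sup>2 * B * triple_dev n k)"
    unfolding \<Psi>_def by (intro add_right_mono mult_left_mono add_left_mono cosh(2)) auto
  also have "\<dots> = ennreal (R / (n * h) * (?A + ?B * ?G) + 2 * R\<^sup>2 * B * triple_dev n k)"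
  proof -
    have RN: "R / (n * h) \<ge> 0" using R h by simp
    have ABG: "?A + ?B * ?G \<ge> 0" by (rule add_nonneg_nonneg[OF A0 mult_nonneg_nonneg[OF B0 G0]])
    have "ennreal ?A + ennreal ?B * ennreal ?G = ennreal (?A + ?B * ?G)"
      unfolding ennreal_mult[OF B0 G0, symmetric]
      by (rule ennreal_plus[symmetric, OF A0 mult_nonneg_nonneg[OF B0 G0]])
    moreover have "ennreal (R / (n * h)) * ennreal (?A + ?B * ?G) = ennreal (R / (n * h) * (?A + ?B * ?G))"
      by (rule ennreal_mult[symmetric, OF RN ABG])
    moreover have "ennreal (R / (n * h) * (?A + ?B * ?G)) + ennreal (2 * R\<^sup>2 * B * triple_dev n k)
       = ennreal (R / (n * h) * (?A + ?B * ?G) + 2 * R\<^sup>2 * B * triple_dev n k)"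
      by (rule ennreal_plus[symmetric, OF mult_nonneg_nonneg[OF RN ABG] dev0])
    ultimately show ?thesis by (simp only:)
  qed
  finally show ?thesis unfolding \<Delta>_def by (simp only: add.assoc of_nat_mult of_nat_numeral)
qed

lemma kernel_sup_measurable:
  assumes n: "n = N div 3" and u: "u \<in> borel_measurable borel"
  shows "(\<lambda>X. SUP x. ennreal (R / h * \<bar>(\<Sum>i<n. block u (v x) (\<lambda>_. 1) i X) / n - triple_mean u (v x) (\<lambda>_. 1)\<bar>))
    \<in> borel_measurable (hmm_law J Q p f N)"
proof -
  have lip: "continuous_on UNIV F" if "\<And>x x'. \<bar>F x - F x'\<bar> \<le> \<bar>x - x'\<bar> / h" for F :: "real \<Rightarrow> real"
  proof -
    have "(1 / h)-lipschitz_on UNIV F"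
      using that h by (intro lipschitz_onI) (auto simp: dist_real_def)
    then show ?thesis by (rule lipschitz_on_continuous_on)
  qed
  have "continuous_on UNIV (\<lambda>x. R / h * \<bar>(\<Sum>i<n. block u (v x) (\<lambda>_. 1) i X) / n - triple_mean u (v x) (\<lambda>_. 1)\<bar>)" for X
    unfolding block_def triple_mean_def divide_inverse
    by (intro continuous_intros lip v_lip mean_v_lipschitz) auto
  note SUP_ennreal_continuous[OF this]
  moreover have "(\<lambda>X. SUP x\<in>\<rat>. ennreal (R / h * \<bar>(\<Sum>i<n. block u (v x) (\<lambda>_. 1) i X) / n - triple_mean u (v x) (\<lambda>_. 1)\<bar>))
    \<in> borel_measurable (PiM {..<N} (\<lambda>_. lborel))"
  proof (rule borel_measurable_SUP[OF countable_rat])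
    fix x
    have "(\<lambda>X. \<Sum>i<n. block u (v x) (\<lambda>_. 1) i X) \<in> borel_measurable (PiM {..<N} (\<lambda>_. lborel))"
      using n u v_measurable by (intro borel_measurable_sum block_measurable_PiM) auto
    then show "(\<lambda>X. ennreal (R / h * \<bar>(\<Sum>i<n. block u (v x) (\<lambda>_. 1) i X) / n - triple_mean u (v x) (\<lambda>_. 1)\<bar>))
      \<in> borel_measurable (PiM {..<N} (\<lambda>_. lborel))" by measurable
  qed
  ultimately show ?thesis by (simp add: hmm_law_def)
qed

lemma kernel_sup_deviation:
  assumes C: "C \<ge> 0" "\<And>N n. n = N div 3 \<Longrightarrow> n \<ge> 1 \<Longrightarrow> E N (triple_dev n) \<le> C / sqrt n"
    and n: "n = N div 3" "n \<ge> 1" and h1: "h \<le> 1"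
    and ln: "ln N \<ge> 1" "4 * ln N \<le> n * h"
    and u: "u \<in> borel_measurable borel" "\<And>y. \<bar>u y\<bar> \<le> 1"
  shows "(\<integral>\<^sup>+X. (SUP x. ennreal (R / h * \<bar>(\<Sum>i<n. block u (v x) (\<lambda>_. 1) i X) / n - triple_mean u (v x) (\<lambda>_. 1)\<bar>)) \<partial>hmm_law J Q p f N)
    \<le> ennreal ((R * (5 + 2 * R * B + 8 * R) + 2 * R\<^sup>2 * B * C) * sqrt (ln N / (n * h)))"
proof -
  have N: "N \<ge> 1" using n by (cases N) auto
  define l where "l = ln (real N)"
  have l: "l \<ge> 1" "4 * l \<le> n * h" using ln by (auto simp: l_def)
  have nh: "n * h > 0" using n h by simp
  \<comment> \<open>The order of the error to be proved serves as exponential parameter;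
    \<open>4 * ln N \<le> n * h\<close> says that it is at most 1/2.\<close>
  define \<beta> where "\<beta> = sqrt (l / (n * h))"
  have \<beta>2: "\<beta>\<^sup>2 = l / (n * h)" using l nh by (simp add: \<beta>_def)
  have \<beta>0: "\<beta> > 0" using l nh by (simp add: \<beta>_def)
  have "l / (n * h) \<le> 1 / 4" using l nh by (simp add: divide_le_eq)
  then have "\<beta>\<^sup>2 \<le> (1/2)\<^sup>2" unfolding \<beta>2 by (simp add: power2_eq_square)
  then have \<beta>h: "\<beta> \<le> 1/2" using power2_le_imp_le[of \<beta> "1/2"] by simp
  \<comment> \<open>The part \<open>2 * R * B * l\<close> cancels the exponential moment; the
    remaining exp (-2 l) = N^(-2) absorbs n^2, where one n comes from the number of blocks and one
    from 1/\<Delta>.\<close>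
  define a where "a = (2 + 2 * R * B) * l"
  have a0: "a \<ge> 0" using R B l by (simp add: a_def)
  define K where "K = R / (n * h) * (1 + (a + 2 * exp (- a)) / \<beta> + 2 * exp (- a) / (\<beta> * (h / (2 * real n))) *
         (\<beta>\<^sup>2 * (n * (2 * R * h)) * exp (\<beta>\<^sup>2 * (n * (2 * R * h * B)))))"
  have K0: "K \<ge> 0"
    unfolding K_def using R h a0 \<beta>0 by (intro mult_nonneg_nonneg add_nonneg_nonneg divide_nonneg_nonneg) auto
  have KB: "K \<le> R * (5 + 2 * R * B + 8 * R) * \<beta>"
  proof -
    have e1: "\<beta>\<^sup>2 * (n * (2 * R * h * B)) = 2 * R * B * l"
      using nh h n by (simp add: \<beta>2 field_simps)
    have e2: "exp (- a) * exp (2 * R * B * l) = exp (- 2 * l)"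
      by (simp add: a_def exp_add[symmetric] algebra_simps)
    have N2: "exp (- 2 * l) * (n * n) \<le> 1"
    proof -
      have "exp (2 * l) = real N * real N"
        using N exp_add[of l l] by (simp add: l_def)
      moreover have "real n * real n \<le> real N * real N" using n by (intro mult_mono) auto
      moreover have "real N * real N > 0" using N by simp
      ultimately show ?thesis by (simp add: exp_minus field_simps)
    qed
    have "2 * exp (- a) / (\<beta> * (h / (2 * real n))) * (\<beta>\<^sup>2 * (n * (2 * R * h)) * exp (\<beta>\<^sup>2 * (n * (2 * R * h * B))))
       = (8 * R * \<beta>\<^sup>2) * ((exp (- a) * exp (2 * R * B * l)) * (n * n)) / \<beta>"
      unfolding e1 using h n \<beta>0 by (simp add: field_simps)
    also have "\<dots> \<le> (8 * R * 1) * 1 / \<beta>"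
      unfolding e2
    proof (intro divide_right_mono mult_mono N2)
      have "\<beta>\<^sup>2 \<le> 1\<^sup>2" using \<beta>0 \<beta>h by (intro power_mono) auto
      then show "\<beta>\<^sup>2 \<le> 1" by simp
    qed (use R \<beta>0 in auto)
    finally have 1: "2 * exp (- a) / (\<beta> * (h / (2 * real n))) * (\<beta>\<^sup>2 * (n * (2 * R * h)) * exp (\<beta>\<^sup>2 * (n * (2 * R * h * B)))) \<le> 8 * R * l / \<beta>"
    proof (rule order_trans)
      show "8 * R * 1 * 1 / \<beta> \<le> 8 * R * l / \<beta>"
        using R l \<beta>0 by (intro divide_right_mono) auto
    qed
    have 2: "1 \<le> l / \<beta>" using l \<beta>0 \<beta>h by (simp add: le_divide_eq)
    have "exp (- a) \<le> 1" using a0 by simp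
    then have "a + 2 * exp (- a) \<le> a + 2 * l" using l by linarith
    also have "\<dots> = (4 + 2 * R * B) * l"
      by (simp add: a_def algebra_simps)
    finally have "a + 2 * exp (- a) \<le> (4 + 2 * R * B) * l" .
    then have 3: "(a + 2 * exp (- a)) / \<beta> \<le> (4 + 2 * R * B) * l / \<beta>"
      using \<beta>0 by (intro divide_right_mono) auto
    \<comment> \<open>Each term is a multiple of l/\<beta>, and l / (n h) = \<beta>^2 turns the
      total into a multiple of \<beta>.\<close>
    have "K \<le> R / (n * h) * (l / \<beta> + (4 + 2 * R * B) * l / \<beta> + 8 * R * l / \<beta>)"
      unfolding K_def using R nh by (intro mult_left_mono add_mono 1 2 3) auto
    also have "\<dots> = R * (5 + 2 * R * B + 8 * R) * ((l / (n * h)) / \<beta>)"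
      by (simp add: add_divide_distrib[symmetric] algebra_simps)
    also have "(l / (n * h)) / \<beta> = \<beta>"
      using \<beta>0 by (simp add: \<beta>2[symmetric] power2_eq_square)
    finally show ?thesis .
  qed
  have sn: "1 / sqrt n \<le> \<beta>"
  proof -
    have "1 / n \<le> l / (n * h)"
      using n h h1 l by (simp add: field_simps)
    then have "sqrt (1 / n) \<le> sqrt (l / (n * h))" by (rule real_sqrt_le_mono)
    then show ?thesis by (simp add: \<beta>_def real_sqrt_divide)
  qed
  have D0: "2 * R\<^sup>2 * B \<ge> 0" using B by simp
  have "(\<integral>\<^sup>+X. (SUP x. ennreal (R / h * \<bar>(\<Sum>i<n. block u (v x) (\<lambda>_. 1) i X) / n - triple_mean u (v x) (\<lambda>_. 1)\<bar>)) \<partial>hmm_law J Q p f N)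
    \<le> ennreal (E N (\<lambda>k. K + 2 * R\<^sup>2 * B * triple_dev n k))"
  proof (rule nn_integral_law_le[OF N])
    show "0 \<le> K + 2 * R\<^sup>2 * B * triple_dev n k" for k
      by (rule add_nonneg_nonneg[OF K0 mult_nonneg_nonneg[OF D0 triple_dev_nonneg]])
    show "(\<integral>\<^sup>+X. (SUP x. ennreal (R / h * \<bar>(\<Sum>i<n. block u (v x) (\<lambda>_. 1) i X) / n - triple_mean u (v x) (\<lambda>_. 1)\<bar>)) \<partial>given_states N k)
      \<le> ennreal (K + 2 * R\<^sup>2 * B * triple_dev n k)" if "k \<in> PiE {..<N} (\<lambda>_. {..<J})" for k
      using kernel_sup_given_states[OF that n u \<beta>0 \<beta>h a0] unfolding K_def .
  qed
  also have "E N (\<lambda>k. K + 2 * R\<^sup>2 * B * triple_dev n k) = K + 2 * R\<^sup>2 * B * E N (triple_dev n)"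
    by (simp only: chain_expectation_add chain_expectation_cmult E_const[OF N])
  also have "ennreal \<dots> \<le> ennreal ((R * (5 + 2 * R * B + 8 * R) + 2 * R\<^sup>2 * B * C) * \<beta>)"
  proof (rule ennreal_leI)
    have "E N (triple_dev n) \<le> C * (1 / sqrt n)" using C(2)[OF n] by simp
    also have "\<dots> \<le> C * \<beta>" using C(1) sn by (intro mult_left_mono) auto
    finally have "2 * R\<^sup>2 * B * E N (triple_dev n) \<le> 2 * R\<^sup>2 * B * (C * \<beta>)"
      using D0 by (intro mult_left_mono) auto
    with KB show "K + 2 * R\<^sup>2 * B * E N (triple_dev n) \<le> (R * (5 + 2 * R * B + 8 * R) + 2 * R\<^sup>2 * B * C) * \<beta>"
      by (simp add: algebra_simps)
  qed
  finally show ?thesis unfolding \<beta>_def l_def .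
qed

end

end

subsection \<open>Identification and stability\<close>

lemma strict_mono_lessThan_id:
  fixes g :: "nat \<Rightarrow> nat"
  assumes "\<And>i. i < J \<Longrightarrow> g i < J" "\<And>i j. i < j \<Longrightarrow> j < J \<Longrightarrow> g i < g j" "i < J"
  shows "g i = i"
proof -
  have lower: "i \<le> g i" if "i < J" for i
    using that
  proof (induction i)
    case (Suc i)
    then show ?case using assms(2)[of i "Suc i"] by simp
  qed simp
  have upper: "i + d < J \<Longrightarrow> g i + d \<le> g (i + d)" for i d
  proof (induction d)
    case (Suc d)
    then show ?case using assms(2)[of "i + d" "i + Suc d"] by simp
  qed simp
  have "g i + (J - 1 - i) \<le> g (J - 1)" using upper[of i "J - 1 - i"] assms(3) by simp
  moreover have "g (J - 1) < J" using assms(1,3) by simp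
  ultimately show ?thesis using lower[OF assms(3)] assms(3) by linarith
qed

text \<open>\<tau> inverts the rank function. The uniqueness clause is the point: any choice g of
  states that respects the order equals \<tau>, so an estimated labelling is pinned down by its
  order alone, and g need not be known to be injective beforehand.\<close>

lemma finite_strict_order_enumeration:
  fixes less :: "nat \<Rightarrow> nat \<Rightarrow> bool"
  assumes irrefl: "\<And>a. \<not> less a a" and trans: "\<And>a b c. less a b \<Longrightarrow> less b c \<Longrightarrow> less a c"
    and total: "\<And>a b. a < J \<Longrightarrow> b < J \<Longrightarrow> a \<noteq> b \<Longrightarrow> less a b \<or> less b a"
  shows "\<exists>\<tau>. bij_betw \<tau> {..<J} {..<J} \<and>
    (\<forall>g. (\<forall>i<J. g i < J) \<longrightarrow> (\<forall>i j. i < j \<longrightarrow> j < J \<longrightarrow> less (g i) (g j)) \<longrightarrow> (\<forall>i<J. g i = \<tau> i)) \<and>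
    (\<forall>i j. i < j \<longrightarrow> j < J \<longrightarrow> less (\<tau> i) (\<tau> j))"
proof -
  define r where "r b = card {a. a < J \<and> less a b}" for b
  have r_mono: "r a < r b" if "a < J" "less a b" for a b
  proof -
    have "{c. c < J \<and> less c a} \<subset> {c. c < J \<and> less c b}"
      using that irrefl trans by blast
    then show ?thesis unfolding r_def by (intro psubset_card_mono) auto
  qed
  have r_less: "r b < J" if "b < J" for b
  proof -
    have "{a. a < J \<and> less a b} \<subset> {..<J}" using that irrefl by auto
    from psubset_card_mono[OF _ this] show ?thesis by (simp add: r_def)
  qed
  have r_inj: "inj_on r {..<J}"
    using total r_mono by (intro inj_onI) (metis lessThan_iff less_irrefl)
  have bij: "bij_betw r {..<J} {..<J}"
    using r_inj r_less by (intro bij_betw_imageI endo_inj_surj) auto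
  define \<tau> where "\<tau> = inv_into {..<J} r"
  have bij\<tau>: "bij_betw \<tau> {..<J} {..<J}" unfolding \<tau>_def by (rule bij_betw_inv_into[OF bij])
  have \<tau>J: "\<tau> i < J" if "i < J" for i using bij\<tau> that by (auto simp: bij_betw_def)
  have r\<tau>: "r (\<tau> i) = i" if "i < J" for i
    unfolding \<tau>_def using bij that by (intro bij_betw_inv_into_right) auto
  have "g i = \<tau> i" if g: "\<forall>i<J. g i < J" "\<forall>i j. i < j \<longrightarrow> j < J \<longrightarrow> less (g i) (g j)" and i: "i < J" for g i
  proof -
    have "r (g i) = i"
      by (rule strict_mono_lessThan_id[of J "\<lambda>i. r (g i)"]) (use g i r_less r_mono in auto)
    with r\<tau>[OF i] have "r (g i) = r (\<tau> i)" by simp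
    then show ?thesis using r_inj g i \<tau>J by (auto dest: inj_onD)
  qed
  moreover have "less (\<tau> i) (\<tau> j)" if "i < j" "j < J" for i j
  proof -
    have "\<tau> i \<noteq> \<tau> j" using r\<tau>[of i] r\<tau>[of j] that by auto
    moreover have "\<not> less (\<tau> j) (\<tau> i)" using r_mono[of "\<tau> j" "\<tau> i"] \<tau>J r\<tau>[of i] r\<tau>[of j] that by auto
    ultimately show ?thesis using total[of "\<tau> i" "\<tau> j"] \<tau>J that by auto
  qed
  ultimately show ?thesis using bij\<tau> by (intro exI[of _ \<tau>]) blast
qed

lemma finite_uniform_gap:
  assumes "finite S" "\<And>x. x \<in> S \<Longrightarrow> \<exists>\<gamma>>0. \<exists>L. P x \<gamma> L"
    and "\<And>x \<gamma> \<gamma>' L L'. P x \<gamma> L \<Longrightarrow> \<gamma>' \<le> \<gamma> \<Longrightarrow> L \<le> L' \<Longrightarrow> P x \<gamma>' L'"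
  shows "\<exists>\<gamma>>0. \<exists>L. \<forall>x\<in>S. P x (\<gamma>::real) (L::nat)"
  using assms(1,2)
proof (induction S rule: finite_induct)
  case empty
  then show ?case by (intro exI[of _ 1]) auto
next
  case (insert x S)
  then obtain \<gamma> L where 1: "\<gamma> > 0" "\<forall>x\<in>S. P x \<gamma> L" by auto
  obtain \<gamma>' L' where 2: "\<gamma>' > 0" "P x \<gamma>' L'" using insert.prems[of x] by auto
  have "\<forall>x\<in>insert x S. P x (min \<gamma> \<gamma>') (max L L')"
    using 1 2 assms(3) by (metis insert_iff max.cobounded1 max.cobounded2 min.cobounded1 min.cobounded2)
  then show ?case using 1 2 by (intro exI[of _ "min \<gamma> \<gamma>'"]) auto
qed

text \<open>Strict lexicographic order of the first l entries, up to an error of the entries: it is exact for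
  tolerance 0, and the order of the true labels survives their estimation.\<close>

definition lex_below :: "nat \<Rightarrow> real \<Rightarrow> (nat \<Rightarrow> real) \<Rightarrow> (nat \<Rightarrow> real) \<Rightarrow> bool" where
  "lex_below l \<delta> a b \<longleftrightarrow> (\<exists>m<l. b m > a m + \<delta> \<and> (\<forall>m'<m. a m' \<le> b m' + \<delta>))"

text \<open>Index 0 is the constant test function, so \<open>T i 0 n\<close> is the moment without
  the middle observation, and the last term normalises the mean of g at the first observation to
  1.\<close>

definition residual ::
    "nat \<Rightarrow> (nat \<Rightarrow> nat \<Rightarrow> nat \<Rightarrow> real) \<Rightarrow> (nat \<Rightarrow> real) \<Rightarrow> (nat \<Rightarrow> real) \<Rightarrow> real" where
  "residual l T c lam =
     (\<Sum>m<l. \<Sum>n<l. \<bar>\<Sum>i<l. c i * (T i m n - lam m * T i 0 n)\<bar>) + \<bar>(\<Sum>i<l. c i * T i 0 0) - 1\<bar>"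

lemma residual_ge:
  "m < l \<Longrightarrow> n < l \<Longrightarrow> \<bar>\<Sum>i<l. c i * (T i m n - lam m * T i 0 n)\<bar> \<le> residual l T c lam"
  "\<bar>(\<Sum>i<l. c i * T i 0 0) - 1\<bar> \<le> residual l T c lam"
proof -
  assume m: "m < l" and n: "n < l"
  have "\<bar>\<Sum>i<l. c i * (T i m n - lam m * T i 0 n)\<bar> \<le> (\<Sum>n<l. \<bar>\<Sum>i<l. c i * (T i m n - lam m * T i 0 n)\<bar>)"
    using n by (intro member_le_sum[of n _ "\<lambda>n. \<bar>\<Sum>i<l. c i * (T i m n - lam m * T i 0 n)\<bar>"]) auto
  also have "\<dots> \<le> (\<Sum>m<l. \<Sum>n<l. \<bar>\<Sum>i<l. c i * (T i m n - lam m * T i 0 n)\<bar>)"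
    using m by (intro member_le_sum[of m _ "\<lambda>m. \<Sum>n<l. \<bar>\<Sum>i<l. c i * (T i m n - lam m * T i 0 n)\<bar>"]) (auto intro!: sum_nonneg)
  finally show "\<bar>\<Sum>i<l. c i * (T i m n - lam m * T i 0 n)\<bar> \<le> residual l T c lam"
    by (simp add: residual_def)
next
  show "\<bar>(\<Sum>i<l. c i * T i 0 0) - 1\<bar> \<le> residual l T c lam"
    unfolding residual_def by (simp add: sum_nonneg)
qed

lemma weighted_sum_diff:
  fixes c :: "nat \<Rightarrow> real"
  assumes "(\<Sum>i<l. \<bar>c i\<bar>) \<le> M" "\<And>i. i < l \<Longrightarrow> \<bar>a i - b i\<bar> \<le> e" "e \<ge> 0"
  shows "\<bar>(\<Sum>i<l. c i * a i) - (\<Sum>i<l. c i * b i)\<bar> \<le> M * e"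
proof -
  have "\<bar>(\<Sum>i<l. c i * a i) - (\<Sum>i<l. c i * b i)\<bar> = \<bar>\<Sum>i<l. c i * (a i - b i)\<bar>"
    by (simp add: sum_subtractf right_diff_distrib)
  also have "\<dots> \<le> (\<Sum>i<l. \<bar>c i\<bar> * e)"
    by (rule order_trans[OF sum_abs]) (auto simp: abs_mult intro!: sum_mono mult_left_mono assms(2))
  also have "\<dots> \<le> M * e"
    using assms(1,3) by (simp add: sum_distrib_right[symmetric] mult_right_mono)
  finally show ?thesis .
qed

context hmm
begin

abbreviation "hmean m b \<equiv> mean (halfline m) b"

definition moment :: "nat \<Rightarrow> nat \<Rightarrow> nat \<Rightarrow> real" where
  "moment i m n = triple_mean (halfline i) (halfline m) (halfline n)"

lemma halfline_abs: "\<bar>halfline l y\<bar> \<le> 1"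
  using halfline_bounds[of l y] by simp

lemma hmean_bounds: "b < J \<Longrightarrow> 0 \<le> hmean m b" "b < J \<Longrightarrow> hmean m b \<le> 1" "b < J \<Longrightarrow> hmean 0 b = 1"
proof -
  assume b: "b < J"
  show "0 \<le> hmean m b" unfolding mean_def using halfline_bounds f_nonneg[OF b] by (intro integral_nonneg_AE) auto
  show "hmean m b \<le> 1" using mean_abs_le[OF b halfline_measurable halfline_abs, of m] by linarith
  show "hmean 0 b = 1" using mean_1[OF b] by (simp add: halfline_def[abs_def])
qed

lemma after_bounds: "b < J \<Longrightarrow> 0 \<le> after (halfline m) b" "b < J \<Longrightarrow> after (halfline m) b \<le> 1"
  "b < J \<Longrightarrow> after (halfline 0) b = 1"
proof -
  assume b: "b < J"
  show "0 \<le> after (halfline m) b" unfolding after_def using b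
    by (intro sum_nonneg mult_nonneg_nonneg Q_nonneg hmean_bounds) auto
  have "after (halfline m) b \<le> (\<Sum>d<J. Q b d * 1)" unfolding after_def using b
    by (intro sum_mono mult_left_mono Q_nonneg hmean_bounds) auto
  then show "after (halfline m) b \<le> 1" using Q_sum[OF b] by simp
  show "after (halfline 0) b = 1" using after_1[OF b] by (simp add: halfline_def[abs_def])
qed

lemma before_bounds: "b < J \<Longrightarrow> 0 \<le> before (halfline m) b" "(\<Sum>b<J. before (halfline m) b) \<le> 1"
proof -
  show "0 \<le> before (halfline m) b" if b: "b < J" unfolding before_def using b
    by (intro sum_nonneg mult_nonneg_nonneg Q_nonneg p_nonneg hmean_bounds) auto
  have "(\<Sum>b<J. before (halfline m) b) \<le> (\<Sum>b<J. \<Sum>a<J. p a * Q a b * 1)"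
    unfolding before_def by (intro sum_mono mult_left_mono mult_nonneg_nonneg Q_nonneg p_nonneg hmean_bounds) auto
  also have "\<dots> = (\<Sum>b<J. p b)" by (intro sum.cong) (auto simp: p_invariant)
  finally show "(\<Sum>b<J. before (halfline m) b) \<le> 1" using p_sum by simp
qed

lemma moment_contract:
  "(\<Sum>i<l. c i * moment i m n) = (\<Sum>b<J. (\<Sum>i<l. c i * before (halfline i) b) * (hmean m b * after (halfline n) b))"
proof -
  have "(\<Sum>i<l. c i * moment i m n) = (\<Sum>i<l. \<Sum>b<J. c i * before (halfline i) b * (hmean m b * after (halfline n) b))"
    by (simp add: moment_def triple_mean_def sum_distrib_left mult.assoc)
  also have "\<dots> = (\<Sum>b<J. \<Sum>i<l. c i * before (halfline i) b * (hmean m b * after (halfline n) b))"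
    by (rule sum.swap)
  finally show ?thesis by (simp add: sum_distrib_right)
qed

lemma moment_bounds: "\<bar>moment i m n\<bar> \<le> 1"
proof -
  have "\<bar>moment i m n\<bar> \<le> (\<Sum>b<J. before (halfline i) b * (1 * 1))"
    unfolding moment_def triple_mean_def
  proof (rule order_trans[OF sum_abs], rule sum_mono)
    fix b assume "b \<in> {..<J}"
    then have b: "b < J" by simp
    show "\<bar>before (halfline i) b * hmean m b * after (halfline n) b\<bar> \<le> before (halfline i) b * (1 * 1)"
      unfolding abs_mult mult.assoc
      using before_bounds(1)[OF b, of i] hmean_bounds(1,2)[OF b, of m] after_bounds(1,2)[OF b, of n]
      by (intro mult_mono mult_nonneg_nonneg) auto
  qed
  then show ?thesis using before_bounds(2)[of i] by simp
qed

text \<open>The combination of densities is continuous and orthogonal to all half-lines, so it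
  vanishes at every point, which is the sense in which the densities are assumed
  independent.\<close>

lemma hmean_independent:
  assumes "\<forall>l. (\<Sum>b<J. v b * hmean l b) = 0"
  shows "\<forall>b<J. v b = 0"
proof -
  define g where "g x = (\<Sum>b<J. v b * f b x)" for x
  have cont: "continuous_on UNIV g"
    unfolding g_def by (intro continuous_intros holder_space_continuous[OF f_holder]) auto
  have int: "integrable lborel g"
    unfolding g_def using f_integrable by (intro Bochner_Integration.integrable_sum integrable_mult_right) auto
  have "(\<integral>y. halfline l y * g y \<partial>lborel) = 0" for l
  proof -
    have "(\<integral>y. halfline l y * g y \<partial>lborel) = (\<integral>y. (\<Sum>b<J. v b * (halfline l y * f b y)) \<partial>lborel)"
      by (simp add: g_def sum_distrib_left mult.left_commute)
    also have "\<dots> = (\<Sum>b<J. \<integral>y. v b * (halfline l y * f b y) \<partial>lborel)"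
      using halfline_integrable f_integrable
      by (intro Bochner_Integration.integral_sum integrable_mult_right) auto
    also have "\<dots> = (\<Sum>b<J. v b * hmean l b)"
      by (simp add: mean_def)
    finally show ?thesis using assms by simp
  qed
  then have "g x = 0" for x by (rule halfline_separating[OF cont int])
  then have "\<forall>x. (\<Sum>j<J. v j * f j x) = 0" by (simp add: g_def)
  then show ?thesis using params by (auto simp: hmm_params_def lin_indep_funs_def)
qed

lemma after_independent:
  assumes "\<forall>l. (\<Sum>b<J. v b * after (halfline l) b) = 0"
  shows "\<forall>b<J. v b = 0"
proof -
  have "(\<Sum>d<J. (\<Sum>b<J. v b * Q b d) * hmean l d) = 0" for l
  proof -
    have "(\<Sum>b<J. v b * after (halfline l) b) = (\<Sum>b<J. \<Sum>d<J. v b * Q b d * hmean l d)"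
      by (simp add: after_def sum_distrib_left mult.assoc)
    also have "\<dots> = (\<Sum>d<J. \<Sum>b<J. v b * Q b d * hmean l d)" by (rule sum.swap)
    finally show ?thesis using assms by (simp add: sum_distrib_right)
  qed
  then have "\<forall>d<J. (\<Sum>b<J. v b * Q b d) = 0" by (intro hmean_independent) blast
  then show ?thesis using params by (auto simp: hmm_params_def full_rank_def)
qed

text \<open>Here the coefficients meet Q from the other side than in
  \<open>after_independent\<close>, once the positive weights p are cancelled; a square matrix with
  trivial left kernel has trivial right kernel as well.\<close>

lemma before_independent:
  assumes "\<forall>l. (\<Sum>b<J. v b * before (halfline l) b) = 0"
  shows "\<forall>b<J. v b = 0"
proof -
  have "(\<Sum>a<J. (\<Sum>b<J. v b * (p a * Q a b)) * hmean l a) = 0" for l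
  proof -
    have "(\<Sum>b<J. v b * before (halfline l) b) = (\<Sum>b<J. \<Sum>a<J. v b * (p a * Q a b) * hmean l a)"
      by (simp add: before_def sum_distrib_left mult.assoc)
    also have "\<dots> = (\<Sum>a<J. \<Sum>b<J. v b * (p a * Q a b) * hmean l a)" by (rule sum.swap)
    finally show ?thesis using assms by (simp add: sum_distrib_right)
  qed
  then have "\<forall>a<J. (\<Sum>b<J. v b * (p a * Q a b)) = 0" by (intro hmean_independent) blast
  moreover have "(\<Sum>b<J. v b * (p a * Q a b)) = p a * (\<Sum>b<J. Q a b * v b)" for a
    by (simp add: sum_distrib_left algebra_simps)
  ultimately have Qv: "(\<Sum>b<J. Q a b * v b) = 0" if "a < J" for a
    using that p_pos[OF that] by auto
  have "\<exists>B. (\<forall>i<J. \<forall>j<J. (\<Sum>l<J. Q i l * B l j) = (if i = j then 1 else 0)) \<and>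
             (\<forall>i<J. \<forall>j<J. (\<Sum>l<J. B i l * Q l j) = (if i = j then 1 else (0::real)))"
    by (rule left_kernel_trivial_imp_inverse) (use params in \<open>auto simp: hmm_params_def full_rank_def\<close>)
  then obtain B where B: "\<And>i j. i < J \<Longrightarrow> j < J \<Longrightarrow> (\<Sum>l<J. B i l * Q l j) = (if i = j then 1 else 0)"
    by blast
  have "v i = 0" if i: "i < J" for i
  proof -
    have "(\<Sum>l<J. B i l * (\<Sum>b<J. Q l b * v b)) = (\<Sum>l<J. \<Sum>b<J. B i l * Q l b * v b)"
      by (simp add: sum_distrib_left mult.assoc)
    also have "\<dots> = (\<Sum>b<J. \<Sum>l<J. B i l * Q l b * v b)" by (rule sum.swap)
    also have "\<dots> = (\<Sum>b<J. if b = i then v b else 0)"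
      using i by (intro sum.cong) (auto simp: B simp flip: sum_distrib_right)
    finally show ?thesis using i Qv by simp
  qed
  then show ?thesis by blast
qed

definition lex_less :: "nat \<Rightarrow> nat \<Rightarrow> bool" where
  "lex_less a b \<longleftrightarrow> (\<exists>m. hmean m a < hmean m b \<and> (\<forall>m'<m. hmean m' a = hmean m' b))"

lemma lex_less_trans:
  assumes "lex_less a b" "lex_less b c"
  shows "lex_less a c"
proof -
  obtain m where m: "hmean m a < hmean m b" "\<forall>m'<m. hmean m' a = hmean m' b" using assms(1) by (auto simp: lex_less_def)
  obtain k where k: "hmean k b < hmean k c" "\<forall>m'<k. hmean m' b = hmean m' c" using assms(2) by (auto simp: lex_less_def)
  show ?thesis
    unfolding lex_less_def
  proof (intro exI[of _ "min m k"] conjI allI impI)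
    show "hmean (min m k) a < hmean (min m k) c"
      using m k by (cases m k rule: linorder_cases) auto
    show "hmean m' a = hmean m' c" if "m' < min m k" for m'
      using m k that by auto
  qed
qed

text \<open>Two states with the same half-line means would make the difference of two unit vectors a
  linear relation between the states.\<close>

lemma lex_less_total:
  assumes "a < J" "b < J" "a \<noteq> b"
  shows "lex_less a b \<or> lex_less b a"
proof -
  have "\<exists>m. hmean m a \<noteq> hmean m b"
  proof (rule ccontr)
    assume *: "\<not> ?thesis"
    define v where "v c = (if c = a then 1 else if c = b then -1 else (0::real))" for c
    have "(\<Sum>c<J. v c * hmean l c) = (\<Sum>c<J. (if c = a then hmean l c else 0) - (if c = b then hmean l c else 0))" for l
      using assms by (intro sum.cong) (auto simp: v_def)
    also have "\<dots> l = hmean l a - hmean l b" for l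
      using assms by (simp add: sum_subtractf)
    finally have "\<forall>l. (\<Sum>c<J. v c * hmean l c) = 0" using * by simp
    from hmean_independent[OF this] have "v a = 0" using assms by blast
    then show False by (simp add: v_def)
  qed
  define m where "m = (LEAST m. hmean m a \<noteq> hmean m b)"
  have "hmean m a \<noteq> hmean m b" unfolding m_def using \<open>\<exists>m. _ m\<close> by (rule LeastI_ex)
  moreover have "\<forall>m'<m. hmean m' a = hmean m' b" unfolding m_def using not_less_Least by blast
  ultimately show ?thesis unfolding lex_less_def by (metis linorder_neqE_linordered_idom)
qed

text \<open>There are finitely many pairs of states, hence one gap \<gamma> and one number L of
  half-lines for all of them; both depend on the unknown parameters.\<close>

lemma lex_gap:
  obtains \<gamma> L where "\<gamma> > 0" "\<And>a b. a < J \<Longrightarrow> b < J \<Longrightarrow> lex_less a b \<Longrightarrow>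
     \<exists>m<L. hmean m a + \<gamma> \<le> hmean m b \<and> (\<forall>m'<m. hmean m' a = hmean m' b)"
proof -
  let ?P = "\<lambda>(a, b) \<gamma> L. lex_less a b \<longrightarrow> (\<exists>m<L. hmean m a + \<gamma> \<le> hmean m b \<and> (\<forall>m'<m. hmean m' a = hmean m' b))"
  have "\<exists>\<gamma>>0. \<exists>L. \<forall>x\<in>{..<J} \<times> {..<J}. ?P x \<gamma> L"
  proof (rule finite_uniform_gap)
    fix x assume "x \<in> {..<J} \<times> {..<J}"
    obtain a b where x: "x = (a, b)" by (cases x)
    show "\<exists>\<gamma>>0. \<exists>L. ?P x \<gamma> L"
    proof (cases "lex_less a b")
      case True
      then obtain m where "hmean m a < hmean m b" "\<forall>m'<m. hmean m' a = hmean m' b" by (auto simp: lex_less_def)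
      then show ?thesis unfolding x
        by (intro exI[of _ "hmean m b - hmean m a"] conjI exI[of _ "Suc m"]) auto
    qed (auto simp: x intro!: exI[of _ "1::real"])
  next
    fix x \<gamma> \<gamma>' L L' assume P: "?P x \<gamma> L" and le: "\<gamma>' \<le> (\<gamma>::real)" "L \<le> (L'::nat)"
    obtain a b where x: "x = (a, b)" by (cases x)
    show "?P x \<gamma>' L'"
      unfolding x prod.case
    proof
      assume "lex_less a b"
      with P obtain m where "m < L" "hmean m a + \<gamma> \<le> hmean m b" "\<forall>m'<m. hmean m' a = hmean m' b" by (auto simp: x)
      then show "\<exists>m<L'. hmean m a + \<gamma>' \<le> hmean m b \<and> (\<forall>m'<m. hmean m' a = hmean m' b)"
        using le by (intro exI[of _ m]) auto
    qed
  qed auto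
  then obtain \<gamma> L where "\<gamma> > 0" "\<forall>x\<in>{..<J} \<times> {..<J}. ?P x \<gamma> L" by blast
  show thesis
  proof (rule that[OF \<open>\<gamma> > 0\<close>])
    show "\<exists>m<L. hmean m a + \<gamma> \<le> hmean m b \<and> (\<forall>m'<m. hmean m' a = hmean m' b)"
      if "a < J" "b < J" "lex_less a b" for a b
      using bspec[OF \<open>\<forall>x\<in>_. ?P x \<gamma> L\<close>, of "(a, b)"] that by simp
  qed
qed

text \<open>For g the combination of half-lines with coefficients c: the mean of g at the first
  observation on the event that the middle state is b.\<close>

definition loading :: "nat \<Rightarrow> (nat \<Rightarrow> real) \<Rightarrow> nat \<Rightarrow> real" where
  "loading l c b = (\<Sum>i<l. c i * before (halfline i) b)"

text \<open>The coefficients and lam enter only through the product of a loading with the defect of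
  lam in that state. Since \<open>after\<close> separates the states, small contrasts force every
  such product to be small.\<close>

lemma contrast_contract:
  "(\<Sum>i<l. c i * (moment i m n - r * moment i 0 n)) =
   (\<Sum>b<J. (loading l c b * (hmean m b - r)) * after (halfline n) b)"
proof -
  have "(\<Sum>i<l. c i * (moment i m n - r * moment i 0 n))
      = (\<Sum>i<l. c i * moment i m n) - r * (\<Sum>i<l. c i * moment i 0 n)"
    by (simp add: right_diff_distrib sum_subtractf sum_distrib_left mult.left_commute)
  also have "\<dots> = (\<Sum>b<J. loading l c b * (hmean m b * after (halfline n) b))
      - r * (\<Sum>b<J. loading l c b * (hmean 0 b * after (halfline n) b))"
    by (simp only: moment_contract loading_def)
  also have "r * (\<Sum>b<J. loading l c b * (hmean 0 b * after (halfline n) b))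
      = (\<Sum>b<J. r * (loading l c b * after (halfline n) b))"
    unfolding sum_distrib_left by (intro sum.cong refl) (simp only: hmean_bounds(3) lessThan_iff mult_1_left)
  finally show ?thesis
    by (simp add: sum_subtractf[symmetric] algebra_simps)
qed

lemma total_contract: "(\<Sum>i<l. c i * moment i 0 0) = (\<Sum>b<J. loading l c b)"
  unfolding moment_contract loading_def[symmetric]
  by (intro sum.cong refl) (simp only: hmean_bounds(3) after_bounds(3) lessThan_iff mult_1_right)

text \<open>Every product of a loading with a mean defect is small, and the loadings add up to about
  1. So some loading is at least 1 / (2 J) in size, and lam is close to the means of that state b0.
  Every other state differs from b0 by \<gamma> in some mean, hence from lam by \<gamma> / 2, which
  makes its loading small.\<close>

lemma single_state_stability:
  obtains C L where "C > 0" "\<And>l T c lam \<epsilon> \<eta>. L \<le> l \<Longrightarrow>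
     \<forall>i<l. \<forall>m<l. \<forall>n<l. \<bar>T i m n - moment i m n\<bar> \<le> \<epsilon> \<Longrightarrow> 0 \<le> \<epsilon> \<Longrightarrow>
     (\<Sum>i<l. \<bar>c i\<bar>) \<le> real l \<Longrightarrow> \<forall>m<l. 0 \<le> lam m \<and> lam m \<le> 1 \<Longrightarrow>
     residual l T c lam \<le> \<eta> \<Longrightarrow> C * (\<eta> + 2 * real l * \<epsilon>) \<le> 1 \<Longrightarrow>
     \<exists>b0<J. (\<forall>m<l. \<bar>hmean m b0 - lam m\<bar> \<le> C * (\<eta> + 2 * real l * \<epsilon>)) \<and>
        (\<forall>b<J. \<bar>loading l c b - of_bool (b = b0)\<bar> \<le> C * (\<eta> + 2 * real l * \<epsilon>))"
proof -
  obtain L1 d where d: "\<And>j b. j < J \<Longrightarrow> b < J \<Longrightarrow> (\<Sum>n<L1. d j n * after (halfline n) b) = (if j = b then 1 else (0::real))"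
    using dual_family[where J = J and F = "\<lambda>b n. after (halfline n) b", OF after_independent] by blast
  obtain \<gamma> L2 where \<gamma>: "\<gamma> > 0" and gap: "\<And>a b. a < J \<Longrightarrow> b < J \<Longrightarrow> lex_less a b \<Longrightarrow>
     \<exists>m<L2. hmean m a + \<gamma> \<le> hmean m b \<and> (\<forall>m'<m. hmean m' a = hmean m' b)"
    by (rule lex_gap) (rule that)
  define D where "D = (\<Sum>j<J. \<Sum>n<L1. \<bar>d j n\<bar>)"
  have D0: "D \<ge> 0" unfolding D_def by (intro sum_nonneg) auto
  \<comment> \<open>Large enough for four uses: to make \<rho> at most 1/2, to bound the defect of
    lam at b0, to keep this defect below \<gamma> / 2, and to bound the errors of the
    loadings.\<close>
  define C where "C = 2 + 2 * real J * D + 4 * real J * D / \<gamma>"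
  define A B where "A = real J * D" and "B = real J * D / \<gamma>"
  have AB: "A \<ge> 0" "B \<ge> 0" using D0 \<gamma> by (auto simp: A_def B_def)
  have eqs: "2 * real J * D = 2 * A" "4 * real J * D / \<gamma> = 4 * B" "2 * real J * D / \<gamma> = 2 * B"
    by (simp_all add: A_def B_def)
  have Ceq: "C = 2 + 2 * A + 4 * B"
    by (simp add: C_def A_def B_def)
  have C: "C \<ge> 2" using AB unfolding Ceq by linarith
  have C2: "C \<ge> 2 * real J * D" using AB unfolding Ceq eqs(1) by linarith
  have C3: "C \<ge> 4 * real J * D / \<gamma>" using AB unfolding Ceq eqs(2) by linarith
  have C4: "C \<ge> 1 + 2 * real J * D / \<gamma>" using AB unfolding Ceq eqs(3) by linarith
  show thesis
  proof (rule that[of C "max 1 (max L1 L2)"])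
    show "C > 0" using C by simp
    fix l T c lam \<epsilon> \<eta>
    assume l: "l \<ge> max 1 (max L1 L2)"
      and T: "\<forall>i<l. \<forall>m<l. \<forall>n<l. \<bar>T i m n - moment i m n\<bar> \<le> \<epsilon>" and \<epsilon>: "0 \<le> \<epsilon>"
      and c: "(\<Sum>i<l. \<bar>c i\<bar>) \<le> real l" and lam: "\<forall>m<l. 0 \<le> lam m \<and> lam m \<le> (1::real)"
      and res: "residual l T c lam \<le> \<eta>" and small: "C * (\<eta> + 2 * real l * \<epsilon>) \<le> 1"
    \<comment> \<open>The residual bound plus the price of replacing T by the true moments:
      coefficients of l1 norm at most l, and two moments in each contrast.\<close>
    define \<rho> where "\<rho> = \<eta> + 2 * real l * \<epsilon>"
    define y where "y = loading l c"
    have l0: "0 < l" using l by simp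
    have contrast: "\<bar>\<Sum>b<J. (y b * (hmean m b - lam m)) * after (halfline n) b\<bar> \<le> \<rho>" if m: "m < l" and n: "n < l" for m n
    proof -
      have "\<bar>(\<Sum>i<l. c i * (T i m n - lam m * T i 0 n)) - (\<Sum>i<l. c i * (moment i m n - lam m * moment i 0 n))\<bar> \<le> real l * (2 * \<epsilon>)"
      proof (rule weighted_sum_diff[OF c])
        fix i assume i: "i < l"
        have "\<bar>T i m n - moment i m n\<bar> \<le> \<epsilon>" "\<bar>T i 0 n - moment i 0 n\<bar> \<le> \<epsilon>"
          using T i m n l0 by auto
        moreover have "\<bar>lam m * (T i 0 n - moment i 0 n)\<bar> \<le> 1 * \<epsilon>"
          unfolding abs_mult using lam m calculation(2) by (intro mult_mono) auto
        ultimately show "\<bar>(T i m n - lam m * T i 0 n) - (moment i m n - lam m * moment i 0 n)\<bar> \<le> 2 * \<epsilon>"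
          by (simp add: right_diff_distrib abs_le_iff)
      qed (use \<epsilon> in simp)
      moreover have "\<bar>\<Sum>i<l. c i * (T i m n - lam m * T i 0 n)\<bar> \<le> \<eta>"
        using residual_ge(1)[OF m n, of c T lam] res by linarith
      ultimately show ?thesis
        unfolding contrast_contract[symmetric] y_def \<rho>_def by linarith
    qed
    have total: "\<bar>(\<Sum>b<J. y b) - 1\<bar> \<le> \<rho>"
    proof -
      have "\<bar>(\<Sum>i<l. c i * T i 0 0) - (\<Sum>i<l. c i * moment i 0 0)\<bar> \<le> real l * \<epsilon>"
        using T l0 by (intro weighted_sum_diff[OF c]) (auto simp: \<epsilon>)
      moreover have "\<bar>(\<Sum>i<l. c i * T i 0 0) - 1\<bar> \<le> \<eta>"
        using residual_ge(2)[where l = l and c = c and T = T and lam = lam] res by linarith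
      moreover have "real l * \<epsilon> \<ge> 0" using \<epsilon> by simp
      ultimately show ?thesis unfolding total_contract y_def \<rho>_def by linarith
    qed
    have \<rho>0: "\<rho> \<ge> 0" using total by linarith
    have prodb: "\<bar>y b * (hmean m b - lam m)\<bar> \<le> D * \<rho>" if m: "m < l" and b: "b < J" for m b
    proof -
      have "\<bar>y b * (hmean m b - lam m)\<bar> \<le> (\<Sum>n<L1. \<bar>d b n\<bar>) * \<rho>"
        by (rule dual_family_bound[where J = J and F = "\<lambda>b n. after (halfline n) b" and d = d])
          (use d b l m contrast in auto)
      also have "\<dots> \<le> D * \<rho>"
        unfolding D_def using b \<rho>0
        by (intro mult_right_mono member_le_sum[of b _ "\<lambda>j. \<Sum>n<L1. \<bar>d j n\<bar>"]) (auto intro!: sum_nonneg)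
      finally show ?thesis .
    qed
    have "2 * \<rho> \<le> C * \<rho>" using C \<rho>0 by (intro mult_right_mono) auto
    then have \<rho>h: "\<rho> \<le> 1/2" using small by (simp add: \<rho>_def)
    have "\<exists>b0<J. \<bar>y b0\<bar> \<ge> 1 / (2 * real J)"
    proof (rule ccontr)
      assume "\<not> ?thesis"
      then have *: "\<bar>y b\<bar> < 1 / (2 * real J)" if "b < J" for b using that by force
      have "(\<Sum>b<J. \<bar>y b\<bar>) < (\<Sum>b<J. 1 / (2 * real J))"
        using J_pos * by (intro sum_strict_mono) (auto simp: lessThan_empty_iff)
      then have "(\<Sum>b<J. \<bar>y b\<bar>) < 1 / 2" using J_pos by simp
      then have "\<bar>\<Sum>b<J. y b\<bar> < 1/2" using sum_abs[of y "{..<J}"] by linarith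
      then show False using total \<rho>h by linarith
    qed
    then obtain b0 where b0: "b0 < J" "\<bar>y b0\<bar> \<ge> 1 / (2 * real J)" by blast
    have lamb0: "\<bar>hmean m b0 - lam m\<bar> \<le> 2 * real J * D * \<rho>" if m: "m < l" for m
    proof -
      have "1 / (2 * real J) * \<bar>hmean m b0 - lam m\<bar> \<le> \<bar>y b0\<bar> * \<bar>hmean m b0 - lam m\<bar>"
        using b0 by (intro mult_right_mono) auto
      also have "\<dots> \<le> D * \<rho>" using prodb[OF m b0(1)] by (simp add: abs_mult)
      finally show ?thesis using J_pos by (simp add: field_simps)
    qed
    have "4 * real J * D / \<gamma> * \<rho> \<le> C * \<rho>" using C3 \<rho>0 by (rule mult_right_mono)
    then have "4 * real J * D / \<gamma> * \<rho> \<le> 1" using small by (simp add: \<rho>_def)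
    then have e: "2 * real J * D * \<rho> \<le> \<gamma> / 2" using \<gamma> by (simp add: field_simps)
    have off: "\<bar>y b\<bar> \<le> 2 * D / \<gamma> * \<rho>" if b: "b < J" "b \<noteq> b0" for b
    proof -
      have "\<exists>m<l. \<bar>hmean m b - hmean m b0\<bar> \<ge> \<gamma>"
        using lex_less_total[OF b(1) b0(1) b(2)]
      proof
        assume "lex_less b b0"
        from gap[OF b(1) b0(1) this] obtain m where "m < L2" "hmean m b + \<gamma> \<le> hmean m b0" by blast
        then show ?thesis using l by (intro exI[of _ m]) auto
      next
        assume "lex_less b0 b"
        from gap[OF b0(1) b(1) this] obtain m where "m < L2" "hmean m b0 + \<gamma> \<le> hmean m b" by blast
        then show ?thesis using l by (intro exI[of _ m]) auto
      qed
      then obtain m where m: "m < l" "\<bar>hmean m b - hmean m b0\<bar> \<ge> \<gamma>" by blast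
      have "\<gamma> / 2 \<le> \<bar>hmean m b - lam m\<bar>" using m(2) lamb0[OF m(1)] e by linarith
      then have "\<bar>y b\<bar> * (\<gamma> / 2) \<le> \<bar>y b\<bar> * \<bar>hmean m b - lam m\<bar>" by (intro mult_left_mono) auto
      also have "\<dots> \<le> D * \<rho>" using prodb[OF m(1) b(1)] by (simp add: abs_mult)
      finally show ?thesis using \<gamma> by (simp add: field_simps)
    qed
    have K0: "2 * D / \<gamma> * \<rho> \<ge> 0" using D0 \<gamma> \<rho>0 by simp
    have main: "\<bar>y b0 - 1\<bar> \<le> (1 + 2 * real J * D / \<gamma>) * \<rho>"
    proof -
      have "(\<Sum>b<J. y b) = y b0 + (\<Sum>b\<in>{..<J} - {b0}. y b)"
        using b0 by (intro sum.remove) auto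
      moreover have "\<bar>\<Sum>b\<in>{..<J} - {b0}. y b\<bar> \<le> (\<Sum>b\<in>{..<J} - {b0}. 2 * D / \<gamma> * \<rho>)"
        by (rule order_trans[OF sum_abs], rule sum_mono) (use off in auto)
      moreover have "(\<Sum>b\<in>{..<J} - {b0}. 2 * D / \<gamma> * \<rho>) \<le> J * (2 * D / \<gamma> * \<rho>)"
        unfolding sum_constant using K0 by (intro mult_right_mono) (auto simp: card_Diff_singleton_if)
      ultimately have "\<bar>y b0 - 1\<bar> \<le> \<rho> + J * (2 * D / \<gamma> * \<rho>)" using total by linarith
      then show ?thesis by (simp add: algebra_simps)
    qed
    have C5: "(1 + 2 * real J * D / \<gamma>) * \<rho> \<le> C * \<rho>" using C4 \<rho>0 by (rule mult_right_mono)
    show "\<exists>b0<J. (\<forall>m<l. \<bar>hmean m b0 - lam m\<bar> \<le> C * (\<eta> + 2 * real l * \<epsilon>)) \<and>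
        (\<forall>b<J. \<bar>loading l c b - of_bool (b = b0)\<bar> \<le> C * (\<eta> + 2 * real l * \<epsilon>))"
      unfolding \<rho>_def[symmetric] y_def[symmetric]
    proof (intro exI[of _ b0] conjI allI impI b0(1))
      fix m assume "m < l"
      moreover have "2 * real J * D * \<rho> \<le> C * \<rho>" using C2 \<rho>0 by (rule mult_right_mono)
      ultimately show "\<bar>hmean m b0 - lam m\<bar> \<le> C * \<rho>" using lamb0 by (meson order_trans)
    next
      fix b assume b: "b < J"
      show "\<bar>y b - of_bool (b = b0)\<bar> \<le> C * \<rho>"
      proof (cases "b = b0")
        case True
        then show ?thesis using main C5 by simp
      next
        case False
        have "1 * (2 * D / \<gamma> * \<rho>) \<le> J * (2 * D / \<gamma> * \<rho>)"
          using J_pos K0 by (intro mult_right_mono) auto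
        also have "\<dots> \<le> (1 + 2 * real J * D / \<gamma>) * \<rho>" using \<rho>0 by (simp add: algebra_simps)
        finally show ?thesis using off[OF b False] C5 False by simp
      qed
    qed
  qed
qed

text \<open>Every fitted row j is attached to one state \<open>g j\<close>. The order of the fitted
  means carries over to the states because the fitting error is below half the margin 1/l, and
  margin and error together are below \<gamma>. Uniqueness of the enumeration then gives g = \<tau>,
  so that no two rows share a state.\<close>

lemma ordered_states_stability:
  obtains \<tau> \<kappa> C L where "bij_betw \<tau> {..<J} {..<J}" "\<And>i j. i < j \<Longrightarrow> j < J \<Longrightarrow> lex_less (\<tau> i) (\<tau> j)"
    "\<kappa> > 0" "C > 0" "\<And>l T c lam \<epsilon> \<eta> j b. L \<le> l \<Longrightarrow>
     \<forall>i<l. \<forall>m<l. \<forall>n<l. \<bar>T i m n - moment i m n\<bar> \<le> \<epsilon> \<Longrightarrow> 0 \<le> \<epsilon> \<Longrightarrow>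
     \<forall>j<J. (\<Sum>i<l. \<bar>c j i\<bar>) \<le> real l \<Longrightarrow> \<forall>j<J. \<forall>m<l. 0 \<le> lam j m \<and> lam j m \<le> 1 \<Longrightarrow>
     \<forall>i j. i < j \<longrightarrow> j < J \<longrightarrow> lex_below l (1 / real l) (lam i) (lam j) \<Longrightarrow>
     \<forall>j<J. residual l T (c j) (lam j) \<le> \<eta> \<Longrightarrow> real l * (\<eta> + 2 * real l * \<epsilon>) \<le> \<kappa> \<Longrightarrow>
     j < J \<Longrightarrow> b < J \<Longrightarrow> \<bar>loading l (c j) b - of_bool (b = \<tau> j)\<bar> \<le> C * (\<eta> + 2 * real l * \<epsilon>)"
proof -
  have irrefl: "\<not> lex_less a a" for a by (auto simp: lex_less_def)
  have "\<exists>\<tau>. bij_betw \<tau> {..<J} {..<J} \<and>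
    (\<forall>g. (\<forall>i<J. g i < J) \<longrightarrow> (\<forall>i j. i < j \<longrightarrow> j < J \<longrightarrow> lex_less (g i) (g j)) \<longrightarrow> (\<forall>i<J. g i = \<tau> i)) \<and>
    (\<forall>i j. i < j \<longrightarrow> j < J \<longrightarrow> lex_less (\<tau> i) (\<tau> j))"
  proof (rule finite_strict_order_enumeration)
    show "\<not> lex_less a a" for a by (rule irrefl)
    show "lex_less a c" if "lex_less a b" "lex_less b c" for a b c by (rule lex_less_trans[OF that])
    show "lex_less a b \<or> lex_less b a" if "a < J" "b < J" "a \<noteq> b" for a b by (rule lex_less_total[OF that])
  qed
  then obtain \<tau> where t: "bij_betw \<tau> {..<J} {..<J} \<and>
    (\<forall>g. (\<forall>i<J. g i < J) \<longrightarrow> (\<forall>i j. i < j \<longrightarrow> j < J \<longrightarrow> lex_less (g i) (g j)) \<longrightarrow> (\<forall>i<J. g i = \<tau> i)) \<and>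
    (\<forall>i j. i < j \<longrightarrow> j < J \<longrightarrow> lex_less (\<tau> i) (\<tau> j))"
    by (rule exE)
  note uniq = t[THEN conjunct2, THEN conjunct1, rule_format]
  obtain C L1 where C: "C > 0" and single: "\<And>l T c lam \<epsilon> \<eta>. L1 \<le> l \<Longrightarrow>
     \<forall>i<l. \<forall>m<l. \<forall>n<l. \<bar>T i m n - moment i m n\<bar> \<le> \<epsilon> \<Longrightarrow> 0 \<le> \<epsilon> \<Longrightarrow>
     (\<Sum>i<l. \<bar>c i\<bar>) \<le> real l \<Longrightarrow> \<forall>m<l. 0 \<le> lam m \<and> lam m \<le> 1 \<Longrightarrow>
     residual l T c lam \<le> \<eta> \<Longrightarrow> C * (\<eta> + 2 * real l * \<epsilon>) \<le> 1 \<Longrightarrow>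
     \<exists>b0<J. (\<forall>m<l. \<bar>hmean m b0 - lam m\<bar> \<le> C * (\<eta> + 2 * real l * \<epsilon>)) \<and>
        (\<forall>b<J. \<bar>loading l c b - of_bool (b = b0)\<bar> \<le> C * (\<eta> + 2 * real l * \<epsilon>))"
    by (rule single_state_stability) (rule that)
  obtain \<gamma> L2 where \<gamma>: "\<gamma> > 0" and gap: "\<And>a b. a < J \<Longrightarrow> b < J \<Longrightarrow> lex_less a b \<Longrightarrow>
     \<exists>m<L2. hmean m a + \<gamma> \<le> hmean m b \<and> (\<forall>m'<m. hmean m' a = hmean m' b)"
    by (rule lex_gap) (rule that)
  \<comment> \<open>From here on the margin 1/l is below \<gamma> / 2, although \<gamma> is unknown
    to the estimator.\<close>
  obtain L3 :: nat where L3: "2 / \<gamma> < L3" using reals_Archimedean2 by blast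
  define L where "L = max 1 (max L1 (max L2 L3))"
  have main: "\<forall>j<J. \<forall>b<J. \<bar>loading l (c j) b - of_bool (b = \<tau> j)\<bar> \<le> C * (\<eta> + 2 * real l * \<epsilon>)"
    if l: "l \<ge> L" and T: "\<forall>i<l. \<forall>m<l. \<forall>n<l. \<bar>T i m n - moment i m n\<bar> \<le> \<epsilon>" and \<epsilon>: "0 \<le> \<epsilon>"
      and c: "\<forall>j<J. (\<Sum>i<l. \<bar>c j i\<bar>) \<le> real l" and lam: "\<forall>j<J. \<forall>m<l. 0 \<le> lam j m \<and> lam j m \<le> 1"
      and ord: "\<forall>i j. i < j \<longrightarrow> j < J \<longrightarrow> lex_below l (1 / real l) (lam i) (lam j)"
      and res: "\<forall>j<J. residual l T (c j) (lam j) \<le> \<eta>" and small: "real l * (\<eta> + 2 * real l * \<epsilon>) \<le> 1 / (4 * C)"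
    for l T c lam \<epsilon> \<eta>
  proof -
    define e where "e = C * (\<eta> + 2 * real l * \<epsilon>)"
    have l1: "real l \<ge> 1" using l by (simp add: L_def)
    have le4: "real l * e \<le> 1 / 4"
      using mult_left_mono[OF small, of C] C by (simp add: e_def algebra_simps)
    have e4: "e \<le> 1 / (4 * real l)" using le4 l1 by (simp add: field_simps)
    have "1 / (4 * real l) \<le> 1" using l1 by (simp add: field_simps)
    then have e1: "e \<le> 1" using e4 by linarith
    have ed: "2 * e < 1 / real l"
      using le4 l1 by (simp add: field_simps)
    have "real l > 2 / \<gamma>" using L3 l by (simp add: L_def)
    then have "2 / real l < \<gamma>" using \<gamma> l1 by (simp add: field_simps)
    then have g: "1 / real l + 2 * e < \<gamma>" using ed by (simp add: field_simps)
    have dl: "1 / real l > 0" using l1 by simp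
    have g2: "2 * e < \<gamma>" using g dl by linarith
    have "\<forall>j\<in>{..<J}. \<exists>b0. b0 < J \<and> (\<forall>m<l. \<bar>hmean m b0 - lam j m\<bar> \<le> e) \<and>
        (\<forall>b<J. \<bar>loading l (c j) b - of_bool (b = b0)\<bar> \<le> e)"
    proof
      fix j assume "j \<in> {..<J}"
      then have j: "j < J" by simp
      from single[of l T \<epsilon> "c j" "lam j" \<eta>, OF _ T \<epsilon>] show "\<exists>b0. b0 < J \<and> (\<forall>m<l. \<bar>hmean m b0 - lam j m\<bar> \<le> e) \<and>
        (\<forall>b<J. \<bar>loading l (c j) b - of_bool (b = b0)\<bar> \<le> e)"
        using l c lam res j e1 unfolding e_def L_def by auto
    qed
    from bchoice[OF this] obtain g where gJ: "\<And>j. j < J \<Longrightarrow> g j < J"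
      and glam: "\<And>j m. j < J \<Longrightarrow> m < l \<Longrightarrow> \<bar>hmean m (g j) - lam j m\<bar> \<le> e"
      and gload: "\<And>j b. j < J \<Longrightarrow> b < J \<Longrightarrow> \<bar>loading l (c j) b - of_bool (b = g j)\<bar> \<le> e"
      by auto
    have "lex_less (g i) (g j)" if ij: "i < j" "j < J" for i j
    proof (rule ccontr)
      assume not_less: "\<not> lex_less (g i) (g j)"
      have iJ: "i < J" using ij by simp
      obtain m where m: "m < l" "lam j m > lam i m + 1 / real l" "\<And>m'. m' < m \<Longrightarrow> lam i m' \<le> lam j m' + 1 / real l"
        using ord ij unfolding lex_below_def by blast
      have neq: "hmean m (g i) \<noteq> hmean m (g j)"
        using glam[OF iJ m(1)] glam[OF ij(2) m(1)] m(2) ed by linarith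
      then have "g i \<noteq> g j" by auto
      then have "lex_less (g j) (g i)" using lex_less_total[OF gJ[OF iJ] gJ[OF ij(2)]] not_less by auto
      from gap[OF gJ[OF ij(2)] gJ[OF iJ] this] obtain k where
        k: "k < L2" "hmean k (g j) + \<gamma> \<le> hmean k (g i)" "\<forall>m'<k. hmean m' (g j) = hmean m' (g i)" by blast
      have kl: "k < l" using k l by (simp add: L_def)
      \<comment> \<open>The true means of the two states differ at m, and k is the first index at
        which they differ.\<close>
      have "k \<le> m"
      proof (rule ccontr)
        assume "\<not> k \<le> m"
        then have "hmean m (g j) = hmean m (g i)" using k(3) by simp
        with neq show False by simp
      qed
      then consider "k = m" | "k < m" by linarith
      then show False
      proof cases
        case 1
        then have "hmean m (g j) + \<gamma> \<le> hmean m (g i)" using k(2) by simp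
        then show False using glam[OF iJ m(1)] glam[OF ij(2) m(1)] m(2) g2 dl by linarith
      next
        case 2
        then show False using m(3)[OF 2] k(2) glam[OF iJ kl] glam[OF ij(2) kl] g by linarith
      qed
    qed
    then have "g i = \<tau> i" if "i < J" for i using gJ that by (intro uniq) auto
    then show ?thesis using gload by (auto simp: e_def)
  qed
  show thesis
  proof (rule that[of \<tau> "1 / (4 * C)" C L])
    show "1 / (4 * C) > 0" using C by simp
    show "bij_betw \<tau> {..<J} {..<J}" using t by (rule conjunct1)
    show "lex_less (\<tau> i) (\<tau> j)" if "i < j" "j < J" for i j
      using t[THEN conjunct2, THEN conjunct2] that by blast
    show "\<bar>loading l (c j) b - of_bool (b = \<tau> j)\<bar> \<le> C * (\<eta> + 2 * real l * \<epsilon>)"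
      if "L \<le> l" "\<forall>i<l. \<forall>m<l. \<forall>n<l. \<bar>T i m n - moment i m n\<bar> \<le> \<epsilon>" "0 \<le> \<epsilon>"
        "\<forall>j<J. (\<Sum>i<l. \<bar>c j i\<bar>) \<le> real l" "\<forall>j<J. \<forall>m<l. 0 \<le> lam j m \<and> lam j m \<le> 1"
        "\<forall>i j. i < j \<longrightarrow> j < J \<longrightarrow> lex_below l (1 / real l) (lam i) (lam j)"
        "\<forall>j<J. residual l T (c j) (lam j) \<le> \<eta>" "real l * (\<eta> + 2 * real l * \<epsilon>) \<le> 1 / (4 * C)"
        "j < J" "b < J" for l T c lam \<epsilon> \<eta> j b
      using main[OF that(1-8)] that(9,10) by blast
  qed (rule C)
qed

end

subsection \<open>The estimator\<close>

text \<open>A finite search set makes the minimiser exist and be measurable. The spacing 1/N costs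
  less than the rate, and the range from -N to N eventually contains any fixed coefficients.\<close>

definition coef_grid :: "nat \<Rightarrow> real set" where
  "coef_grid N = (\<lambda>z. real_of_int z / real N) ` {- int (N * N)..int (N * N)}"

definition unit_grid :: "nat \<Rightarrow> real set" where
  "unit_grid N = (\<lambda>z. real z / real N) ` {..N}"

text \<open>The constraints involve only l: it bounds the l1 norm of the coefficients, and the
  margin 1/l makes well-fitted rows belong to different states. Extensional tables over J times l
  keep the set finite.\<close>

definition candidates :: "nat \<Rightarrow> nat \<Rightarrow> nat \<Rightarrow> ((nat \<times> nat \<Rightarrow> real) \<times> (nat \<times> nat \<Rightarrow> real)) set" where
  "candidates J l N = {\<theta> \<in> PiE ({..<J} \<times> {..<l}) (\<lambda>_. coef_grid N) \<times> PiE ({..<J} \<times> {..<l}) (\<lambda>_. unit_grid N).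
     (\<forall>j<J. (\<Sum>i<l. \<bar>fst \<theta> (j, i)\<bar>) \<le> real l) \<and>
     (\<forall>i j. i < j \<longrightarrow> j < J \<longrightarrow> lex_below l (1 / real l) (\<lambda>m. snd \<theta> (i, m)) (\<lambda>m. snd \<theta> (j, m)))}"

definition total_residual :: "nat \<Rightarrow> nat \<Rightarrow> (nat \<Rightarrow> nat \<Rightarrow> nat \<Rightarrow> real) \<Rightarrow>
    (nat \<times> nat \<Rightarrow> real) \<times> (nat \<times> nat \<Rightarrow> real) \<Rightarrow> real" where
  "total_residual J l T \<theta> = (\<Sum>j<J. residual l T (\<lambda>i. fst \<theta> (j, i)) (\<lambda>m. snd \<theta> (j, m)))"

text \<open>The whole set of minimisers: as a function of the data it takes finitely many values, so
  selecting an element of it by \<open>SOME\<close> preserves measurability.\<close>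

definition best_candidates :: "nat \<Rightarrow> nat \<Rightarrow> nat \<Rightarrow> (nat \<Rightarrow> nat \<Rightarrow> nat \<Rightarrow> real) \<Rightarrow>
    ((nat \<times> nat \<Rightarrow> real) \<times> (nat \<times> nat \<Rightarrow> real)) set" where
  "best_candidates J l N T = {\<theta> \<in> candidates J l N.
     \<forall>\<theta>'\<in>candidates J l N. total_residual J l T \<theta> \<le> total_residual J l T \<theta>'}"

lemma finite_candidates: "finite (candidates J l N)"
  unfolding candidates_def
  by (intro finite_subset[OF Collect_subset] finite_cartesian_product finite_PiE)
    (auto simp: coef_grid_def unit_grid_def)

lemma best_candidates_nonempty:
  assumes "candidates J l N \<noteq> {}"
  shows "best_candidates J l N T \<noteq> {}"
proof -
  let ?S = "total_residual J l T ` candidates J l N"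
  have fin: "finite ?S" "?S \<noteq> {}" using finite_candidates assms by auto
  from Min_in[OF this] obtain \<theta> where \<theta>: "\<theta> \<in> candidates J l N" "Min ?S = total_residual J l T \<theta>" by auto
  have "\<theta> \<in> best_candidates J l N T"
    unfolding best_candidates_def using \<theta> Min_le[OF fin(1)] by (auto simp flip: \<theta>(2))
  then show ?thesis by blast
qed

lemma residual_nonneg: "residual l T c lam \<ge> 0"
  unfolding residual_def by (intro add_nonneg_nonneg sum_nonneg) auto

lemma residual_le_total:
  "j < J \<Longrightarrow> residual l T (\<lambda>i. fst \<theta> (j, i)) (\<lambda>m. snd \<theta> (j, m)) \<le> total_residual J l T \<theta>"
  unfolding total_residual_def
  by (intro member_le_sum[of j _ "\<lambda>j. residual l T (\<lambda>i. fst \<theta> (j, i)) (\<lambda>m. snd \<theta> (j, m))"])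
    (auto simp: residual_nonneg)

lemma unit_grid_bounds: "r \<in> unit_grid N \<Longrightarrow> 0 \<le> r \<and> r \<le> 1"
  unfolding unit_grid_def by (auto simp: divide_le_eq_1)

lemma coef_grid_approx:
  assumes "\<bar>r\<bar> \<le> real N - 1" "N \<ge> 1"
  shows "\<exists>q\<in>coef_grid N. \<bar>q - r\<bar> \<le> 1 / real N"
proof -
  define z where "z = \<lfloor>r * N\<rfloor>"
  have fl: "real_of_int z \<le> r * N" "r * N < real_of_int z + 1" unfolding z_def by linarith+
  have "\<bar>r * N\<bar> \<le> (real N - 1) * N" using assms by (simp add: abs_mult mult_right_mono)
  \<comment> \<open>Rounding down moves by less than 1, so the bound N^2 - 1 keeps z within the
    grid.\<close>
  also have "\<dots> \<le> real N * real N - 1" using assms by (simp add: algebra_simps)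
  finally have "\<bar>r * N\<bar> \<le> real N * real N - 1" .
  then have "\<bar>real_of_int z\<bar> \<le> real N * real N" using fl by linarith
  then have "\<bar>real_of_int z\<bar> \<le> real_of_int (int (N * N))" by simp
  then have "\<bar>z\<bar> \<le> int (N * N)" by linarith
  then have "real_of_int z / N \<in> coef_grid N"
    unfolding coef_grid_def by (intro image_eqI[of _ _ z]) (auto simp: abs_le_iff)
  moreover have "\<bar>real_of_int z / N - r\<bar> \<le> 1 / real N"
  proof -
    have "\<bar>real_of_int z - r * N\<bar> \<le> 1" using fl by linarith
    moreover have "real_of_int z / N - r = (real_of_int z - r * N) / N" using assms by (simp add: field_simps)
    ultimately show ?thesis using assms by (simp add: abs_divide divide_right_mono)
  qed
  ultimately show ?thesis by blast
qed

definition round_down :: "nat \<Rightarrow> real \<Rightarrow> real" where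
  "round_down N r = real (nat \<lfloor>r * N\<rfloor>) / real N"

lemma round_down:
  assumes "0 \<le> r" "r \<le> 1" "N \<ge> 1"
  shows "round_down N r \<in> unit_grid N" "round_down N r \<le> r" "r \<le> round_down N r + 1 / real N"
proof -
  have r: "0 \<le> r * N" "r * N \<le> real N" using assms by (auto simp: mult_left_le_one_le)
  then have "nat \<lfloor>r * N\<rfloor> \<le> N" by linarith
  then show "round_down N r \<in> unit_grid N" unfolding round_down_def unit_grid_def by auto
  have "real (nat \<lfloor>r * N\<rfloor>) \<le> r * N" "r * N \<le> real (nat \<lfloor>r * N\<rfloor>) + 1" using r by linarith+
  then show "round_down N r \<le> r" "r \<le> round_down N r + 1 / real N"
    using assms by (auto simp: round_down_def field_simps)
qed

context hmm
begin

text \<open>The candidate is the true solution rounded to the grid: the dual family of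
  \<open>before\<close> at \<tau> j makes the loadings the unit vector of \<tau> j, and lam consists
  of the means of that state. Before rounding its population residual is 0, so only moment errors
  and rounding remain.\<close>

lemma candidate_exists:
  assumes bij: "bij_betw \<tau> {..<J} {..<J}" and ord: "\<And>i j. i < j \<Longrightarrow> j < J \<Longrightarrow> lex_less (\<tau> i) (\<tau> j)"
  obtains L where "\<And>l N. L \<le> l \<Longrightarrow> l \<le> N \<Longrightarrow> \<exists>\<theta>\<in>candidates J l N. \<forall>T \<epsilon>.
     (\<forall>i<l. \<forall>m<l. \<forall>n<l. \<bar>T i m n - moment i m n\<bar> \<le> \<epsilon>) \<longrightarrow> 0 \<le> \<epsilon> \<longrightarrow>
     total_residual J l T \<theta> \<le> real J * (4 * real l ^ 3 * (\<epsilon> + 1 / real N))"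
proof -
  have \<tau>J: "\<tau> j < J" if "j < J" for j using bij that by (auto simp: bij_betw_def)
  obtain L1 d where d0: "\<And>j i. j < J \<Longrightarrow> i \<ge> L1 \<Longrightarrow> d j i = 0"
    and d1: "\<And>j b. j < J \<Longrightarrow> b < J \<Longrightarrow> (\<Sum>i<L1. d j i * before (halfline i) b) = (if j = b then 1 else (0::real))"
    using dual_family[where J = J and F = "\<lambda>b i. before (halfline i) b", OF before_independent] by blast
  obtain \<gamma> L2 where \<gamma>: "\<gamma> > 0" and gap: "\<And>a b. a < J \<Longrightarrow> b < J \<Longrightarrow> lex_less a b \<Longrightarrow>
     \<exists>m<L2. hmean m a + \<gamma> \<le> hmean m b \<and> (\<forall>m'<m. hmean m' a = hmean m' b)"
    by (rule lex_gap) (rule that)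
  define D where "D = (\<Sum>j<J. \<Sum>i<L1. \<bar>d j i\<bar>)"
  obtain L3 :: nat where L3: "2 / \<gamma> < L3" using reals_Archimedean2 by blast
  \<comment> \<open>Room for the dual coefficients and a rounding error of at most 1 in each of the
    first \<open>L1\<close> of them; the further 1 keeps them inside the range of the grid.\<close>
  obtain L4 :: nat where L4: "D + L1 + 1 < L4" using reals_Archimedean2 by blast
  show thesis
  proof (rule that[of "max 1 (max L1 (max L2 (max L3 L4)))"])
    fix l N assume l: "max 1 (max L1 (max L2 (max L3 L4))) \<le> l" and lN: "l \<le> N"
    have N1: "N \<ge> 1" and l1: "l \<ge> 1" using l lN by auto
    have dD: "(\<Sum>i<L1. \<bar>d j i\<bar>) \<le> D" if "j < J" for j
      unfolding D_def using that
      by (intro member_le_sum[of j _ "\<lambda>j. \<Sum>i<L1. \<bar>d j i\<bar>"]) (auto intro!: sum_nonneg)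
    have dN: "\<bar>d j i\<bar> \<le> real N - 1" if "j < J" for j i
    proof (cases "i < L1")
      case True
      then have "\<bar>d j i\<bar> \<le> (\<Sum>i<L1. \<bar>d j i\<bar>)" by (intro member_le_sum) auto
      then show ?thesis using dD[OF that] L4 l lN by simp
    next
      case False
      then show ?thesis using d0[OF that] N1 by simp
    qed
    define c where "c j i = (if i < L1 then (SOME q. q \<in> coef_grid N \<and> \<bar>q - d (\<tau> j) i\<bar> \<le> 1 / real N) else 0)" for j i
    have c: "c j i \<in> coef_grid N" "\<bar>c j i - d (\<tau> j) i\<bar> \<le> (if i < L1 then 1 / real N else 0)" if j: "j < J" for j i
    proof -
      have "\<exists>q. q \<in> coef_grid N \<and> \<bar>q - d (\<tau> j) i\<bar> \<le> 1 / real N"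
        using coef_grid_approx[OF dN[OF \<tau>J[OF j]] N1] by blast
      note some = someI_ex[OF this]
      have zero: "0 \<in> coef_grid N" unfolding coef_grid_def by (rule image_eqI[of _ _ 0]) auto
      show "c j i \<in> coef_grid N" using some zero by (simp add: c_def)
      show "\<bar>c j i - d (\<tau> j) i\<bar> \<le> (if i < L1 then 1 / real N else 0)" using some d0[OF \<tau>J[OF j]] by (auto simp: c_def)
    qed
    define lam where "lam j m = round_down N (hmean m (\<tau> j))" for j m
    have lam: "lam j m \<in> unit_grid N" "lam j m \<le> hmean m (\<tau> j)" "hmean m (\<tau> j) \<le> lam j m + 1 / real N" if "j < J" for j m
      unfolding lam_def using round_down[OF hmean_bounds(1,2)[OF \<tau>J[OF that]] N1] by auto
    have cd: "(\<Sum>i<l. \<bar>c j i - d (\<tau> j) i\<bar>) \<le> real l / real N" if j: "j < J" for j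
    proof -
      have "(\<Sum>i<l. \<bar>c j i - d (\<tau> j) i\<bar>) \<le> (\<Sum>i<l. 1 / real N)"
        by (intro sum_mono order_trans[OF c(2)[OF j]]) auto
      then show ?thesis by simp
    qed
    have c_norm: "(\<Sum>i<l. \<bar>c j i\<bar>) \<le> real l" if j: "j < J" for j
    proof -
      have "(\<Sum>i<l. \<bar>c j i\<bar>) = (\<Sum>i<L1. \<bar>c j i\<bar>)"
        using l by (intro sum.mono_neutral_right) (auto simp: c_def)
      also have "\<dots> \<le> (\<Sum>i<L1. \<bar>d (\<tau> j) i\<bar> + 1)"
      proof (rule sum_mono)
        fix i assume "i \<in> {..<L1}"
        moreover have "1 / real N \<le> 1" using N1 by simp
        ultimately show "\<bar>c j i\<bar> \<le> \<bar>d (\<tau> j) i\<bar> + 1" using c(2)[OF j, of i] by simp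
      qed
      also have "\<dots> \<le> D + L1" using dD[OF \<tau>J[OF j]] by (simp add: sum.distrib)
      finally show ?thesis using L4 l by simp
    qed
    have lex: "lex_below l (1 / real l) (lam i) (lam j)" if ij: "i < j" "j < J" for i j
    proof -
      have iJ: "i < J" using ij by simp
      obtain m where m: "m < L2" "hmean m (\<tau> i) + \<gamma> \<le> hmean m (\<tau> j)" "\<forall>m'<m. hmean m' (\<tau> i) = hmean m' (\<tau> j)"
        using gap[OF \<tau>J[OF iJ] \<tau>J[OF ij(2)] ord[OF ij]] by blast
      have "real l > 2 / \<gamma>" using L3 l by simp
      then have "2 / real l < \<gamma>" using \<gamma> l1 by (simp add: field_simps)
      moreover have "1 / real N \<le> 1 / real l" using lN l1 by (intro divide_left_mono) auto
      ultimately have "lam i m + 1 / real l < lam j m"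
        using lam(2)[OF iJ, of m] lam(3)[OF ij(2), of m] m(2) by linarith
      \<comment> \<open>Equal means are rounded to equal values, so ties before m survive.\<close>
      moreover have "lam i m' \<le> lam j m' + 1 / real l" if "m' < m" for m'
        using m(3) that by (simp add: lam_def)
      ultimately show ?thesis unfolding lex_below_def using m(1) l by (intro exI[of _ m]) auto
    qed
    define \<theta> where "\<theta> = (restrict (\<lambda>(j, i). c j i) ({..<J} \<times> {..<l}), restrict (\<lambda>(j, m). lam j m) ({..<J} \<times> {..<l}))"
    have \<theta>c: "fst \<theta> (j, i) = c j i" and \<theta>l: "snd \<theta> (j, i) = lam j i" if "j < J" "i < l" for j i
      using that by (auto simp: \<theta>_def)
    have residual_cong: "residual l T (\<lambda>i. fst \<theta> (j, i)) (\<lambda>m. snd \<theta> (j, m)) = residual l T (c j) (lam j)" if "j < J" for T j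
      unfolding residual_def using that by (simp add: \<theta>c \<theta>l)
    have \<theta>: "\<theta> \<in> candidates J l N"
      unfolding candidates_def
    proof (intro CollectI conjI allI impI)
      show "\<theta> \<in> PiE ({..<J} \<times> {..<l}) (\<lambda>_. coef_grid N) \<times> PiE ({..<J} \<times> {..<l}) (\<lambda>_. unit_grid N)"
        using c(1) lam(1) by (auto simp: \<theta>_def)
      show "(\<Sum>i<l. \<bar>fst \<theta> (j, i)\<bar>) \<le> real l" if "j < J" for j
        using c_norm[OF that] that by (simp add: \<theta>c)
      show "lex_below l (1 / real l) (\<lambda>m. snd \<theta> (i, m)) (\<lambda>m. snd \<theta> (j, m))" if "i < j" "j < J" for i j
      proof -
        from lex[OF that] obtain m where m: "m < l" "lam j m > lam i m + 1 / real l" "\<forall>m'<m. lam i m' \<le> lam j m' + 1 / real l"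
          unfolding lex_below_def by blast
        then show ?thesis
          unfolding lex_below_def using that by (intro exI[of _ m]) (auto simp: \<theta>l)
      qed
    qed
    have res: "residual l T (c j) (lam j) \<le> 4 * real l ^ 3 * (\<epsilon> + 1 / real N)"
      if T: "\<forall>i<l. \<forall>m<l. \<forall>n<l. \<bar>T i m n - moment i m n\<bar> \<le> \<epsilon>" and \<epsilon>: "0 \<le> \<epsilon>" and j: "j < J" for T \<epsilon> j
    proof -
      define e where "e = \<epsilon> + 1 / real N"
      have e0: "e \<ge> 0" using \<epsilon> by (simp add: e_def)
      have l0: "0 < l" using l1 by simp
      have loading: "loading l (d (\<tau> j)) b = (if \<tau> j = b then 1 else 0)" if "b < J" for b
      proof -
        have "loading l (d (\<tau> j)) b = (\<Sum>i<L1. d (\<tau> j) i * before (halfline i) b)"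
          unfolding loading_def using l d0[OF \<tau>J[OF j]] by (intro sum.mono_neutral_right) auto
        then show ?thesis using d1[OF \<tau>J[OF j] that] by simp
      qed
      have lamb: "0 \<le> lam j m" "lam j m \<le> 1" for m using unit_grid_bounds[OF lam(1)[OF j]] by auto
      have cd_sum: "\<bar>(\<Sum>i<l. c j i * a i) - (\<Sum>i<l. d (\<tau> j) i * a i)\<bar> \<le> real l / real N * M"
        if a: "\<And>i. \<bar>a i\<bar> \<le> M" for a :: "nat \<Rightarrow> real" and M
      proof -
        have "M \<ge> 0" using a[of 0] by linarith
        have "\<bar>(\<Sum>i<l. c j i * a i) - (\<Sum>i<l. d (\<tau> j) i * a i)\<bar> = \<bar>\<Sum>i<l. (c j i - d (\<tau> j) i) * a i\<bar>"
          by (simp add: sum_subtractf left_diff_distrib)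
        also have "\<dots> \<le> (\<Sum>i<l. \<bar>c j i - d (\<tau> j) i\<bar> * M)"
          by (rule order_trans[OF sum_abs]) (auto simp: abs_mult intro!: sum_mono mult_left_mono a)
        also have "\<dots> \<le> real l / real N * M"
          using cd[OF j] \<open>M \<ge> 0\<close> by (simp only: sum_distrib_right[symmetric]) (rule mult_right_mono)
        finally show ?thesis .
      qed
      have contrast: "\<bar>\<Sum>i<l. c j i * (T i m n - lam j m * T i 0 n)\<bar> \<le> 3 * real l * e" if m: "m < l" and n: "n < l" for m n
      proof -
        let ?a = "\<lambda>i. moment i m n - lam j m * moment i 0 n"
        have 1: "\<bar>(\<Sum>i<l. c j i * (T i m n - lam j m * T i 0 n)) - (\<Sum>i<l. c j i * ?a i)\<bar> \<le> real l * (2 * \<epsilon>)"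
        proof (rule weighted_sum_diff[OF c_norm[OF j]])
          fix i assume i: "i < l"
          have "\<bar>T i m n - moment i m n\<bar> \<le> \<epsilon>" "\<bar>T i 0 n - moment i 0 n\<bar> \<le> \<epsilon>"
            using T i m n l0 by auto
          moreover have "\<bar>lam j m * (T i 0 n - moment i 0 n)\<bar> \<le> 1 * \<epsilon>"
            unfolding abs_mult using lamb calculation(2) by (intro mult_mono) auto
          ultimately show "\<bar>(T i m n - lam j m * T i 0 n) - ?a i\<bar> \<le> 2 * \<epsilon>"
            by (simp add: right_diff_distrib abs_le_iff)
        qed (use \<epsilon> in simp)
        have 2: "\<bar>(\<Sum>i<l. c j i * ?a i) - (\<Sum>i<l. d (\<tau> j) i * ?a i)\<bar> \<le> real l / real N * 2"
        proof (rule cd_sum)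
          fix i
          have "\<bar>lam j m * moment i 0 n\<bar> \<le> 1 * 1"
            unfolding abs_mult using lamb moment_bounds by (intro mult_mono) auto
          then show "\<bar>?a i\<bar> \<le> 2" using moment_bounds[of i m n] by linarith
        qed
        have "(\<Sum>i<l. d (\<tau> j) i * ?a i) = (\<Sum>b<J. (loading l (d (\<tau> j)) b * (hmean m b - lam j m)) * after (halfline n) b)"
          by (rule contrast_contract)
        also have "\<dots> = (\<Sum>b<J. if b = \<tau> j then (hmean m b - lam j m) * after (halfline n) b else 0)"
          by (intro sum.cong) (auto simp: loading)
        also have "\<dots> = (hmean m (\<tau> j) - lam j m) * after (halfline n) (\<tau> j)"
          using \<tau>J[OF j] by simp
        finally have 3: "\<bar>\<Sum>i<l. d (\<tau> j) i * ?a i\<bar> \<le> 1 / real N * 1"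
          using lam(2,3)[OF j, of m] after_bounds(1,2)[OF \<tau>J[OF j], of n]
          by (simp only: abs_mult) (intro mult_mono, auto)
        have N_le: "1 / real N * 1 \<le> real l / real N" using l1 by (simp add: divide_right_mono)
        have tri: "\<bar>x\<bar> \<le> A + B + C" if "\<bar>x - y\<bar> \<le> A" "\<bar>y - z\<bar> \<le> B" "\<bar>z\<bar> \<le> C" for x y z A B C :: real
          using that by linarith
        have aux: "a + t * 2 + g * 1 \<le> a + t * 3" if "g * 1 \<le> t" for a t g :: real
          using that by linarith
        note aux[OF N_le, of "real l * (2 * \<epsilon>)"]
        with tri[OF 1 2 3] have "\<bar>\<Sum>i<l. c j i * (T i m n - lam j m * T i 0 n)\<bar> \<le> real l * (2 * \<epsilon>) + real l / real N * 3"
          by (rule order_trans)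
        also have "\<dots> \<le> 3 * real l * e"
          using \<epsilon> by (simp add: e_def algebra_simps)
        finally show ?thesis .
      qed
      have last: "\<bar>(\<Sum>i<l. c j i * T i 0 0) - 1\<bar> \<le> real l * e"
      proof -
        have 1: "\<bar>(\<Sum>i<l. c j i * T i 0 0) - (\<Sum>i<l. c j i * moment i 0 0)\<bar> \<le> real l * \<epsilon>"
          using T l0 by (intro weighted_sum_diff[OF c_norm[OF j]]) (auto simp: \<epsilon>)
        have 2: "\<bar>(\<Sum>i<l. c j i * moment i 0 0) - (\<Sum>i<l. d (\<tau> j) i * moment i 0 0)\<bar> \<le> real l / real N * 1"
          by (rule cd_sum) (rule moment_bounds)
        have "(\<Sum>i<l. d (\<tau> j) i * moment i 0 0) = (\<Sum>b<J. if b = \<tau> j then 1 else 0)"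
          unfolding total_contract by (intro sum.cong) (auto simp: loading)
        also have "\<dots> = (1::real)" using \<tau>J[OF j] by simp
        finally have 3: "(\<Sum>i<l. d (\<tau> j) i * moment i 0 0) = 1" .
        show ?thesis using 1 2 unfolding 3 by (simp add: e_def algebra_simps)
      qed
      \<comment> \<open>There are l^2 contrasts of size at most 3 l e, and the normalisation adds l
        e.\<close>
      have "residual l T (c j) (lam j) \<le> (\<Sum>m<l. \<Sum>n<l. 3 * real l * e) + real l * e"
        unfolding residual_def using contrast last by (intro add_mono sum_mono) auto
      also have "\<dots> = 3 * real l ^ 3 * e + real l * e"
        by (simp add: power3_eq_cube)
      also have "\<dots> \<le> 4 * real l ^ 3 * e"
      proof -
        have "real l ^ 1 \<le> real l ^ 3" using l1 by (intro power_increasing) auto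
        then have "real l * e \<le> real l ^ 3 * e" using e0 by (intro mult_right_mono) auto
        then show ?thesis by (simp add: algebra_simps)
      qed
      finally show ?thesis unfolding e_def .
    qed
    show "\<exists>\<theta>\<in>candidates J l N. \<forall>T \<epsilon>.
     (\<forall>i<l. \<forall>m<l. \<forall>n<l. \<bar>T i m n - moment i m n\<bar> \<le> \<epsilon>) \<longrightarrow> 0 \<le> \<epsilon> \<longrightarrow>
     total_residual J l T \<theta> \<le> real J * (4 * real l ^ 3 * (\<epsilon> + 1 / real N))"
    proof (intro bexI[OF _ \<theta>] allI impI)
      fix T \<epsilon> assume T: "\<forall>i<l. \<forall>m<l. \<forall>n<l. \<bar>T i m n - moment i m n\<bar> \<le> \<epsilon>" "0 \<le> \<epsilon>"
      have "total_residual J l T \<theta> \<le> (\<Sum>j<J. 4 * real l ^ 3 * (\<epsilon> + 1 / real N))"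
        unfolding total_residual_def using res[OF T] by (intro sum_mono) (auto simp: residual_cong)
      then show "total_residual J l T \<theta> \<le> real J * (4 * real l ^ 3 * (\<epsilon> + 1 / real N))" by simp
    qed
  qed
qed

text \<open>For a functional v of the states, the fitted coefficients recover
  \<open>v (\<tau> j)\<close> from estimates \<open>vh i\<close> of its sums against
  \<open>before\<close>. The error splits into that of \<open>vh\<close>, weighted by l, and that of
  the loadings. The bound is deterministic, for any T within \<epsilon> of the moments, however
  large \<epsilon> is.\<close>

lemma plug_in_stability:
  obtains \<tau> C L where "bij_betw \<tau> {..<J} {..<J}" "C \<ge> 0"
    "\<And>l N T \<epsilon> \<theta> j v vh M. L \<le> l \<Longrightarrow> l \<le> N \<Longrightarrow>
      \<forall>i<l. \<forall>m<l. \<forall>n<l. \<bar>T i m n - moment i m n\<bar> \<le> \<epsilon> \<Longrightarrow> 0 \<le> \<epsilon> \<Longrightarrow>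
      \<theta> \<in> best_candidates J l N T \<Longrightarrow> j < J \<Longrightarrow> \<forall>b<J. \<bar>v b\<bar> \<le> M \<Longrightarrow>
      \<bar>(\<Sum>i<l. fst \<theta> (j, i) * vh i) - v (\<tau> j)\<bar> \<le>
        real l * (\<Sum>i<l. \<bar>vh i - (\<Sum>b<J. before (halfline i) b * v b)\<bar>) + C * M * (real l ^ 5 * (\<epsilon> + 1 / real N))"
    "\<And>l N. L \<le> l \<Longrightarrow> l \<le> N \<Longrightarrow> candidates J l N \<noteq> {}"
proof -
  obtain \<tau> \<kappa> C1 L1 where bij: "bij_betw \<tau> {..<J} {..<J}"
    and ord: "\<And>i j. i < j \<Longrightarrow> j < J \<Longrightarrow> lex_less (\<tau> i) (\<tau> j)"
    and \<kappa>: "\<kappa> > 0" and C1: "C1 > 0" and stab: "\<And>l T c lam \<epsilon> \<eta> j b. L1 \<le> l \<Longrightarrow>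
     \<forall>i<l. \<forall>m<l. \<forall>n<l. \<bar>T i m n - moment i m n\<bar> \<le> \<epsilon> \<Longrightarrow> 0 \<le> \<epsilon> \<Longrightarrow>
     \<forall>j<J. (\<Sum>i<l. \<bar>c j i\<bar>) \<le> real l \<Longrightarrow> \<forall>j<J. \<forall>m<l. 0 \<le> lam j m \<and> lam j m \<le> 1 \<Longrightarrow>
     \<forall>i j. i < j \<longrightarrow> j < J \<longrightarrow> lex_below l (1 / real l) (lam i) (lam j) \<Longrightarrow>
     \<forall>j<J. residual l T (c j) (lam j) \<le> \<eta> \<Longrightarrow> real l * (\<eta> + 2 * real l * \<epsilon>) \<le> \<kappa> \<Longrightarrow>
     j < J \<Longrightarrow> b < J \<Longrightarrow> \<bar>loading l (c j) b - of_bool (b = \<tau> j)\<bar> \<le> C1 * (\<eta> + 2 * real l * \<epsilon>)"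
    by (rule ordered_states_stability) (rule that)
  have \<tau>J: "\<tau> j < J" if "j < J" for j using bij that by (auto simp: bij_betw_def)
  obtain L2 where cand: "\<And>l N. L2 \<le> l \<Longrightarrow> l \<le> N \<Longrightarrow> \<exists>\<theta>\<in>candidates J l N. \<forall>T \<epsilon>.
     (\<forall>i<l. \<forall>m<l. \<forall>n<l. \<bar>T i m n - moment i m n\<bar> \<le> \<epsilon>) \<longrightarrow> 0 \<le> \<epsilon> \<longrightarrow>
     total_residual J l T \<theta> \<le> real J * (4 * real l ^ 3 * (\<epsilon> + 1 / real N))"
    by (rule candidate_exists[OF bij], rule ord, assumption, assumption) (rule that)
  define C where "C = (real J * C1 + 2 / \<kappa>) * (4 * real J + 2)"
  show thesis
  proof (rule that[of \<tau> C "max 1 (max L1 L2)"])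
    show "bij_betw \<tau> {..<J} {..<J}" by (rule bij)
    show "C \<ge> 0" using C1 \<kappa> by (simp add: C_def)
    show "candidates J l N \<noteq> {}" if "max 1 (max L1 L2) \<le> l" "l \<le> N" for l N
      using cand[of l N] that by auto
    fix l N T \<epsilon> \<theta> j v vh M
    assume l: "max 1 (max L1 L2) \<le> l" and lN: "l \<le> N"
      and T: "\<forall>i<l. \<forall>m<l. \<forall>n<l. \<bar>T i m n - moment i m n\<bar> \<le> \<epsilon>" and \<epsilon>: "0 \<le> \<epsilon>"
      and \<theta>: "\<theta> \<in> best_candidates J l N T" and j: "j < J" and v: "\<forall>b<J. \<bar>v b\<bar> \<le> (M::real)"
    define e where "e = \<epsilon> + 1 / real N"
    have e0: "e \<ge> 0" "\<epsilon> \<le> e" using \<epsilon> by (auto simp: e_def)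
    have l1: "real l \<ge> 1" using l by simp
    have M0: "M \<ge> 0" using v j by force
    define \<eta> where "\<eta> = real J * (4 * real l ^ 3 * e)"
    define \<rho> where "\<rho> = \<eta> + 2 * real l * \<epsilon>"
    have \<rho>0: "\<rho> \<ge> 0" using e0 \<epsilon> by (simp add: \<rho>_def \<eta>_def)
    have \<theta>c: "\<theta> \<in> candidates J l N" using \<theta> by (simp add: best_candidates_def)
    obtain \<theta>' where "\<theta>' \<in> candidates J l N" "total_residual J l T \<theta>' \<le> \<eta>"
      using cand[of l N] l lN T \<epsilon> unfolding \<eta>_def e_def by auto
    then have tot: "total_residual J l T \<theta> \<le> \<eta>" using \<theta> unfolding best_candidates_def by force
    define c where "c j i = fst \<theta> (j, i)" for j i
    define lam where "lam j m = snd \<theta> (j, m)" for j m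
    have norm: "\<forall>j<J. (\<Sum>i<l. \<bar>c j i\<bar>) \<le> real l" using \<theta>c by (auto simp: candidates_def c_def)
    have unit: "\<forall>j<J. \<forall>m<l. 0 \<le> lam j m \<and> lam j m \<le> 1"
    proof (intro allI impI)
      fix j m assume "j < J" "m < l"
      then have "lam j m \<in> unit_grid N" using \<theta>c by (auto simp: candidates_def lam_def PiE_iff mem_Times_iff)
      then show "0 \<le> lam j m \<and> lam j m \<le> 1" by (rule unit_grid_bounds)
    qed
    have lex: "\<forall>i j. i < j \<longrightarrow> j < J \<longrightarrow> lex_below l (1 / real l) (lam i) (lam j)"
      using \<theta>c by (auto simp: candidates_def lam_def[abs_def])
    have res: "\<forall>j<J. residual l T (c j) (lam j) \<le> \<eta>"
      using residual_le_total[of _ J l T \<theta>] tot unfolding c_def[abs_def] lam_def[abs_def] by (meson order_trans)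
    \<comment> \<open>The minimal residual is at most that of the rounded true solution, which gives
      l^3; the factor l^2 below completes l^5.\<close>
    have \<rho>_le: "\<rho> \<le> (4 * real J + 2) * (real l ^ 3 * e)"
    proof -
      have "real l ^ 1 \<le> real l ^ 3" using l1 by (intro power_increasing) auto
      then have "real l * \<epsilon> \<le> real l ^ 3 * e" using e0 \<epsilon> by (intro mult_mono) auto
      then show ?thesis by (simp add: \<rho>_def \<eta>_def algebra_simps)
    qed
    have pop: "\<bar>(\<Sum>i<l. c j i * (\<Sum>b<J. before (halfline i) b * v b)) - v (\<tau> j)\<bar> \<le> (real J * C1 + 2 / \<kappa>) * M * (real l ^ 2 * \<rho>)"
    proof (cases "real l * \<rho> \<le> \<kappa>")
      case True
      have "(\<Sum>i<l. c j i * (\<Sum>b<J. before (halfline i) b * v b)) = (\<Sum>i<l. \<Sum>b<J. c j i * before (halfline i) b * v b)"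
        by (simp add: sum_distrib_left mult.assoc)
      also have "\<dots> = (\<Sum>b<J. \<Sum>i<l. c j i * before (halfline i) b * v b)" by (rule sum.swap)
      also have "\<dots> = (\<Sum>b<J. loading l (c j) b * v b)" by (simp add: loading_def sum_distrib_right)
      finally have eq: "(\<Sum>i<l. c j i * (\<Sum>b<J. before (halfline i) b * v b)) = (\<Sum>b<J. loading l (c j) b * v b)" .
      have "(\<Sum>b<J. of_bool (b = \<tau> j) * v b) = (\<Sum>b<J. if b = \<tau> j then v b else 0)"
        by (intro sum.cong) auto
      also have "\<dots> = v (\<tau> j)" using \<tau>J[OF j] by simp
      finally have "(\<Sum>b<J. loading l (c j) b * v b) - v (\<tau> j) = (\<Sum>b<J. (loading l (c j) b - of_bool (b = \<tau> j)) * v b)"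
        by (simp add: left_diff_distrib sum_subtractf)
      also have "\<bar>\<dots>\<bar> \<le> (\<Sum>b<J. (C1 * \<rho>) * M)"
      proof (rule order_trans[OF sum_abs], rule sum_mono)
        fix b assume "b \<in> {..<J}"
        then have b: "b < J" by simp
        have "\<bar>loading l (c j) b - of_bool (b = \<tau> j)\<bar> \<le> C1 * \<rho>"
          unfolding \<rho>_def using True l by (intro stab[OF _ T \<epsilon> norm unit lex res _ j b]) (auto simp: \<rho>_def)
        then show "\<bar>(loading l (c j) b - of_bool (b = \<tau> j)) * v b\<bar> \<le> C1 * \<rho> * M"
          unfolding abs_mult using v b C1 \<rho>0 by (intro mult_mono) auto
      qed
      finally have "\<bar>(\<Sum>b<J. loading l (c j) b * v b) - v (\<tau> j)\<bar> \<le> real J * C1 * M * (1 * \<rho>)" by (simp add: algebra_simps)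
      also have "\<dots> \<le> (real J * C1 + 2 / \<kappa>) * M * (real l ^ 2 * \<rho>)"
        using C1 \<kappa> M0 \<rho>0 l1 by (intro mult_mono) (auto simp: one_le_power)
      finally show ?thesis unfolding eq .
    next
      \<comment> \<open>The fit is too poor for the stability lemma. But then 1 < l \<rho> /
        \<kappa>, and multiplying the trivial bound 2 l M by this quotient brings it into the
        required form.\<close>
      case False
      have V: "\<bar>\<Sum>b<J. before (halfline i) b * v b\<bar> \<le> M" for i
      proof -
        have "\<bar>\<Sum>b<J. before (halfline i) b * v b\<bar> \<le> (\<Sum>b<J. before (halfline i) b * M)"
        proof (rule order_trans[OF sum_abs], rule sum_mono)
          fix b assume "b \<in> {..<J}"
          then show "\<bar>before (halfline i) b * v b\<bar> \<le> before (halfline i) b * M"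
            using before_bounds(1)[of b i] v by (auto simp: abs_mult intro!: mult_left_mono)
        qed
        also have "\<dots> \<le> 1 * M"
          using before_bounds(2)[of i] M0 by (simp only: sum_distrib_right[symmetric]) (rule mult_right_mono)
        finally show ?thesis by simp
      qed
      have "\<bar>\<Sum>i<l. c j i * (\<Sum>b<J. before (halfline i) b * v b)\<bar> \<le> (\<Sum>i<l. \<bar>c j i\<bar> * M)"
        by (rule order_trans[OF sum_abs]) (auto simp: abs_mult intro!: sum_mono mult_left_mono V)
      also have "\<dots> \<le> real l * M"
        using norm j M0 by (simp only: sum_distrib_right[symmetric]) (auto intro: mult_right_mono)
      finally have "\<bar>(\<Sum>i<l. c j i * (\<Sum>b<J. before (halfline i) b * v b)) - v (\<tau> j)\<bar> \<le> real l * M + 1 * M"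
        using v \<tau>J[OF j] by fastforce
      also have "\<dots> \<le> real l * M + real l * M" using l1 M0 by (intro add_left_mono mult_right_mono) auto
      also have "\<dots> = 2 * real l * M * 1" by simp
      also have "\<dots> \<le> 2 * real l * M * (real l * \<rho> / \<kappa>)"
        using False \<kappa> M0 by (intro mult_left_mono) auto
      also have "\<dots> = (2 / \<kappa>) * M * (real l ^ 2 * \<rho>)" by (simp add: power2_eq_square)
      also have "\<dots> \<le> (real J * C1 + 2 / \<kappa>) * M * (real l ^ 2 * \<rho>)"
        using C1 M0 \<rho>0 by (intro mult_right_mono) auto
      finally show ?thesis .
    qed
    also have "\<dots> \<le> (real J * C1 + 2 / \<kappa>) * M * (real l ^ 2 * ((4 * real J + 2) * (real l ^ 3 * e)))"
      using C1 M0 \<kappa> \<rho>_le by (intro mult_left_mono) auto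
    also have "\<dots> = C * M * (real l ^ 5 * e)"
      by (simp add: C_def power_numeral_reduce algebra_simps)
    finally have pop': "\<bar>(\<Sum>i<l. c j i * (\<Sum>b<J. before (halfline i) b * v b)) - v (\<tau> j)\<bar> \<le> C * M * (real l ^ 5 * e)" .
    have "\<bar>(\<Sum>i<l. c j i * vh i) - (\<Sum>i<l. c j i * (\<Sum>b<J. before (halfline i) b * v b))\<bar>
        = \<bar>\<Sum>i<l. c j i * (vh i - (\<Sum>b<J. before (halfline i) b * v b))\<bar>"
      by (simp add: right_diff_distrib sum_subtractf)
    also have "\<dots> \<le> (\<Sum>i<l. real l * \<bar>vh i - (\<Sum>b<J. before (halfline i) b * v b)\<bar>)"
    proof (rule order_trans[OF sum_abs], rule sum_mono)
      fix i assume "i \<in> {..<l}"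
      then have "\<bar>c j i\<bar> \<le> (\<Sum>i<l. \<bar>c j i\<bar>)" by (intro member_le_sum) auto
      then have "\<bar>c j i\<bar> \<le> real l" using norm j by (meson order_trans)
      then show "\<bar>c j i * (vh i - (\<Sum>b<J. before (halfline i) b * v b))\<bar> \<le> real l * \<bar>vh i - (\<Sum>b<J. before (halfline i) b * v b)\<bar>"
        unfolding abs_mult by (intro mult_right_mono) auto
    qed
    finally have samp: "\<bar>(\<Sum>i<l. c j i * vh i) - (\<Sum>i<l. c j i * (\<Sum>b<J. before (halfline i) b * v b))\<bar>
        \<le> real l * (\<Sum>i<l. \<bar>vh i - (\<Sum>b<J. before (halfline i) b * v b)\<bar>)" by (simp add: sum_distrib_left)
    have tri: "\<bar>x - z\<bar> \<le> A + B" if "\<bar>x - y\<bar> \<le> A" "\<bar>y - z\<bar> \<le> B" for x y z A B :: real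
      using that by linarith
    show "\<bar>(\<Sum>i<l. fst \<theta> (j, i) * vh i) - v (\<tau> j)\<bar> \<le>
        real l * (\<Sum>i<l. \<bar>vh i - (\<Sum>b<J. before (halfline i) b * v b)\<bar>) + C * M * (real l ^ 5 * (\<epsilon> + 1 / real N))"
      using tri[OF samp pop'] unfolding c_def e_def .
  qed
qed

end

section \<open>Bandwidth and rates\<close>

text \<open>Balances the bias h^s against the stochastic error sqrt (log N / (N h)); both become the
  rate.\<close>

definition bandwidth :: "real \<Rightarrow> nat \<Rightarrow> real" where
  "bandwidth s N = (ln (real N) / real N) powr (1 / (1 + 2 * s))"

lemma rate_asymptotics:
  assumes s: "s > 0"
  shows "eventually (\<lambda>N. N \<ge> 4 \<and> ln (real N) \<ge> 1 \<and> 0 < bandwidth s N \<and> bandwidth s N \<le> 1 \<and> 0 < rate s N \<and>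
     bandwidth s N powr s = rate s N \<and> 4 * ln (real N) \<le> real (N div 3) * bandwidth s N \<and>
     sqrt (ln (real N) / (real (N div 3) * bandwidth s N)) \<le> 3 * rate s N \<and>
     ln (real N) ^ 8 / sqrt (real (N div 3)) \<le> rate s N \<and> ln (real N) ^ 5 / real N \<le> rate s N) sequentially"
proof -
  define a where "a = s / (1 + 2 * s)"
  define b where "b = 1 / (1 + 2 * s)"
  have a: "0 < a" "a < 1/2" using s by (auto simp: a_def field_simps)
  have b: "0 < b" "b * s = a" "1 - b = 2 * a" using s by (auto simp: a_def b_def field_simps)
  \<comment> \<open>The distance of the exponent of the rate from 1/2: this power of N absorbs the
    logarithms that multiply the parametric error.\<close>
  define c where "c = 1/2 - a"
  have c: "c > 0" using a by (simp add: c_def)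
  have "((\<lambda>x::real. 3 * ln x ^ 8 / x powr c) \<longlongrightarrow> 0) at_top" using c by real_asymp
  then have "((\<lambda>N. 3 * ln (real N) ^ 8 / real N powr c) \<longlongrightarrow> 0) sequentially"
    by (rule filterlim_compose[OF _ filterlim_real_sequentially])
  then have e1: "eventually (\<lambda>N. 3 * ln (real N) ^ 8 / real N powr c < 1) sequentially"
    by (rule order_tendstoD) simp
  have "((\<lambda>x::real. (ln x / x) powr a) \<longlongrightarrow> 0) at_top" using a by real_asymp
  then have "((\<lambda>N. (ln (real N) / real N) powr a) \<longlongrightarrow> 0) sequentially"
    by (rule filterlim_compose[OF _ filterlim_real_sequentially])
  \<comment> \<open>1/5 ensures 6 r^2 \<le> 1/4, where the factor 6 stems from N div 3 \<ge> N /
    6.\<close>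
  then have e2: "eventually (\<lambda>N. (ln (real N) / real N) powr a < 1/5) sequentially"
    by (rule order_tendstoD) simp
  have e3: "eventually (\<lambda>N. ln (real N) \<ge> 1) sequentially" by real_asymp
  show ?thesis
    using e1 e2 e3 eventually_ge_at_top[of 4]
  proof eventually_elim
    case (elim N)
    let ?q = "ln (real N) / real N" and ?n = "real (N div 3)" and ?h = "bandwidth s N" and ?r = "rate s N"
    have N: "real N \<ge> 4" using elim by simp
    have lnp: "ln (real N) > 0" using elim by simp
    have q: "?q > 0" using elim N by (intro divide_pos_pos) auto
    have q1: "?q \<le> 1" using N ln_le_minus_one[of "real N"] by (simp add: divide_le_eq)
    have r: "?r = ?q powr a"
    proof -
      have "?r = (inverse ?q) powr (- a)" by (simp add: rate_def a_def)
      also have "\<dots> = ?q powr a" using q by (simp add: powr_minus inverse_powr del: inverse_divide inverse_eq_divide)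
      finally show ?thesis .
    qed
    have h: "?h = ?q powr b" by (simp add: bandwidth_def b_def)
    have h0: "?h > 0" using q lnp N by (simp add: h)
    have r0: "?r > 0" using q lnp N by (simp add: r)
    have n: "?n \<ge> real N / 6"
    proof -
      have "N \<le> 3 * (N div 3) + 2" by presburger
      then have "real N \<le> 3 * ?n + 2" by linarith
      then show ?thesis using N by linarith
    qed
    have n0: "?n > 0" using n N by linarith
    have quot: "ln (real N) / (?n * ?h) \<le> 6 * ?r\<^sup>2"
    proof -
      have "ln (real N) / (?n * ?h) \<le> ln (real N) / (real N / 6 * ?h)"
        using n n0 N h0 elim by (intro divide_left_mono mult_right_mono mult_pos_pos) auto
      also have "\<dots> = 6 * (?q / ?h)" by simp
      also have "?q / ?h = ?q powr (1 - b)" using q lnp N by (simp add: h powr_diff)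
      also have "\<dots> = ?r\<^sup>2" using q by (simp add: b(3) r power2_eq_square powr_add[symmetric])
      finally show ?thesis .
    qed
    have "?r \<le> 1/5" using elim by (simp add: r)
    then have "?r\<^sup>2 \<le> (1/5)\<^sup>2" using r0 by (intro power_mono) auto
    then have "ln (real N) / (?n * ?h) \<le> 1/4" using quot by (simp add: power2_eq_square)
    then have 4: "4 * ln (real N) \<le> ?n * ?h" using n0 h0 by (simp add: divide_le_eq)
    have "sqrt (ln (real N) / (?n * ?h)) \<le> sqrt (9 * ?r\<^sup>2)"
      using quot by (intro real_sqrt_le_mono) (use zero_le_power2[of ?r] in linarith)
    then have 5: "sqrt (ln (real N) / (?n * ?h)) \<le> 3 * ?r" using r0 by (simp add: real_sqrt_mult)
    have rN: "real N powr (- a) \<le> ?r"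
    proof -
      have "1 / real N \<le> ?q" using elim N by (intro divide_right_mono) auto
      then have "(1 / real N) powr a \<le> ?q powr a" using a N by (intro powr_mono2) auto
      then show ?thesis using N by (simp add: r powr_divide powr_minus_divide)
    qed
    have 3: "3 * ln (real N) ^ 8 \<le> real N powr c" using elim N by (simp add: divide_less_eq)
    have sq: "sqrt ?n \<ge> real N powr (1/2) / 3"
    proof -
      have "real N powr (1/2) / 3 = sqrt (real N / 9)" using N by (simp add: powr_half_sqrt real_sqrt_divide)
      also have "\<dots> \<le> sqrt ?n" using n N by (intro real_sqrt_le_mono) linarith
      finally show ?thesis .
    qed
    have 6: "ln (real N) ^ 8 / sqrt ?n \<le> ?r"
    proof -
      have "ln (real N) ^ 8 / sqrt ?n \<le> ln (real N) ^ 8 / (real N powr (1/2) / 3)"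
        using sq N elim n0 by (intro divide_left_mono mult_pos_pos) auto
      also have "\<dots> = 3 * ln (real N) ^ 8 / real N powr (1/2)" by simp
      also have "\<dots> \<le> real N powr c / real N powr (1/2)" using 3 by (intro divide_right_mono) auto
      also have "\<dots> = real N powr (- a)" using N by (simp add: powr_diff[symmetric] c_def)
      finally show ?thesis using rN by simp
    qed
    have 7: "ln (real N) ^ 5 / real N \<le> ?r"
    proof -
      have "ln (real N) ^ 5 \<le> ln (real N) ^ 8" using elim by (intro power_increasing) auto
      moreover have "sqrt ?n \<le> real N"
      proof -
        have "?n \<le> real N" by simp
        also have "\<dots> \<le> (real N)\<^sup>2" using N by (simp add: power2_eq_square)
        finally show ?thesis by (simp add: real_le_lsqrt)
      qed
      ultimately have "ln (real N) ^ 5 / real N \<le> ln (real N) ^ 8 / sqrt ?n"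
        using n0 elim by (intro frac_le) auto
      then show ?thesis using 6 by simp
    qed
    have hs: "?h powr s = ?r" using q by (simp add: h r powr_powr b(2))
    have h1: "?h \<le> 1" unfolding h using q q1 b by (intro powr_le1) auto
    show ?case using elim h0 h1 r0 hs 4 5 6 7 by auto
  qed
qed

section \<open>The fitted estimator and its error\<close>

text \<open>The cap by the logarithm keeps l^8 / sqrt n below the rate however fast L0 grows: l^5
  comes from the plug-in bound and l^3 from summing over all triples of half-lines.\<close>

definition grid_size :: "(nat \<Rightarrow> real) \<Rightarrow> nat \<Rightarrow> nat" where
  "grid_size L0 N = nat \<lfloor>min (L0 N) (ln (real N))\<rfloor>"

definition emp_moment :: "nat \<Rightarrow> (nat \<Rightarrow> real) \<Rightarrow> nat \<Rightarrow> nat \<Rightarrow> nat \<Rightarrow> real" where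
  "emp_moment N X i m n = (\<Sum>t<N div 3. block (halfline i) (halfline m) (halfline n) t X) / real (N div 3)"

text \<open>K / R is bounded by 1, as the deviation bounds require, and R / h restores the scale of
  a kernel estimate; the constant 1 drops the third observation of each block.\<close>

definition emp_kernel :: "(real \<Rightarrow> real) \<Rightarrow> real \<Rightarrow> real \<Rightarrow> nat \<Rightarrow> (nat \<Rightarrow> real) \<Rightarrow> nat \<Rightarrow> real \<Rightarrow> real" where
  "emp_kernel K R h N X i x =
     R / h * ((\<Sum>t<N div 3. block (halfline i) (\<lambda>y. K ((x - y) / h) / R) (\<lambda>_. 1) t X) / real (N div 3))"

text \<open>If there is no candidate the choice is arbitrary but fixed; this ceases once l and N are
  large.\<close>

definition fitted :: "nat \<Rightarrow> nat \<Rightarrow> nat \<Rightarrow> (nat \<Rightarrow> real) \<Rightarrow> (nat \<times> nat \<Rightarrow> real) \<times> (nat \<times> nat \<Rightarrow> real)" where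
  "fitted J l N X = (SOME \<theta>. \<theta> \<in> best_candidates J l N (emp_moment N X))"

definition estimator :: "nat \<Rightarrow> real \<Rightarrow> (nat \<Rightarrow> real) \<Rightarrow> (real \<Rightarrow> real) \<Rightarrow> real \<Rightarrow>
    nat \<Rightarrow> (nat \<Rightarrow> real) \<Rightarrow> nat \<Rightarrow> real \<Rightarrow> real" where
  "estimator J s L0 K R N X j x =
     (\<Sum>i<grid_size L0 N. fst (fitted J (grid_size L0 N) N X) (j, i) * emp_kernel K R (bandwidth s N) N X i x)"

lemma emp_moment_measurable: "(\<lambda>X. emp_moment N X i m n) \<in> borel_measurable (PiM {..<N} (\<lambda>_. lborel))"
proof -
  have "(\<lambda>X. \<Sum>t<N div 3. block (halfline i) (halfline m) (halfline n) t X) \<in> borel_measurable (PiM {..<N} (\<lambda>_. lborel))"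
    by (intro borel_measurable_sum block_measurable_PiM halfline_measurable) auto
  then show ?thesis unfolding emp_moment_def by measurable
qed

lemma emp_kernel_measurable:
  assumes "K \<in> borel_measurable borel"
  shows "(\<lambda>X. emp_kernel K R h N X i x) \<in> borel_measurable (PiM {..<N} (\<lambda>_. lborel))"
proof -
  have [measurable]: "(\<lambda>y. K ((x - y) / h) / R) \<in> borel_measurable borel" using assms by measurable
  have "(\<lambda>X. \<Sum>t<N div 3. block (halfline i) (\<lambda>y. K ((x - y) / h) / R) (\<lambda>_. 1) t X) \<in> borel_measurable (PiM {..<N} (\<lambda>_. lborel))"
    by (intro borel_measurable_sum block_measurable_PiM) auto
  then show ?thesis unfolding emp_kernel_def by measurable
qed

lemma total_residual_measurable:
  "(\<lambda>X. total_residual J l (emp_moment N X) \<theta>) \<in> borel_measurable (PiM {..<N} (\<lambda>_. lborel))"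
  unfolding total_residual_def residual_def
  by (intro borel_measurable_sum borel_measurable_add borel_measurable_abs borel_measurable_diff
      borel_measurable_times borel_measurable_const emp_moment_measurable)

text \<open>The set of minimisers equals A exactly when finitely many comparisons of measurable
  residuals turn out as A prescribes.\<close>

lemma best_candidates_measurable:
  "(\<lambda>X. best_candidates J l N (emp_moment N X))
     \<in> PiM {..<N} (\<lambda>_. lborel) \<rightarrow>\<^sub>M count_space (Pow (candidates J l N))"
proof -
  let ?M = "PiM {..<N} (\<lambda>_. lborel :: real measure)"
  let ?b = "\<lambda>X. best_candidates J l N (emp_moment N X)"
  have "?b -` {A} \<inter> space ?M \<in> sets ?M" if A: "A \<subseteq> candidates J l N" for A
  proof -
    have "?b -` {A} \<inter> space ?M = {X \<in> space ?M. \<forall>\<theta>\<in>candidates J l N. (\<theta> \<in> A) =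
        (\<forall>\<theta>'\<in>candidates J l N. total_residual J l (emp_moment N X) \<theta> \<le> total_residual J l (emp_moment N X) \<theta>')}"
      using A unfolding best_candidates_def by blast
    also have "\<dots> \<in> sets ?M"
    proof (rule sets.sets_Collect_finite_All[OF _ finite_candidates])
      fix \<theta> assume "\<theta> \<in> candidates J l N"
      have *: "{X \<in> space ?M. \<forall>\<theta>'\<in>candidates J l N. total_residual J l (emp_moment N X) \<theta> \<le> total_residual J l (emp_moment N X) \<theta>'} \<in> sets ?M"
        by (rule sets.sets_Collect_finite_All[OF _ finite_candidates])
          (intro borel_measurable_le total_residual_measurable)
      show "{X \<in> space ?M. (\<theta> \<in> A) = (\<forall>\<theta>'\<in>candidates J l N. total_residual J l (emp_moment N X) \<theta> \<le> total_residual J l (emp_moment N X) \<theta>')} \<in> sets ?M"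
        using * sets.sets_Collect_neg[OF *] by (cases "\<theta> \<in> A") simp_all
    qed
    finally show ?thesis .
  qed
  then show ?thesis
    by (subst measurable_count_space_eq2) (auto simp: finite_candidates best_candidates_def)
qed

lemma valid_estimator_estimator:
  assumes K: "continuous_on UNIV K"
  shows "valid_estimator J (estimator J s L0 K R)"
  unfolding valid_estimator_def
proof (intro conjI allI impI)
  fix N X j
  have "continuous_on UNIV (\<lambda>x. K ((x - a) * c))" for a c
    by (rule continuous_on_compose2[OF K]) (auto intro!: continuous_intros)
  then show "continuous_on UNIV (estimator J s L0 K R N X j)"
    unfolding estimator_def[abs_def] emp_kernel_def block_def divide_inverse
    by (intro continuous_intros) auto
next
  fix N j x
  let ?M = "PiM {..<N} (\<lambda>_. lborel :: real measure)" and ?l = "grid_size L0 N"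
  have Km: "K \<in> borel_measurable borel" by (rule borel_measurable_continuous_onI[OF K])
  \<comment> \<open>The estimator is written as a function of the set of minimisers and of X
    separately: for each of the finitely many values of the set it is a fixed linear combination of
    kernel averages.\<close>
  have "(\<lambda>X. (\<lambda>A X. \<Sum>i<?l. fst (SOME \<theta>. \<theta> \<in> A) (j, i) * emp_kernel K R (bandwidth s N) N X i x)
      (best_candidates J ?l N (emp_moment N X)) X) \<in> borel_measurable ?M"
  proof (rule measurable_compose_countable'[where I = "Pow (candidates J ?l N)"
      and g = "\<lambda>X. best_candidates J ?l N (emp_moment N X)"
      and f = "\<lambda>A X. \<Sum>i<?l. fst (SOME \<theta>. \<theta> \<in> A) (j, i) * emp_kernel K R (bandwidth s N) N X i x"])
    show "(\<lambda>X. best_candidates J ?l N (emp_moment N X)) \<in> ?M \<rightarrow>\<^sub>M count_space (Pow (candidates J ?l N))"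
      by (rule best_candidates_measurable)
    show "(\<lambda>X. \<Sum>i<?l. fst (SOME \<theta>. \<theta> \<in> A) (j, i) * emp_kernel K R (bandwidth s N) N X i x) \<in> borel_measurable ?M" for A
      by (intro borel_measurable_sum borel_measurable_times borel_measurable_const emp_kernel_measurable Km)
    show "countable (Pow (candidates J ?l N))"
      by (intro countable_finite finite_Pow_iff[THEN iffD2] finite_candidates)
  qed
  then show "(\<lambda>X. estimator J s L0 K R N X j x) \<in> borel_measurable ?M"
    by (simp add: estimator_def fitted_def)
qed

context hmm
begin

text \<open>Besides one bias constant for all states, this yields a bound on the densities:
  \<open>holder_space\<close> bounds only the derivative of order floor s, but the smoothing of f
  with bandwidth 1 is at most R and differs from f by at most C.\<close>

lemma smoothing_bias:
  assumes R: "R \<ge> 1" and K: "\<And>u. \<bar>K u\<bar> \<le> R" and Km: "K \<in> borel_measurable borel"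
    and bias: "\<forall>f\<in>holder_space s. integrable lborel f \<longrightarrow> (\<exists>C\<ge>0. \<forall>h x. 0 < h \<and> h \<le> 1 \<longrightarrow>
       \<bar>(\<integral>y. K ((x - y) / h) * f y \<partial>lborel) / h - f x\<bar> \<le> C * h powr s)"
  obtains C where "C \<ge> 0" "\<And>j h x. j < J \<Longrightarrow> 0 < h \<Longrightarrow> h \<le> 1 \<Longrightarrow>
       \<bar>mean (\<lambda>y. K ((x - y) / h)) j / h - f j x\<bar> \<le> C * h powr s" "\<And>j x. j < J \<Longrightarrow> f j x \<le> R + C"
proof -
  have "\<forall>j\<in>{..<J}. \<exists>C. C \<ge> 0 \<and> (\<forall>h x. 0 < h \<and> h \<le> 1 \<longrightarrow>
       \<bar>mean (\<lambda>y. K ((x - y) / h)) j / h - f j x\<bar> \<le> C * h powr s)"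
    unfolding mean_def using bias f_holder f_integrable by auto
  from bchoice[OF this] obtain C where C: "\<And>j. j < J \<Longrightarrow> C j \<ge> 0"
    "\<And>j h x. j < J \<Longrightarrow> 0 < h \<Longrightarrow> h \<le> 1 \<Longrightarrow> \<bar>mean (\<lambda>y. K ((x - y) / h)) j / h - f j x\<bar> \<le> C j * h powr s"
    by auto
  define C' where "C' = (\<Sum>j<J. C j)"
  have CC: "C j \<le> C'" if "j < J" for j
    unfolding C'_def using that C(1) by (intro member_le_sum) auto
  have b: "\<bar>mean (\<lambda>y. K ((x - y) / h)) j / h - f j x\<bar> \<le> C' * h powr s" if "j < J" "0 < h" "h \<le> 1" for j h x
    using C(2)[OF that, of x] mult_right_mono[OF CC[OF that(1)], of "h powr s"] by simp
  show thesis
  proof (rule that[of C'])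
    show "C' \<ge> 0" unfolding C'_def using C(1) by (intro sum_nonneg) auto
    show "f j x \<le> R + C'" if j: "j < J" for j x
    proof -
      have [measurable]: "K \<in> borel_measurable borel" by (rule Km)
      have "\<bar>mean (\<lambda>y. K ((x - y) / 1)) j\<bar> \<le> R" by (rule mean_abs_le[OF j _ K]) measurable
      then show ?thesis using b[OF j, of 1 x] by simp
    qed
  qed (rule b)
qed

text \<open>The stability bound is applied on every sample, so the expected supremum is bounded by
  finitely many expected kernel errors and expected moment errors, with no exceptional event to
  treat.\<close>

lemma estimator_expected_error:
  assumes L0: "filterlim L0 at_top sequentially"
    and R: "R \<ge> 1" and K: "\<And>u. \<bar>K u\<bar> \<le> R" "\<And>u. \<bar>u\<bar> > R \<Longrightarrow> K u = 0" "\<And>u v. \<bar>K u - K v\<bar> \<le> R * \<bar>u - v\<bar>"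
    and Kc: "continuous_on UNIV K"
    and bias: "\<forall>f\<in>holder_space s. integrable lborel f \<longrightarrow> (\<exists>C\<ge>0. \<forall>h x. 0 < h \<and> h \<le> 1 \<longrightarrow>
       \<bar>(\<integral>y. K ((x - y) / h) * f y \<partial>lborel) / h - f x\<bar> \<le> C * h powr s)"
  obtains \<tau> C where "bij_betw \<tau> {..<J} {..<J}" "C > 0"
    "eventually (\<lambda>N. \<forall>j<J. (\<integral>\<^sup>+ X. sup_dist (estimator J s L0 K R N X j) (f (\<tau> j)) \<partial>hmm_law J Q p f N)
        \<le> ennreal (C * (L0 N)\<^sup>2 * rate s N)) sequentially"
proof -
  have Km[measurable]: "K \<in> borel_measurable borel" by (rule borel_measurable_continuous_onI[OF Kc])
  obtain Cb where Cb: "Cb \<ge> 0" and bias': "\<And>j h x. j < J \<Longrightarrow> 0 < h \<Longrightarrow> h \<le> 1 \<Longrightarrow>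
       \<bar>mean (\<lambda>y. K ((x - y) / h)) j / h - f j x\<bar> \<le> Cb * h powr s"
    and fB: "\<And>j x. j < J \<Longrightarrow> f j x \<le> R + Cb"
    by (rule smoothing_bias[OF R K(1) Km bias]) (rule that)
  define B where "B = R + Cb"
  have B: "B \<ge> 0" "\<And>j x. j < J \<Longrightarrow> f j x \<le> B" using R Cb fB by (auto simp: B_def)
  define M where "M = B + Cb"
  have M: "M \<ge> 0" using B Cb by (simp add: M_def)
  obtain Cd where Cd: "Cd \<ge> 0" "\<And>N n. n = N div 3 \<Longrightarrow> n \<ge> 1 \<Longrightarrow> E N (triple_dev n) \<le> Cd / sqrt n"
    using triple_dev_expectation by blast
  obtain Cm where Cm: "Cm \<ge> 0" and mom: "\<And>N n u v w. n = N div 3 \<Longrightarrow> n \<ge> 1 \<Longrightarrow>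
    u \<in> borel_measurable borel \<Longrightarrow> v \<in> borel_measurable borel \<Longrightarrow> w \<in> borel_measurable borel \<Longrightarrow>
    (\<forall>y. \<bar>u y\<bar> \<le> 1) \<Longrightarrow> (\<forall>y. \<bar>v y\<bar> \<le> 1) \<Longrightarrow> (\<forall>y. \<bar>w y\<bar> \<le> 1) \<Longrightarrow>
    (\<integral>\<^sup>+X. ennreal \<bar>(\<Sum>i<n. block u v w i X) / n - triple_mean u v w\<bar> \<partial>hmm_law J Q p f N) \<le> ennreal (Cm / sqrt n)"
    using moment_deviation by blast
  obtain \<tau> C L where \<tau>: "bij_betw \<tau> {..<J} {..<J}" and C: "C \<ge> 0"
    and plug: "\<And>l N T \<epsilon> \<theta> j v vh M. L \<le> l \<Longrightarrow> l \<le> N \<Longrightarrow>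
      \<forall>i<l. \<forall>m<l. \<forall>n<l. \<bar>T i m n - moment i m n\<bar> \<le> \<epsilon> \<Longrightarrow> 0 \<le> \<epsilon> \<Longrightarrow>
      \<theta> \<in> best_candidates J l N T \<Longrightarrow> j < J \<Longrightarrow> \<forall>b<J. \<bar>v b\<bar> \<le> M \<Longrightarrow>
      \<bar>(\<Sum>i<l. fst \<theta> (j, i) * vh i) - v (\<tau> j)\<bar> \<le>
        real l * (\<Sum>i<l. \<bar>vh i - (\<Sum>b<J. before (halfline i) b * v b)\<bar>) + C * M * (real l ^ 5 * (\<epsilon> + 1 / real N))"
    and cand: "\<And>l N. L \<le> l \<Longrightarrow> l \<le> N \<Longrightarrow> candidates J l N \<noteq> {}"
    by (rule plug_in_stability) (rule that)
  have \<tau>J: "\<tau> j < J" if "j < J" for j using \<tau> that by (auto simp: bij_betw_def)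
  define C2 where "C2 = R * (5 + 2 * R * B + 8 * R) + 2 * R\<^sup>2 * B * Cd"
  have C2: "C2 \<ge> 0" unfolding C2_def using R B Cd by (intro add_nonneg_nonneg mult_nonneg_nonneg) auto
  define C3 where "C3 = 3 * C2 + C * M * (Cm + 1) + Cb + 1"
  have C3: "C3 > 0" unfolding C3_def using C2 C M Cm Cb by (intro add_nonneg_pos add_nonneg_nonneg mult_nonneg_nonneg) auto
  have main: "(\<integral>\<^sup>+ X. sup_dist (estimator J s L0 K R N X j) (f (\<tau> j)) \<partial>hmm_law J Q p f N)
        \<le> ennreal (C3 * (L0 N)\<^sup>2 * rate s N)"
    if as: "N \<ge> 4 \<and> ln (real N) \<ge> 1 \<and> 0 < bandwidth s N \<and> bandwidth s N \<le> 1 \<and> 0 < rate s N \<and>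
     bandwidth s N powr s = rate s N \<and> 4 * ln (real N) \<le> real (N div 3) * bandwidth s N \<and>
     sqrt (ln (real N) / (real (N div 3) * bandwidth s N)) \<le> 3 * rate s N \<and>
     ln (real N) ^ 8 / sqrt (real (N div 3)) \<le> rate s N \<and> ln (real N) ^ 5 / real N \<le> rate s N"
      and big: "L0 N \<ge> max 1 (real L)" "ln (real N) \<ge> max 1 (real L)" and j: "j < J" for N j
  proof -
    define l where "l = grid_size L0 N"
    define n where "n = N div 3"
    define h where "h = bandwidth s N"
    define r where "r = rate s N"
    have n1: "n \<ge> 1" using as unfolding n_def by linarith
    have h: "0 < h" "h \<le> 1" "h powr s = r" and r: "r > 0" using as by (auto simp: h_def r_def)
    have ln1: "ln (real N) \<ge> 1" using as by simp
    have "real l \<le> min (L0 N) (ln (real N))"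
      unfolding l_def grid_size_def using big by (intro of_nat_floor) auto
    moreover have "L \<le> l" "1 \<le> l"
      using big by (auto simp: l_def grid_size_def le_nat_iff le_floor_iff)
    ultimately have l: "L \<le> l" "1 \<le> l" "real l \<le> L0 N" "real l \<le> ln (real N)" by auto
    have lN: "l \<le> N"
    proof -
      have "ln (real N) \<le> real N" using ln_le_minus_one[of "real N"] as by simp
      then show ?thesis using l(4) by linarith
    qed
    define v where "v x y = K ((x - y) / h) / R" for x y
    have v_meas: "(\<lambda>(x, y). v x y) \<in> borel_measurable (borel \<Otimes>\<^sub>M borel)" unfolding v_def by measurable
    have v1: "\<bar>v x y\<bar> \<le> 1" for x y using K(1)[of "(x - y) / h"] R by (simp add: v_def)
    have v0: "v x y = 0" if "\<bar>x - y\<bar> > R * h" for x y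
      using that h K(2)[of "(x - y) / h"] by (simp add: v_def abs_divide less_divide_eq)
    have vl: "\<bar>v x y - v x' y\<bar> \<le> \<bar>x - x'\<bar> / h" for x x' y
    proof -
      have "\<bar>K ((x - y) / h) - K ((x' - y) / h)\<bar> \<le> R * \<bar>(x - y) / h - (x' - y) / h\<bar>" by (rule K(3))
      also have "(x - y) / h - (x' - y) / h = (x - x') / h" by (simp add: diff_divide_distrib)
      finally have "\<bar>K ((x - y) / h) - K ((x' - y) / h)\<bar> / R \<le> \<bar>x - x'\<bar> / h"
        using R h by (simp add: abs_divide divide_le_eq mult.commute)
      moreover have "v x y - v x' y = (K ((x - y) / h) - K ((x' - y) / h)) / R" by (simp add: v_def diff_divide_distrib)
      ultimately show ?thesis using R by (simp add: abs_divide)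
    qed
    define D where "D i X = (SUP x. ennreal (R / h * \<bar>(\<Sum>t<n. block (halfline i) (v x) (\<lambda>_. 1) t X) / n - triple_mean (halfline i) (v x) (\<lambda>_. 1)\<bar>))" for i X
    have Dm: "D i \<in> borel_measurable (hmm_law J Q p f N)" for i
      unfolding D_def[abs_def]
      by (rule kernel_sup_measurable[OF h(1) R B v_meas v1 v0 vl n_def halfline_measurable])
    have De: "(\<integral>\<^sup>+X. D i X \<partial>hmm_law J Q p f N) \<le> ennreal (C2 * (3 * r))" for i
    proof -
      have "(\<integral>\<^sup>+X. D i X \<partial>hmm_law J Q p f N) \<le> ennreal (C2 * sqrt (ln (real N) / (n * h)))"
        unfolding D_def C2_def
        by (rule kernel_sup_deviation[OF h(1) R B v_meas v1 v0 vl Cd n_def n1 h(2) ln1 _ halfline_measurable halfline_abs])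
          (use as in \<open>auto simp: n_def h_def\<close>)
      also have "\<dots> \<le> ennreal (C2 * (3 * r))"
        using as C2 by (intro ennreal_leI mult_left_mono) (auto simp: n_def h_def r_def)
      finally show ?thesis .
    qed
    define G where "G i m k X = ennreal \<bar>emp_moment N X i m k - moment i m k\<bar>" for i m k X
    have Gm: "G i m k \<in> borel_measurable (hmm_law J Q p f N)" for i m k
      using emp_moment_measurable[of N i m k] unfolding G_def[abs_def] by (simp add: hmm_law_def)
    have Ge: "(\<integral>\<^sup>+X. G i m k X \<partial>hmm_law J Q p f N) \<le> ennreal (Cm / sqrt n)" for i m k
      unfolding G_def emp_moment_def moment_def n_def[symmetric]
      by (intro mom n_def n1 halfline_measurable allI halfline_abs)
    define A where "A = C * M * real l ^ 5"
    have A: "A \<ge> 0" using C M by (simp add: A_def)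
    have pt: "sup_dist (estimator J s L0 K R N X j) (f (\<tau> j)) \<le>
        ennreal (real l) * (\<Sum>i<l. D i X) + ennreal A * (\<Sum>i<l. \<Sum>m<l. \<Sum>k<l. G i m k X) + ennreal (A / N + Cb * r)" for X
      unfolding sup_dist_def
    proof (rule SUP_least)
      fix x
      \<comment> \<open>The sum rather than the maximum of the moment errors, so that its
        expectation is bounded term by term.\<close>
      define \<epsilon> where "\<epsilon> = (\<Sum>i<l. \<Sum>m<l. \<Sum>k<l. \<bar>emp_moment N X i m k - moment i m k\<bar>)"
      have \<epsilon>0: "\<epsilon> \<ge> 0" unfolding \<epsilon>_def by (intro sum_nonneg) auto
      have \<epsilon>: "\<forall>i<l. \<forall>m<l. \<forall>k<l. \<bar>emp_moment N X i m k - moment i m k\<bar> \<le> \<epsilon>"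
      proof (intro allI impI)
        fix i m k assume "i < l" "m < l" "k < l"
        have "\<bar>emp_moment N X i m k - moment i m k\<bar> \<le> (\<Sum>k<l. \<bar>emp_moment N X i m k - moment i m k\<bar>)"
          using \<open>k < l\<close> by (intro member_le_sum[of k _ "\<lambda>k. \<bar>emp_moment N X i m k - moment i m k\<bar>"]) auto
        also have "\<dots> \<le> (\<Sum>m<l. \<Sum>k<l. \<bar>emp_moment N X i m k - moment i m k\<bar>)"
          using \<open>m < l\<close> by (intro member_le_sum[of m _ "\<lambda>m. \<Sum>k<l. \<bar>emp_moment N X i m k - moment i m k\<bar>"]) (auto intro!: sum_nonneg)
        also have "\<dots> \<le> \<epsilon>" unfolding \<epsilon>_def
          using \<open>i < l\<close> by (intro member_le_sum[of i _ "\<lambda>i. \<Sum>m<l. \<Sum>k<l. \<bar>emp_moment N X i m k - moment i m k\<bar>"]) (auto intro!: sum_nonneg)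
        finally show "\<bar>emp_moment N X i m k - moment i m k\<bar> \<le> \<epsilon>" .
      qed
      have \<epsilon>G: "ennreal \<epsilon> = (\<Sum>i<l. \<Sum>m<l. \<Sum>k<l. G i m k X)"
      proof -
        have "(\<Sum>i<l. \<Sum>m<l. \<Sum>k<l. G i m k X) = (\<Sum>i<l. \<Sum>m<l. ennreal (\<Sum>k<l. \<bar>emp_moment N X i m k - moment i m k\<bar>))"
          unfolding G_def by (intro sum.cong refl sum_ennreal) auto
        also have "\<dots> = (\<Sum>i<l. ennreal (\<Sum>m<l. \<Sum>k<l. \<bar>emp_moment N X i m k - moment i m k\<bar>))"
          by (intro sum.cong refl sum_ennreal sum_nonneg) auto
        also have "\<dots> = ennreal \<epsilon>"
          unfolding \<epsilon>_def by (intro sum_ennreal sum_nonneg) auto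
        finally show ?thesis by (rule sym)
      qed
      define \<theta> where "\<theta> = fitted J l N X"
      have \<theta>: "\<theta> \<in> best_candidates J l N (emp_moment N X)"
      proof -
        have "\<exists>\<theta>. \<theta> \<in> best_candidates J l N (emp_moment N X)"
          using best_candidates_nonempty[OF cand[OF l(1) lN], of "emp_moment N X"] unfolding ex_in_conv .
        from someI_ex[OF this] show ?thesis unfolding \<theta>_def fitted_def .
      qed
      \<comment> \<open>Stability is applied to the smoothed densities at x, which the kernel
        averages estimate; the bias is added afterwards.\<close>
      define w where "w b = mean (\<lambda>y. K ((x - y) / h)) b / h" for b
      have wf: "\<bar>w b - f b x\<bar> \<le> Cb * r" if "b < J" for b
        using bias'[OF that h(1,2), of x] by (simp add: w_def h(3))
      have wM: "\<forall>b<J. \<bar>w b\<bar> \<le> M"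
      proof (intro allI impI)
        fix b assume b: "b < J"
        have "r \<le> 1" using h s_pos powr_le1[of s h] by simp
        then have "Cb * r \<le> Cb" using Cb r by (simp add: mult_left_le)
        then show "\<bar>w b\<bar> \<le> M" using wf[OF b] f_nonneg[OF b, of x] B(2)[OF b, of x] by (simp add: M_def)
      qed
      have est: "estimator J s L0 K R N X j x = (\<Sum>i<l. fst \<theta> (j, i) * emp_kernel K R h N X i x)"
        by (simp add: estimator_def \<theta>_def l_def h_def)
      have diff: "ennreal \<bar>emp_kernel K R h N X i x - (\<Sum>b<J. before (halfline i) b * w b)\<bar> \<le> D i X" for i
      proof -
        have "(\<Sum>b<J. before (halfline i) b * w b) = R / h * triple_mean (halfline i) (v x) (\<lambda>_. 1)"
          unfolding triple_mean_def sum_distrib_left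
          using R by (intro sum.cong) (auto simp: w_def v_def[abs_def] mean_divide after_1)
        then have "emp_kernel K R h N X i x - (\<Sum>b<J. before (halfline i) b * w b)
            = R / h * ((\<Sum>t<n. block (halfline i) (v x) (\<lambda>_. 1) t X) / n - triple_mean (halfline i) (v x) (\<lambda>_. 1))"
          by (simp add: emp_kernel_def n_def v_def[abs_def] right_diff_distrib)
        then have eq: "\<bar>emp_kernel K R h N X i x - (\<Sum>b<J. before (halfline i) b * w b)\<bar>
            = R / h * \<bar>(\<Sum>t<n. block (halfline i) (v x) (\<lambda>_. 1) t X) / n - triple_mean (halfline i) (v x) (\<lambda>_. 1)\<bar>"
          using R h by (simp add: abs_mult)
        show ?thesis unfolding D_def eq by (rule SUP_upper) simp
      qed
      have "\<bar>estimator J s L0 K R N X j x - w (\<tau> j)\<bar> \<le>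
         real l * (\<Sum>i<l. \<bar>emp_kernel K R h N X i x - (\<Sum>b<J. before (halfline i) b * w b)\<bar>) + C * M * (real l ^ 5 * (\<epsilon> + 1 / real N))"
        unfolding est by (rule plug[OF l(1) lN \<epsilon> \<epsilon>0 \<theta> j wM])
      also have "C * M * (real l ^ 5 * (\<epsilon> + 1 / real N)) = A * \<epsilon> + A / N" by (simp add: A_def algebra_simps)
      finally have "\<bar>estimator J s L0 K R N X j x - f (\<tau> j) x\<bar> \<le>
         real l * (\<Sum>i<l. \<bar>emp_kernel K R h N X i x - (\<Sum>b<J. before (halfline i) b * w b)\<bar>) + A * \<epsilon> + (A / N + Cb * r)"
        using wf[OF \<tau>J[OF j]] by linarith
      then have "ennreal \<bar>estimator J s L0 K R N X j x - f (\<tau> j) x\<bar> \<le>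
         ennreal (real l * (\<Sum>i<l. \<bar>emp_kernel K R h N X i x - (\<Sum>b<J. before (halfline i) b * w b)\<bar>) + A * \<epsilon> + (A / N + Cb * r))"
        by (rule ennreal_leI)
      also have "\<dots> = ennreal (real l) * (\<Sum>i<l. ennreal \<bar>emp_kernel K R h N X i x - (\<Sum>b<J. before (halfline i) b * w b)\<bar>)
          + ennreal A * ennreal \<epsilon> + ennreal (A / N + Cb * r)"
        using A \<epsilon>0 Cb r by (simp add: ennreal_plus ennreal_mult sum_nonneg sum_ennreal)
      also have "\<dots> \<le> ennreal (real l) * (\<Sum>i<l. D i X) + ennreal A * ennreal \<epsilon> + ennreal (A / N + Cb * r)"
        by (intro add_right_mono mult_left_mono sum_mono diff) auto
      finally show "ennreal \<bar>estimator J s L0 K R N X j x - f (\<tau> j) x\<bar> \<le>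
        ennreal (real l) * (\<Sum>i<l. D i X) + ennreal A * (\<Sum>i<l. \<Sum>m<l. \<Sum>k<l. G i m k X) + ennreal (A / N + Cb * r)"
        unfolding \<epsilon>G .
    qed
    have N1: "N \<ge> 1" using as by simp
    have total1: "emeasure (hmm_law J Q p f N) (space (hmm_law J Q p f N)) \<le> 1"
    proof -
      have "(\<integral>\<^sup>+X. 1 \<partial>hmm_law J Q p f N) \<le> ennreal (E N (\<lambda>_. 1))"
        by (rule nn_integral_law_le[OF N1]) (simp_all add: prob_space.emeasure_space_1[OF prob_space_given_states])
      then show ?thesis by (simp add: E_const[OF N1])
    qed
    have "(\<integral>\<^sup>+ X. sup_dist (estimator J s L0 K R N X j) (f (\<tau> j)) \<partial>hmm_law J Q p f N)
       \<le> (\<integral>\<^sup>+ X. ennreal (real l) * (\<Sum>i<l. D i X) + ennreal A * (\<Sum>i<l. \<Sum>m<l. \<Sum>k<l. G i m k X) + ennreal (A / N + Cb * r) \<partial>hmm_law J Q p f N)"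
      by (intro nn_integral_mono pt)
    also have "\<dots> = ennreal (real l) * (\<Sum>i<l. \<integral>\<^sup>+X. D i X \<partial>hmm_law J Q p f N)
        + ennreal A * (\<Sum>i<l. \<Sum>m<l. \<Sum>k<l. \<integral>\<^sup>+X. G i m k X \<partial>hmm_law J Q p f N)
        + ennreal (A / N + Cb * r) * emeasure (hmm_law J Q p f N) (space (hmm_law J Q p f N))"
    proof -
      note [measurable] = Dm Gm
      show ?thesis by (simp add: nn_integral_add nn_integral_cmult nn_integral_sum)
    qed
    also have "\<dots> \<le> ennreal (real l) * (\<Sum>i<l. ennreal (C2 * (3 * r)))
        + ennreal A * (\<Sum>i<l. \<Sum>m<l. \<Sum>k<l. ennreal (Cm / sqrt n)) + ennreal (A / N + Cb * r) * 1"
      by (intro add_mono mult_left_mono sum_mono De Ge total1) auto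
    also have "\<dots> = ennreal (real l * (real l * (C2 * (3 * r))) + A * (real l * (real l * (real l * (Cm / sqrt n)))) + (A / N + Cb * r))"
    proof -
      have sums: "(\<Sum>i<l. ennreal q) = ennreal (real l * q)" if "q \<ge> 0" for q
        using that by (subst sum_ennreal) auto
      have q: "C2 * (3 * r) \<ge> 0" "Cm / sqrt n \<ge> 0" "A / N + Cb * r \<ge> 0"
        using C2 r Cm A Cb by auto
      show ?thesis
        using q A by (simp only: sums mult_nonneg_nonneg of_nat_0_le_iff mult_1_right
            ennreal_mult[symmetric] ennreal_plus[symmetric] add_nonneg_nonneg)
    qed
    \<comment> \<open>Only the kernel term needs l^2: one l is the weight of a coefficient, the
      other the number of test functions. The moment and grid terms are at most multiples of
      r.\<close>
    also have "\<dots> \<le> ennreal (C3 * (real l)\<^sup>2 * r)"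
    proof (rule ennreal_leI)
      have l1: "real l \<ge> 1" using l by simp
      have sqn: "sqrt n > 0" using n1 by simp
      have "real l ^ 8 / sqrt n \<le> ln (real N) ^ 8 / sqrt n"
        using l sqn by (intro divide_right_mono power_mono) auto
      also have "\<dots> \<le> r" using as by (simp add: n_def r_def)
      finally have p8: "real l ^ 8 / sqrt n \<le> r" .
      have "real l ^ 5 / N \<le> ln (real N) ^ 5 / N" using l by (intro divide_right_mono power_mono) auto
      also have "\<dots> \<le> r" using as by (simp add: r_def)
      finally have p5: "real l ^ 5 / N \<le> r" .
      have rl: "r \<le> (real l)\<^sup>2 * r" using l1 r by (simp add: one_le_power)
      have "A * (real l * (real l * (real l * (Cm / sqrt n)))) = C * M * Cm * (real l ^ 8 / sqrt n)"
        by (simp add: A_def power_numeral_reduce)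
      also have "\<dots> \<le> C * M * Cm * ((real l)\<^sup>2 * r)" using p8 rl C M Cm by (intro mult_left_mono) auto
      finally have 1: "A * (real l * (real l * (real l * (Cm / sqrt n)))) \<le> C * M * Cm * ((real l)\<^sup>2 * r)" .
      have "A / N = C * M * (real l ^ 5 / N)" by (simp add: A_def)
      also have "\<dots> \<le> C * M * ((real l)\<^sup>2 * r)" using p5 rl C M by (intro mult_left_mono) auto
      finally have 2: "A / N \<le> C * M * ((real l)\<^sup>2 * r)" .
      have 3: "Cb * r \<le> Cb * ((real l)\<^sup>2 * r)" using rl Cb by (rule mult_left_mono)
      have 4: "real l * (real l * (C2 * (3 * r))) = 3 * C2 * ((real l)\<^sup>2 * r)" by (simp add: power2_eq_square)
      have 5: "0 \<le> (real l)\<^sup>2 * r" using r by simp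
      have "C3 * (real l)\<^sup>2 * r = 3 * C2 * ((real l)\<^sup>2 * r) + C * M * Cm * ((real l)\<^sup>2 * r) + C * M * ((real l)\<^sup>2 * r)
         + Cb * ((real l)\<^sup>2 * r) + (real l)\<^sup>2 * r" by (simp add: C3_def algebra_simps)
      then show "real l * (real l * (C2 * (3 * r))) + A * (real l * (real l * (real l * (Cm / sqrt n)))) + (A / N + Cb * r) \<le> C3 * (real l)\<^sup>2 * r"
        using 1 2 3 4 5 by linarith
    qed
    also have "\<dots> \<le> ennreal (C3 * (L0 N)\<^sup>2 * r)"
      using C3 r l by (intro ennreal_leI mult_right_mono mult_left_mono power_mono) auto
    finally show ?thesis by (simp add: r_def)
  qed
  have ev1: "eventually (\<lambda>N. L0 N \<ge> max 1 (real L)) sequentially"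
    using L0 unfolding filterlim_at_top by blast
  have "filterlim (\<lambda>N. ln (real N)) at_top sequentially" by real_asymp
  then have ev2: "eventually (\<lambda>N. ln (real N) \<ge> max 1 (real L)) sequentially"
    unfolding filterlim_at_top by blast
  show thesis
  proof (rule that[OF \<tau> C3])
    show "eventually (\<lambda>N. \<forall>j<J. (\<integral>\<^sup>+ X. sup_dist (estimator J s L0 K R N X j) (f (\<tau> j)) \<partial>hmm_law J Q p f N)
        \<le> ennreal (C3 * (L0 N)\<^sup>2 * rate s N)) sequentially"
      using rate_asymptotics[OF s_pos] ev1 ev2
      by eventually_elim (intro allI impI main)
  qed
qed

end

theorem theorem5:
  fixes J :: nat and s :: real and L0 :: "nat \<Rightarrow> real"
  assumes "J \<ge> 2" and "s > 0"
    and "filterlim L0 at_top sequentially"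
    and "(\<lambda>N. L0 N powr (max 5 ((real J + 3) / 2)) * rate s N) \<longlonglongrightarrow> 0"
  shows "\<exists>fh. valid_estimator J fh \<and>
    (\<forall>Q p f. hmm_params J s Q p f \<longrightarrow>
      (\<exists>\<tau>. bij_betw \<tau> {..<J} {..<J} \<and>
        (\<exists>C>0. \<forall>j<J.
          (\<lambda>N. measure (hmm_law J Q p f N)
             {X \<in> space (hmm_law J Q p f N).
                ennreal (C * L0 N ^ 5 * rate s N) \<le> sup_dist (fh N X j) (f (\<tau> j))}) \<longlonglongrightarrow> 0) \<and>
        (\<exists>C'>0. \<forall>j<J. eventually (\<lambda>N.
          (\<integral>\<^sup>+ X. sup_dist (fh N X j) (f (\<tau> j)) \<partial>hmm_law J Q p f N)
             \<le> ennreal (C' * L0 N ^ 5 * rate s N)) sequentially)))"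
proof -
  note s = assms(2) and L0 = assms(3)
  obtain K R where R: "R \<ge> 1"
    and K: "\<And>u. \<bar>K u\<bar> \<le> R" "\<And>u. \<bar>u\<bar> > R \<Longrightarrow> K u = 0" "\<And>u v. \<bar>K u - K v\<bar> \<le> R * \<bar>u - v\<bar>"
    and bias: "\<forall>f\<in>holder_space s. integrable lborel f \<longrightarrow> (\<exists>C\<ge>0. \<forall>h x. 0 < h \<and> h \<le> 1 \<longrightarrow>
       \<bar>(\<integral>y. K ((x - y) / h) * f y \<partial>lborel) / h - f x\<bar> \<le> C * h powr s)"
    by (rule higher_order_kernel[OF s]) (rule that)
  have "R-lipschitz_on UNIV K" using K(3) R by (intro lipschitz_onI) (auto simp: dist_real_def)
  then have Kc: "continuous_on UNIV K" by (rule lipschitz_on_continuous_on)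
  show ?thesis
  \<comment> \<open>The witness is fixed before Q, p and f: the kernel and R come from s alone, the
    tuning from L0 and N.\<close>
  proof (intro exI[of _ "estimator J s L0 K R"] conjI allI impI valid_estimator_estimator[OF Kc])
    fix Q p f assume params: "hmm_params J s Q p f"
    interpret hmm J s Q p f by standard (fact params, fact s)
    obtain \<tau> C where \<tau>: "bij_betw \<tau> {..<J} {..<J}" and C: "C > 0"
      and err: "eventually (\<lambda>N. \<forall>j<J. (\<integral>\<^sup>+ X. sup_dist (estimator J s L0 K R N X j) (f (\<tau> j)) \<partial>hmm_law J Q p f N)
        \<le> ennreal (C * (L0 N)\<^sup>2 * rate s N)) sequentially"
      by (rule estimator_expected_error[OF L0 R K Kc bias]) (assumption | rule that)+
    have L1: "eventually (\<lambda>N. L0 N \<ge> 1) sequentially" using L0 by (simp add: filterlim_at_top)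
    have rpos: "eventually (\<lambda>N. rate s N > 0) sequentially"
      using rate_asymptotics[OF s] by eventually_elim auto
    have prob: "(\<lambda>N. measure (hmm_law J Q p f N) {X \<in> space (hmm_law J Q p f N).
          ennreal (1 * L0 N ^ 5 * rate s N) \<le> sup_dist (estimator J s L0 K R N X j) (f (\<tau> j))}) \<longlonglongrightarrow> 0"
      if j: "j < J" for j
    proof (rule tendsto_sandwich[OF _ _ tendsto_const])
      show "eventually (\<lambda>N. 0 \<le> measure (hmm_law J Q p f N) {X \<in> space (hmm_law J Q p f N).
          ennreal (1 * L0 N ^ 5 * rate s N) \<le> sup_dist (estimator J s L0 K R N X j) (f (\<tau> j))}) sequentially"
        by simp
      show "eventually (\<lambda>N. measure (hmm_law J Q p f N) {X \<in> space (hmm_law J Q p f N).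
          ennreal (1 * L0 N ^ 5 * rate s N) \<le> sup_dist (estimator J s L0 K R N X j) (f (\<tau> j))} \<le> C * inverse (L0 N)) sequentially"
        using err L1 rpos
      proof eventually_elim
        case (elim N)
        let ?M = "hmm_law J Q p f N" and ?F = "\<lambda>X. sup_dist (estimator J s L0 K R N X j) (f (\<tau> j))"
        let ?a = "1 * L0 N ^ 5 * rate s N"
        let ?A = "{X \<in> space ?M. ennreal ?a \<le> ?F X}"
        have a: "?a > 0" using elim by simp
        show ?case
        \<comment> \<open>For a set outside the sigma-algebra \<open>measure\<close> is 0 by
          convention; for a measurable event Markov's inequality applies.\<close>
        proof (cases "?A \<in> sets ?M")
          case True
          have "ennreal ?a * emeasure ?M ?A = (\<integral>\<^sup>+X. ennreal ?a * indicator ?A X \<partial>?M)"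
            using True by (simp add: nn_integral_cmult_indicator)
          also have "\<dots> \<le> (\<integral>\<^sup>+X. ?F X \<partial>?M)"
            by (intro nn_integral_mono) (auto simp: indicator_def)
          also have "\<dots> \<le> ennreal (C * (L0 N)\<^sup>2 * rate s N)" using elim j by blast
          also have "\<dots> \<le> ennreal (?a * (C * inverse (L0 N)))"
          proof (rule ennreal_leI)
            \<comment> \<open>Markov's inequality leaves the quotient L0^2 / L0^5; the weaker factor
              1 / L0 already tends to 0.\<close>
            have "L0 N ^ 2 \<le> L0 N ^ 4" using elim by (intro power_increasing) auto
            then have "C * rate s N * L0 N ^ 2 \<le> C * rate s N * L0 N ^ 4"
              using C elim by (intro mult_left_mono) auto
            also have "\<dots> = ?a * (C * inverse (L0 N))" using elim by (simp add: power_numeral_reduce)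
            finally show "C * (L0 N)\<^sup>2 * rate s N \<le> ?a * (C * inverse (L0 N))" by (simp add: mult.commute mult.left_commute)
          qed
          also have "\<dots> = ennreal ?a * ennreal (C * inverse (L0 N))"
            using a C elim by (intro ennreal_mult) auto
          finally have "emeasure ?M ?A \<le> ennreal (C * inverse (L0 N))"
            using a by (subst (asm) ennreal_mult_le_mult_iff) auto
          then show ?thesis using C elim by (simp add: measure_def enn2real_leI)
        next
          case False
          then have "measure ?M ?A = 0" by (simp add: measure_def emeasure_notin_sets)
          then show ?thesis using C elim by simp
        qed
      qed
      have "(\<lambda>N. inverse (L0 N)) \<longlonglongrightarrow> 0" by (rule tendsto_inverse_0_at_top[OF L0])
      then show "(\<lambda>N. C * inverse (L0 N)) \<longlonglongrightarrow> 0" by (rule tendsto_mult_right_zero)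
    qed
    have expect: "eventually (\<lambda>N. (\<integral>\<^sup>+ X. sup_dist (estimator J s L0 K R N X j) (f (\<tau> j)) \<partial>hmm_law J Q p f N)
             \<le> ennreal (C * L0 N ^ 5 * rate s N)) sequentially" if j: "j < J" for j
      using err L1 rpos
    proof eventually_elim
      case (elim N)
      have "L0 N ^ 2 \<le> L0 N ^ 5" using elim by (intro power_increasing) auto
      then have "C * (L0 N)\<^sup>2 * rate s N \<le> C * L0 N ^ 5 * rate s N"
        using C elim by (intro mult_right_mono mult_left_mono) auto
      then show ?case using elim j by (meson ennreal_leI order_trans)
    qed
    show "\<exists>\<tau>. bij_betw \<tau> {..<J} {..<J} \<and>
        (\<exists>C>0. \<forall>j<J.
          (\<lambda>N. measure (hmm_law J Q p f N)
             {X \<in> space (hmm_law J Q p f N).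
                ennreal (C * L0 N ^ 5 * rate s N) \<le> sup_dist (estimator J s L0 K R N X j) (f (\<tau> j))}) \<longlonglongrightarrow> 0) \<and>
        (\<exists>C'>0. \<forall>j<J. eventually (\<lambda>N.
          (\<integral>\<^sup>+ X. sup_dist (estimator J s L0 K R N X j) (f (\<tau> j)) \<partial>hmm_law J Q p f N)
             \<le> ennreal (C' * L0 N ^ 5 * rate s N)) sequentially)"
    proof (rule exI[of _ \<tau>], intro conjI \<tau>)
      show "\<exists>C>0. \<forall>j<J.
          (\<lambda>N. measure (hmm_law J Q p f N)
             {X \<in> space (hmm_law J Q p f N).
                ennreal (C * L0 N ^ 5 * rate s N) \<le> sup_dist (estimator J s L0 K R N X j) (f (\<tau> j))}) \<longlonglongrightarrow> 0"
        by (rule exI[of _ 1]) (use prob in simp)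
      show "\<exists>C'>0. \<forall>j<J. eventually (\<lambda>N.
          (\<integral>\<^sup>+ X. sup_dist (estimator J s L0 K R N X j) (f (\<tau> j)) \<partial>hmm_law J Q p f N)
             \<le> ennreal (C' * L0 N ^ 5 * rate s N)) sequentially"
        by (rule exI[of _ C]) (use C expect in blast)
    qed
  qed
qed

end
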